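(* Let $H\in(0,1)$, let $\lambda,\sigma>0$ and let $(Y_t)_{t\ge0}$ be the stationary one-dimensional fractional Ornstein–Uhlenbeck process solution to $$dY_t=-\lambda Y_t\,dt+\sigma\,dB_t^H,$$ where $B^H$ is a fractional Brownian motion with Hurst parameter $H$. Let $\nu$ be the law of $Y_0$ (first marginal of the invariant distribution), and $\nu_t=\frac1t\int_0^t\delta_{Y_s}ds$. Then for any $q>0$ and $t_0>0$ there is a constant $C_0\in(0,\infty)$ such that $$\mathbb E\,|\nu_t(A)-\nu(A)|\le C_0\min\Big(\nu(A),\frac{\nu(A)^{1/2}}{t^\gamma}\Big)\quad\text{for all }t\ge t_0\text{ and all Borel }A\subset\mathbb R,\qquad\text{and}\qquad\int|\xi|^q\nu(d\xi)<+\infty,$$ with $\gamma=\frac12$ if $H\le\frac12$ and $\gamma=1-H$ if $H>\frac12$. Thus, for every $p>0$ and $t_0>0$ there is a constant $C$ such that for every $t\ge t_0$ $$\|\mathcal W_p(\nu_t,\nu)\|_p\le C\,t^{-\frac1p\left(\frac12\wedge(1-H)\right)}.$$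
   Context: For $p>0$, $\mathcal W_p(\mu,\nu)=\inf_\varpi(\int|x-y|^p\varpi(dx,dy))^{1/p}$ over couplings $\varpi$ of $\mu$ and $\nu$; $\|Z\|_p=(\mathbb E|Z|^p)^{1/p}$; $a\wedge b=\min(a,b)$. *)

theory Defs
  imports "HOL-Probability.Probability"
begin

text \<open>A real Gaussian law may be degenerate, so variance 0 is allowed.\<close>

definition gaussian_law :: "real \<Rightarrow> real \<Rightarrow> real measure" where
  "gaussian_law m v =
    (if v = 0 then return borel m else density lborel (\<lambda>x. ennreal (normal_density m (sqrt v) x)))"

definition gaussian_process :: "'a measure \<Rightarrow> real set \<Rightarrow> (real \<Rightarrow> 'a \<Rightarrow> real) \<Rightarrow> bool" where
  "gaussian_process M I X \<longleftrightarrow>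
    (\<forall>t\<in>I. X t \<in> borel_measurable M) \<and>
    (\<forall>J c. finite J \<longrightarrow> J \<subseteq> I \<longrightarrow>
      (\<exists>m v. 0 \<le> v \<and> distr M borel (\<lambda>\<omega>. \<Sum>t\<in>J. c t * X t \<omega>) = gaussian_law m v))"

definition fractional_brownian_motion ::
    "'a measure \<Rightarrow> real \<Rightarrow> (real \<Rightarrow> 'a \<Rightarrow> real) \<Rightarrow> bool" where
  "fractional_brownian_motion M H B \<longleftrightarrow>
    gaussian_process M {0..} B \<and>
    (\<forall>t\<ge>0. prob_space.expectation M (B t) = 0) \<and>
    (\<forall>s\<ge>0. \<forall>t\<ge>0. prob_space.expectation M (\<lambda>\<omega>. B s \<omega> * B t \<omega>) =
      (s powr (2 * H) + t powr (2 * H) - \<bar>t - s\<bar> powr (2 * H)) / 2) \<and>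
    (AE \<omega> in M. continuous_on {0..} (\<lambda>t. B t \<omega>))"

definition stationary_process :: "'a measure \<Rightarrow> (real \<Rightarrow> 'a \<Rightarrow> real) \<Rightarrow> bool" where
  "stationary_process M Y \<longleftrightarrow>
    (\<forall>t\<ge>0. Y t \<in> borel_measurable M) \<and>
    (\<forall>J h. finite J \<longrightarrow> J \<subseteq> {0..} \<longrightarrow> 0 \<le> h \<longrightarrow>
      distr M (Pi\<^sub>M J (\<lambda>_. borel)) (\<lambda>\<omega>. \<lambda>t\<in>J. Y (t + h) \<omega>) =
      distr M (Pi\<^sub>M J (\<lambda>_. borel)) (\<lambda>\<omega>. \<lambda>t\<in>J. Y t \<omega>))"

text \<open>The noise is additive, so the equation is read pathwise in integrated form. No relation
  between \<open>Y 0\<close> and \<open>B\<close> is imposed here: the stationary solution is not started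
  independently of the noise.\<close>

definition fractional_OU ::
    "'a measure \<Rightarrow> real \<Rightarrow> real \<Rightarrow> (real \<Rightarrow> 'a \<Rightarrow> real) \<Rightarrow> (real \<Rightarrow> 'a \<Rightarrow> real) \<Rightarrow> bool" where
  "fractional_OU M lam sig B Y \<longleftrightarrow>
    (\<forall>t\<ge>0. Y t \<in> borel_measurable M) \<and>
    (AE \<omega> in M. continuous_on {0..} (\<lambda>t. Y t \<omega>) \<and>
      (\<forall>t\<ge>0. Y t \<omega> = Y 0 \<omega> - lam * integral {0..t} (\<lambda>s. Y s \<omega>) + sig * B t \<omega>))"

text \<open>The occupation measure \<open>(1/t) \<integral>\<^sub>0\<^sup>t \<delta>\<^bsub>Y\<^sub>s(\<omega>)\<^esub> ds\<close>. Restricting the space (rather than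
  normalising \<open>lborel\<close> on the whole line) keeps the values of \<open>Y\<close> at negative
  times, which are arbitrary and possibly non-measurable, out of the definition.\<close>

definition occupation_measure :: "(real \<Rightarrow> 'a \<Rightarrow> real) \<Rightarrow> real \<Rightarrow> 'a \<Rightarrow> real measure" where
  "occupation_measure Y t \<omega> =
    scale_measure (ennreal (1 / t)) (distr (restrict_space lborel {0..t}) borel (\<lambda>s. Y s \<omega>))"

definition couplings :: "real measure \<Rightarrow> real measure \<Rightarrow> (real \<times> real) measure set" where
  "couplings \<mu> \<nu> =
    {\<pi>. sets \<pi> = sets (borel \<Otimes>\<^sub>M borel) \<and> distr \<pi> borel fst = \<mu> \<and> distr \<pi> borel snd = \<nu>}"

text \<open>Real powers on \<open>[0,\<infinity>]\<close>, meant for exponents \<open>a > 0\<close>.\<close>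

definition ennpowr :: "ennreal \<Rightarrow> real \<Rightarrow> ennreal" where
  "ennpowr x a = (if x = \<infinity> then \<infinity> else ennreal (enn2real x powr a))"

definition wasserstein :: "real \<Rightarrow> real measure \<Rightarrow> real measure \<Rightarrow> ennreal" where
  "wasserstein p \<mu> \<nu> =
    (INF \<pi>\<in>couplings \<mu> \<nu>. ennpowr (\<integral>\<^sup>+(x, y). ennreal (\<bar>x - y\<bar> powr p) \<partial>\<pi>) (1 / p))"

definition Lp_norm :: "'a measure \<Rightarrow> real \<Rightarrow> ('a \<Rightarrow> ennreal) \<Rightarrow> ennreal" where
  "Lp_norm M p Z = ennpowr (\<integral>\<^sup>+\<omega>. ennpowr (Z \<omega>) p \<partial>M) (1 / p)"

end

theory Submission
  imports Defs
begin

text \<open>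
  Write \<open>v\<close> for the variance of \<open>Y 0\<close>, \<open>\<rho>\<close> for the autocovariance of \<open>Y\<close>, and \<open>\<nu>\<^sub>t\<close> for the
  occupation measure.

  \<^bold>\<open>Gaussianity.\<close> The equation integrates to \<open>Y\<^sub>t = exp (- lam t) Y\<^sub>0 + Z\<^sub>t\<close> with \<open>Z\<^sub>t\<close> a limit of linear
  combinations of \<open>B\<close>. Neither the law of \<open>Y\<^sub>0\<close> nor its dependence on \<open>B\<close> is prescribed, but by stationarity a linear combination of \<open>Y\<^sub>s\<close> and
  \<open>Y\<^sub>u\<close> has the same law at times \<open>s + n\<close>, \<open>u + n\<close>, where the contribution of \<open>Y\<^sub>0\<close> has died out as \<open>n\<close>
  grows. So it is a limit of centred Gaussian variables, hence one itself (\<open>X_pair_gaussian\<close>).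

  \<^bold>\<open>Decay of correlations.\<close> Computing the variance of \<open>sig B\<^sub>t = Y\<^sub>t - Y\<^sub>0 + lam \<integral>\<^sub>0\<^sup>t Y\<close> in terms of \<open>\<rho>\<close> gives
  \<open>\<rho>(t) = v - sig\<^sup>2 t powr (2H) / 2 + lam\<^sup>2 \<integral>\<^sub>0\<^sup>t \<integral>\<^sub>0\<^sup>s \<rho>\<close>, that is
  \<open>\<rho>'' = lam\<^sup>2 \<rho> - sig\<^sup>2 H (2H - 1) t powr (2H - 2)\<close>. By a maximum principle a bounded solution decays at
  least as fast as the forcing term. The same identity shows \<open>1 - (\<rho>(t)/v)\<^sup>2 \<ge> c t powr (2H)\<close> for small
  \<open>t > 0\<close>; this extends to bounded intervals because perfect correlation at one lag would propagate to all its
  multiples, against the decay (\<open>autocov_decay\<close>, \<open>correlation_gap\<close>).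

  \<^bold>\<open>Variance of \<open>\<nu>\<^sub>t(A)\<close>.\<close> It is the mean over \<open>[0,t]\<^sup>2\<close> of \<open>Cov(1\<^sub>A(Y\<^sub>s), 1\<^sub>A(Y\<^sub>u))\<close>. For small correlation \<open>r\<close>
  the bivariate normal density differs from the product density by at most
  \<open>C \<bar>r\<bar> exp(-(x\<^sup>2 + y\<^sup>2) / (3v))\<close>, so the covariance is at most \<open>C \<bar>r\<bar> (\<integral>\<^sub>A exp(-x\<^sup>2/(3v)) dx)\<^sup>2\<close>, which the
  Cauchy--Schwarz inequality bounds by \<open>C' \<bar>r\<bar> \<nu>(A)\<close>. As \<open>\<integral>\<^sub>0\<^sup>t \<bar>\<rho>\<bar>\<close> is at most of order \<open>t powr (1 - 2\<gamma>)\<close>, this is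
  the estimate on \<open>\<bar>\<nu>\<^sub>t(A) - \<nu>(A)\<bar>\<close>.

  \<^bold>\<open>Wasserstein distance.\<close> Summing the bound with \<open>sqrt (\<nu>(A))\<close> over ever finer partitions gives the claimed rate only when
  \<open>p > 1/2\<close>. For all \<open>p\<close> at once one needs a bound that is linear in the size of a small cell, namely
  \<open>E \<bar>\<nu>\<^sub>t(A) - \<nu>(A)\<bar> \<le> C t powr (-\<gamma>) \<integral>\<^sub>A exp(-x\<^sup>2/(4v)) dx\<close>. It holds because the pair density at a lag \<open>u\<close> in a
  bounded interval is at most \<open>C u powr (-H) exp(-(x\<^sup>2 + y\<^sup>2) / (4v))\<close>, and \<open>u powr (-H)\<close> is integrable at \<open>0\<close>. Cut the line into
  cells of length \<open>d = t powr (-\<gamma>/p)\<close> and couple \<open>\<nu>\<^sub>t\<close> with \<open>\<nu>\<close> by keeping the common mass of each cell inside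
  that cell. This costs at most \<open>d powr p = t powr (-\<gamma>)\<close>, and the remaining mass costs a weighted sum of
  \<open>\<bar>\<nu>\<^sub>t(A) - \<nu>(A)\<bar>\<close> over the cells \<open>A\<close>, whose mean is \<open>t powr (-\<gamma>)\<close> times a finite Gaussian moment.
\<close>

section \<open>Gaussian laws and characteristic functions\<close>

lemma char_std_normal: "char std_normal_distribution t = exp (- (t\<^sup>2) / 2)"
  using char_std_normal_distribution by (simp add: fun_eq_iff)

lemma gaussian_law_eq_distr:
  assumes "0 \<le> v"
  shows "gaussian_law m v = distr std_normal_distribution borel (\<lambda>x. m + sqrt v * x)"
proof (cases "v = 0")
  case True
  interpret real_distribution std_normal_distribution by (rule real_dist_normal_dist)
  show ?thesis using True by (simp add: gaussian_law_def)
next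
  case False
  then have s: "0 < sqrt v" using assms by auto
  interpret real_distribution std_normal_distribution by (rule real_dist_normal_dist)
  have "distributed std_normal_distribution lborel (\<lambda>x. x) std_normal_density"
    unfolding distributed_def by (auto simp: distr_id2)
  from normal_density_affine[OF this, of "sqrt v" m] s
  have "distributed std_normal_distribution lborel (\<lambda>x. m + sqrt v * x) (normal_density m (sqrt v))"
    by simp
  then have "distr std_normal_distribution lborel (\<lambda>x. m + sqrt v * x) = density lborel (normal_density m (sqrt v))"
    by (simp add: distributed_def)
  moreover have "distr std_normal_distribution lborel (\<lambda>x. m + sqrt v * x) = distr std_normal_distribution borel (\<lambda>x. m + sqrt v * x)"
    by (rule distr_cong) auto
  ultimately show ?thesis using False by (simp add: gaussian_law_def)
qed

lemma real_distribution_gaussian_law: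
  assumes "0 \<le> v" shows "real_distribution (gaussian_law m v)"
proof -
  interpret real_distribution std_normal_distribution by (rule real_dist_normal_dist)
  show ?thesis unfolding gaussian_law_eq_distr[OF assms]
    by (intro real_distribution_distr) auto
qed

lemma char_gaussian_law:
  assumes "0 \<le> v"
  shows "char (gaussian_law m v) t = iexp (m * t) * of_real (exp (- (v * t\<^sup>2) / 2))"
proof -
  interpret real_distribution std_normal_distribution by (rule real_dist_normal_dist)
  have "char (gaussian_law m v) t = (CLINT x|std_normal_distribution. iexp (t * (m + sqrt v * x)))"
    unfolding gaussian_law_eq_distr[OF assms] char_def by (subst integral_distr) auto
  also have "\<dots> = (CLINT x|std_normal_distribution. iexp (m * t) * iexp ((sqrt v * t) * x))"
    by (intro Bochner_Integration.integral_cong refl) (simp add: exp_add[symmetric] algebra_simps)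
  also have "\<dots> = iexp (m * t) * char std_normal_distribution (sqrt v * t)"
    unfolding char_def by simp
  also have "\<dots> = iexp (m * t) * of_real (exp (- (v * t\<^sup>2) / 2))"
    using assms by (simp add: char_std_normal power_mult_distrib)
  finally show ?thesis .
qed

lemma
  assumes "0 \<le> v"
  shows integrable_gaussian_law: "integrable (gaussian_law m v) (\<lambda>x. x)"
    and integral_gaussian_law: "integral\<^sup>L (gaussian_law m v) (\<lambda>x. x) = m"
    and integrable_gaussian_law_sq: "integrable (gaussian_law 0 v) (\<lambda>x. x\<^sup>2)"
    and integral_gaussian_law_sq: "integral\<^sup>L (gaussian_law 0 v) (\<lambda>x. x\<^sup>2) = v"
proof -
  interpret real_distribution std_normal_distribution by (rule real_dist_normal_dist)
  have i1: "integrable std_normal_distribution (\<lambda>x. x)"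
    using integrable_std_normal_distribution_moment[of 1] by simp
  have i3: "integrable std_normal_distribution (\<lambda>x. m + sqrt v * x)"
    using i1 by simp
  have i2: "integrable std_normal_distribution (\<lambda>x. x\<^sup>2)"
    using integrable_std_normal_distribution_moment[of 2] by simp
  have e1: "(LINT x|std_normal_distribution. x) = 0"
    using integral_std_normal_distribution_moment_odd[of 1] by simp
  have e2: "(LINT x|std_normal_distribution. x\<^sup>2) = 1"
    using std_normal_distribution_even_moments(1)[of 1] by (simp add: eval_nat_numeral)
  have e3: "(LINT x|std_normal_distribution. m + sqrt v * x) = m"
  proof -
    have "(LINT x|std_normal_distribution. m + sqrt v * x)
        = (LINT x|std_normal_distribution. m) + (LINT x|std_normal_distribution. sqrt v * x)"
      by (rule Bochner_Integration.integral_add) (use i1 in simp_all)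
    also have "(LINT x|std_normal_distribution. m) = m" using prob_space by (simp only: lebesgue_integral_const) simp
    finally show ?thesis using e1 by simp
  qed
  have i4: "integrable std_normal_distribution (\<lambda>x. (0 + sqrt v * x)\<^sup>2)"
    using i2 by (simp add: power_mult_distrib)
  have e4: "(LINT x|std_normal_distribution. (0 + sqrt v * x)\<^sup>2) = v"
    using assms e2 by (simp add: power_mult_distrib)
  note * = gaussian_law_eq_distr[OF assms]
  show "integrable (gaussian_law m v) (\<lambda>x. x)"
    unfolding * by (subst integrable_distr_eq) (simp_all add: i3)
  show "integral\<^sup>L (gaussian_law m v) (\<lambda>x. x) = m"
    unfolding * by (subst integral_distr) (simp_all only: e3, simp_all)
  show "integrable (gaussian_law 0 v) (\<lambda>x. x\<^sup>2)"
    unfolding * by (subst integrable_distr_eq) (simp_all only: i4, simp_all)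
  show "integral\<^sup>L (gaussian_law 0 v) (\<lambda>x. x\<^sup>2) = v"
    unfolding * by (subst integral_distr) (simp_all only: e4, simp_all)
qed

text \<open>Only pointwise convergence of the characteristic functions is assumed, not that of the variances: at some
  \<open>t \<noteq> 0\<close> the limit does not vanish, and taking logarithms there makes the variances converge.\<close>

lemma char_limit_gaussian:
  assumes M: "real_distribution N" and v: "\<And>n. 0 \<le> v n"
    and lim: "\<And>t. (\<lambda>n. complex_of_real (exp (- (v n * t\<^sup>2) / 2))) \<longlonglongrightarrow> char N t"
  shows "\<exists>w\<ge>0. N = gaussian_law 0 w"
proof -
  interpret real_distribution N by fact
  have re: "(\<lambda>n. exp (- (v n * t\<^sup>2) / 2)) \<longlonglongrightarrow> Re (char N t)" for t
    using tendsto_Re[OF lim[of t]] by simp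
  have im: "Im (char N t) = 0" for t
    using tendsto_Im[OF lim[of t]] by (simp add: LIMSEQ_const_iff)
  have "char N \<midarrow>0\<rightarrow> 1" using isCont_char[of 0] by (simp add: isCont_def char_zero)
  then have "eventually (\<lambda>t. char N t \<noteq> 0) (at 0)"
    by (rule tendsto_imp_eventually_ne) simp
  then obtain d where d: "d > 0" "\<And>t. t \<noteq> 0 \<Longrightarrow> \<bar>t\<bar> < d \<Longrightarrow> char N t \<noteq> 0"
    by (auto simp: eventually_at dist_real_def)
  define t where "t = d / 2"
  have t: "t \<noteq> 0" "char N t \<noteq> 0" using d by (auto simp: t_def)
  have "Re (char N t) \<ge> 0" using re[of t] by (rule LIMSEQ_le_const) auto
  moreover have "Re (char N t) \<noteq> 0" using t im[of t] by (auto simp: complex_eq_iff)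
  ultimately have pos: "Re (char N t) > 0" by simp
  define w where "w = - 2 * ln (Re (char N t)) / t\<^sup>2"
  have "(\<lambda>n. - 2 * ln (exp (- (v n * t\<^sup>2) / 2)) / t\<^sup>2) \<longlonglongrightarrow> w"
    unfolding w_def using pos t by (intro tendsto_intros re) auto
  then have vw: "v \<longlonglongrightarrow> w" using t by simp
  then have w0: "w \<ge> 0" using v by (intro LIMSEQ_le_const) auto
  have "char N = char (gaussian_law 0 w)"
  proof
    fix s
    have "(\<lambda>n. complex_of_real (exp (- (v n * s\<^sup>2) / 2))) \<longlonglongrightarrow> of_real (exp (- (w * s\<^sup>2) / 2))"
      by (intro tendsto_intros vw) auto
    with lim[of s] have "char N s = of_real (exp (- (w * s\<^sup>2) / 2))" by (rule LIMSEQ_unique)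
    then show "char N s = char (gaussian_law 0 w) s" using w0 by (simp add: char_gaussian_law)
  qed
  with M real_distribution_gaussian_law[OF w0] have "N = gaussian_law 0 w"
    by (rule Levy_uniqueness)
  with w0 show ?thesis by auto
qed

text \<open>Probability measures obtained by reweighting turn statements about \<open>E (w iexp (a X))\<close> into statements about
  characteristic functions of laws on the line.\<close>

lemma weighted_law_char:
  fixes X w :: "'a \<Rightarrow> real"
  assumes "prob_space P"
    and [measurable]: "X \<in> borel_measurable P" "w \<in> borel_measurable P" "A \<in> sets borel"
    and w0: "\<And>x. 0 \<le> w x" and wb: "\<And>x. w x \<le> K" and m: "m = (LINT x|P. w x)" "0 < m"
  defines "D \<equiv> distr (density P (\<lambda>x. ennreal (w x / m))) borel X"
  shows "real_distribution D"
    and "char D a = (CLINT x|P. of_real (w x) * iexp (a * X x)) / m"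
    and "measure D A = (LINT x|P. w x * indicator A (X x)) / m"
proof -
  interpret prob_space P by fact
  have int: "integrable P w" by (rule integrable_const_bound[where B=K]) (use w0 wb in auto)
  have "emeasure (density P (\<lambda>x. ennreal (w x / m))) (space P) = (\<integral>\<^sup>+x. ennreal (w x / m) \<partial>P)"
    by (simp add: emeasure_density)
  also have "\<dots> = ennreal (LINT x|P. w x / m)"
    using m w0 int by (intro nn_integral_eq_integral) auto
  also have "\<dots> = 1" using m by simp
  finally interpret D: prob_space "density P (\<lambda>x. ennreal (w x / m))"
    by (intro prob_spaceI) simp
  show rd: "real_distribution D"
    unfolding D_def by (intro D.real_distribution_distr) simp
  have "char D a = (CLINT x|density P (\<lambda>x. ennreal (w x / m)). iexp (a * X x))"
    unfolding char_def D_def by (subst integral_distr) auto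
  also have "\<dots> = (CLINT x|P. (w x / m) *\<^sub>R iexp (a * X x))"
    using m w0 by (subst integral_density) auto
  also have "\<dots> = (CLINT x|P. (of_real (w x) * iexp (a * X x)) / of_real m)"
    by (intro Bochner_Integration.integral_cong) (auto simp: scaleR_conv_of_real)
  finally show "char D a = (CLINT x|P. of_real (w x) * iexp (a * X x)) / m"
    by simp
  interpret E: real_distribution D by (rule rd)
  have "measure D A = (LINT x|D. indicator A x)" by simp
  also have "\<dots> = (LINT x|density P (\<lambda>x. ennreal (w x / m)). indicator A (X x))"
    unfolding D_def by (subst integral_distr) auto
  also have "\<dots> = (LINT x|P. (w x / m) *\<^sub>R indicator A (X x))"
    using m w0 by (subst integral_density) auto
  finally show "measure D A = (LINT x|P. w x * indicator A (X x)) / m" by simp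
qed

lemma weighted_char_uniqueness:
  fixes X w :: "'a \<Rightarrow> real" and X' w' :: "'b \<Rightarrow> real"
  assumes P: "prob_space P" and Q: "prob_space Q"
    and meas [measurable]: "X \<in> borel_measurable P" "X' \<in> borel_measurable Q"
      "w \<in> borel_measurable P" "w' \<in> borel_measurable Q" "A \<in> sets borel"
    and w0: "\<And>x. 0 \<le> w x" "\<And>x. 0 \<le> w' x" and wb: "\<And>x. w x \<le> K" "\<And>x. w' x \<le> K"
    and eq: "\<And>a. (CLINT x|P. of_real (w x) * iexp (a * X x)) = (CLINT x|Q. of_real (w' x) * iexp (a * X' x))"
  shows "(LINT x|P. w x * indicator A (X x)) = (LINT x|Q. w' x * indicator A (X' x))"
proof -
  interpret P: prob_space P by fact
  interpret Q: prob_space Q by fact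
  have iP: "integrable P w" by (rule P.integrable_const_bound[where B=K]) (use w0 wb in auto)
  have iQ: "integrable Q w'" by (rule Q.integrable_const_bound[where B=K]) (use w0 wb in auto)
  define m where "m = (LINT x|P. w x)"
  have "complex_of_real m = complex_of_real (LINT x|Q. w' x)"
    using eq[of 0] by (simp add: m_def)
  then have m': "m = (LINT x|Q. w' x)" using of_real_eq_iff by blast
  have "m \<ge> 0" unfolding m_def using w0 by simp
  show ?thesis
  proof (cases "m = 0")
    case True
    have "AE x in P. w x = 0" using True integral_nonneg_eq_0_iff_AE[OF iP] w0 by (auto simp: m_def)
    moreover have "AE x in Q. w' x = 0" using True integral_nonneg_eq_0_iff_AE[OF iQ] w0 by (auto simp: m')
    ultimately have "(LINT x|P. w x * indicator A (X x)) = (LINT x|P. 0)" "(LINT x|Q. w' x * indicator A (X' x)) = (LINT x|Q. 0)"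
      by (intro integral_cong_AE; force)+
    then show ?thesis by simp
  next
    case False
    with \<open>m \<ge> 0\<close> have mp: "m > 0" by simp
    note LP = weighted_law_char[OF P meas(1,3,5) w0(1) wb(1) m_def mp]
    note LQ = weighted_law_char[OF Q meas(2,4,5) w0(2) wb(2) m' mp]
    have "distr (density P (\<lambda>x. ennreal (w x / m))) borel X = distr (density Q (\<lambda>x. ennreal (w' x / m))) borel X'"
      by (intro Levy_uniqueness LP(1) LQ(1) ext) (simp only: LP(2) LQ(2) eq)
    then show ?thesis using LP(3) LQ(3) mp by simp
  qed
qed

text \<open>Uniqueness for pairs, reduced to the uniqueness theorem on the line. The weights \<open>2 + cos (b Y)\<close> and
  \<open>2 + sin (b Y)\<close> are positive and expand into exponentials, so the joint characteristic function determines
  \<open>E (iexp (b Y) 1\<^sub>A(X))\<close>; with \<open>1\<^sub>A(X)\<close> as the weight this in turn determines \<open>E (1\<^sub>A(X) 1\<^sub>A\<^sub>'(Y))\<close>.\<close>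

lemma char_uniqueness_rectangles:
  fixes X Y :: "'a \<Rightarrow> real" and X' Y' :: "'b \<Rightarrow> real"
  assumes P: "prob_space P" and Q: "prob_space Q"
    and meas [measurable]: "X \<in> borel_measurable P" "X' \<in> borel_measurable Q"
      "Y \<in> borel_measurable P" "Y' \<in> borel_measurable Q" "A \<in> sets borel" "A' \<in> sets borel"
    and eq: "\<And>a b. (CLINT x|P. iexp (a * X x + b * Y x)) = (CLINT x|Q. iexp (a * X' x + b * Y' x))"
  shows "(LINT x|P. indicator A (X x) * indicator A' (Y x) :: real) = (LINT x|Q. indicator A (X' x) * indicator A' (Y' x))"
proof -
  interpret P: prob_space P by fact
  interpret Q: prob_space Q by fact
  have iP: "integrable P (\<lambda>x. iexp (a * X x + b * Y x))" for a b
    by (rule P.integrable_const_bound[where B=1]) auto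
  have iQ: "integrable Q (\<lambda>x. iexp (a * X' x + b * Y' x))" for a b
    by (rule Q.integrable_const_bound[where B=1]) auto
  have I: "(LINT x|P. indicator A (X x) :: real) = (LINT x|Q. indicator A (X' x))"
  proof -
    have "(LINT x|P. 1 * indicator A (X x) :: real) = (LINT x|Q. 1 * indicator A (X' x))"
    proof (rule weighted_char_uniqueness[OF P Q, where K=1])
      show "(CLINT x|P. of_real 1 * iexp (a * X x)) = (CLINT x|Q. of_real 1 * iexp (a * X' x))" for a
        using eq[of a 0] by simp
    qed (auto intro: meas)
    then show ?thesis by simp
  qed
  have cs: "(LINT x|P. c (b * Y x) * indicator A (X x) :: real) = (LINT x|Q. c (b * Y' x) * indicator A (X' x))"
    if c: "c = cos \<or> c = sin" for c b
  proof -
    have [measurable]: "c \<in> borel_measurable borel" using c by auto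
    have cb: "\<bar>c x\<bar> \<le> 1" for x using c by auto
    obtain k1 k2 where k: "\<And>x. complex_of_real (c x) = k1 * iexp x + k2 * iexp (- x)"
    proof (cases "c = cos")
      case True
      show ?thesis by (rule that[of "1/2" "1/2"]) (simp add: True exp_Euler exp_minus_Euler cos_of_real sin_of_real algebra_simps)
    next
      case False
      with c have "c = sin" by simp
      then show ?thesis by (intro that[of "- \<i>/2" "\<i>/2"]) (simp add: exp_Euler exp_minus_Euler cos_of_real sin_of_real algebra_simps)
    qed
    have e: "complex_of_real (2 + c (b * y)) * iexp (a * x) =
       2 * iexp (a * x + 0 * y) + (k1 * iexp (a * x + b * y) + k2 * iexp (a * x + (- b) * y))" for a x y
    proof -
      have "iexp (a * x + z) = iexp (a * x) * iexp z" for z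
        by (simp add: exp_add distrib_left)
      from this[of "b * y"] this[of "- (b * y)"] k[of "b * y"] show ?thesis
        by (simp only: of_real_add of_real_numeral mult_minus_left add_0_right mult_zero_left) (simp only: distrib_left distrib_right mult.assoc mult.commute mult.left_commute)
    qed
    have "(LINT x|P. (2 + c (b * Y x)) * indicator A (X x) :: real) = (LINT x|Q. (2 + c (b * Y' x)) * indicator A (X' x))"
    proof (rule weighted_char_uniqueness[OF P Q, where K=3])
      show "2 + c (b * Y x) \<ge> 0" "2 + c (b * Y x) \<le> 3" for x using cb[of "b * Y x"] by auto
      show "2 + c (b * Y' x) \<ge> 0" "2 + c (b * Y' x) \<le> 3" for x using cb[of "b * Y' x"] by auto
      show "(CLINT x|P. of_real (2 + c (b * Y x)) * iexp (a * X x)) = (CLINT x|Q. of_real (2 + c (b * Y' x)) * iexp (a * X' x))" for a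
        unfolding e
        by (simp only: Bochner_Integration.integral_add integral_mult_right_zero Bochner_Integration.integrable_add
            integrable_mult_right iP iQ eq)
    qed auto
    moreover have "integrable P (\<lambda>x. c (b * Y x) * indicator A (X x))" "integrable P (\<lambda>x. indicator A (X x) :: real)"
      by (rule P.integrable_const_bound[where B=1]; simp add: indicator_def cb)+
    moreover have "integrable Q (\<lambda>x. c (b * Y' x) * indicator A (X' x))" "integrable Q (\<lambda>x. indicator A (X' x) :: real)"
      by (rule Q.integrable_const_bound[where B=1]; simp add: indicator_def cb)+
    ultimately show ?thesis using I by (simp only: distrib_right Bochner_Integration.integral_add integral_mult_right_zero Bochner_Integration.integrable_add integrable_mult_right)
  qed
  have "(LINT x|P. indicator A (X x) * indicator A' (Y x) :: real) = (LINT x|Q. indicator A (X' x) * indicator A' (Y' x))"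
  proof (rule weighted_char_uniqueness[OF P Q, where K=1])
    fix b
    have e: "complex_of_real (indicator A x) * iexp (b * y) =
      of_real (cos (b * y) * indicator A x) + \<i> * of_real (sin (b * y) * indicator A x)" for x y :: real
      by (simp add: exp_Euler algebra_simps flip: cos_of_real sin_of_real)
    have "integrable P (\<lambda>x. cos (b * Y x) * indicator A (X x))" "integrable P (\<lambda>x. sin (b * Y x) * indicator A (X x))"
      by (rule P.integrable_const_bound[where B=1]; simp add: indicator_def)+
    moreover have "integrable Q (\<lambda>x. cos (b * Y' x) * indicator A (X' x))" "integrable Q (\<lambda>x. sin (b * Y' x) * indicator A (X' x))"
      by (rule Q.integrable_const_bound[where B=1]; simp add: indicator_def)+
    ultimately show "(CLINT x|P. of_real (indicator A (X x)) * iexp (b * Y x)) =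
        (CLINT x|Q. of_real (indicator A (X' x)) * iexp (b * Y' x))"
      unfolding e using cs[of cos b] cs[of sin b]
      by (simp only: Bochner_Integration.integral_add integral_mult_right_zero integral_complex_of_real
          Bochner_Integration.integrable_add integrable_mult_right complex_of_real_integrable_eq simp_thms)
  qed (simp_all add: indicator_def)
  then show ?thesis .
qed

section \<open>Integrals along continuous processes\<close>

abbreviation time_interval :: "real \<Rightarrow> real measure" where
  "time_interval t \<equiv> restrict_space lborel {0..t}"

lemma finite_measure_time_interval: "finite_measure (time_interval t)"
  by (rule finite_measureI) (simp add: emeasure_restrict_space space_restrict_space emeasure_lborel_Icc_eq)

lemma emeasure_time_interval: "0 \<le> t \<Longrightarrow> emeasure (time_interval t) (space (time_interval t)) = ennreal t"
  by (simp add: emeasure_restrict_space space_restrict_space)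

lemma measurable_time_intervalI [measurable (raw)]:
  "f \<in> measurable borel N \<Longrightarrow> f \<in> measurable (time_interval t) N"
  by (intro measurable_restrict_space1) simp

lemma measurable_time_interval_pair:
  assumes [measurable]: "(\<lambda>(s, \<omega>). \<phi> s \<omega>) \<in> borel_measurable (borel \<Otimes>\<^sub>M M)"
  shows "(\<lambda>(s, \<omega>). \<phi> s \<omega>) \<in> borel_measurable (time_interval t \<Otimes>\<^sub>M M)"
proof -
  have "(\<lambda>p. (fst p, snd p)) \<in> measurable (time_interval t \<Otimes>\<^sub>M M) (borel \<Otimes>\<^sub>M M)"
    by (intro measurable_Pair measurable_compose[OF measurable_fst] measurable_time_intervalI) auto
  from measurable_compose[OF this assms] show ?thesis by (simp add: case_prod_beta)
qed

text \<open>The process is the pointwise limit of its values at the grid points \<open>\<lfloor>n t\<rfloor> / n\<close>.\<close>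

lemma continuous_process_measurable:
  fixes X :: "real \<Rightarrow> 'a \<Rightarrow> real"
  assumes [measurable]: "\<And>t. X t \<in> borel_measurable M"
    and c: "\<And>\<omega>. \<omega> \<in> space M \<Longrightarrow> continuous_on UNIV (\<lambda>t. X t \<omega>)"
  shows "(\<lambda>(t, \<omega>). X t \<omega>) \<in> borel_measurable (borel \<Otimes>\<^sub>M M)"
proof -
  define g where "g n t = \<lfloor>real (Suc n) * t\<rfloor>" for n and t :: real
  have lim: "(\<lambda>n. real_of_int (g n t) / real (Suc n)) \<longlonglongrightarrow> t" for t
  proof (rule LIMSEQ_norm_0[THEN LIM_zero_cancel] )
    fix n
    have "\<bar>real_of_int (g n t) - real (Suc n) * t\<bar> < 1" unfolding g_def by linarith
    moreover have "real_of_int (g n t) / real (Suc n) - t = (real_of_int (g n t) - real (Suc n) * t) / real (Suc n)"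
      by (simp add: field_simps)
    ultimately show "norm (real_of_int (g n t) / real (Suc n) - t) < 1 / real (Suc n)"
      by (simp add: divide_strict_right_mono)
  qed
  show ?thesis
  proof (rule borel_measurable_LIMSEQ_real[where u="\<lambda>n (t, \<omega>). X (real_of_int (g n t) / real (Suc n)) \<omega>"])
    fix n
    have m: "(\<lambda>p. g n (fst p)) \<in> measurable (borel \<Otimes>\<^sub>M M) (count_space UNIV)"
      unfolding g_def by measurable
    have "(\<lambda>p. X (real_of_int (g n (fst p)) / real (Suc n)) (snd p)) \<in> borel_measurable (borel \<Otimes>\<^sub>M M)"
      by (rule measurable_compose_countable[OF _ m, where f="\<lambda>i p. X (real_of_int i / real (Suc n)) (snd p)"]) measurable
    then show "(\<lambda>(t, \<omega>). X (real_of_int (g n t) / real (Suc n)) \<omega>) \<in> borel_measurable (borel \<Otimes>\<^sub>M M)"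
      by (simp add: case_prod_beta)
  next
    fix p :: "real \<times> 'a" assume "p \<in> space (borel \<Otimes>\<^sub>M M)"
    then have "snd p \<in> space M" by (auto simp: space_pair_measure)
    from c[OF this] have "isCont (\<lambda>t. X t (snd p)) (fst p)"
      by (simp add: continuous_on_eq_continuous_at)
    from isCont_tendsto_compose[OF this lim]
    show "(\<lambda>n. case p of (t, \<omega>) \<Rightarrow> X (real_of_int (g n t) / real (Suc n)) \<omega>) \<longlonglongrightarrow> (case p of (t, \<omega>) \<Rightarrow> X t \<omega>)"
      by (simp add: case_prod_beta)
  qed
qed

text \<open>Fubini's theorem; the bound on \<open>E \<bar>W \<phi>\<^sub>s\<bar>\<close>, uniform in \<open>s\<close>, gives integrability on \<open>[0,t] \<times> \<Omega>\<close>.\<close>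

lemma
  fixes \<phi> :: "real \<Rightarrow> 'a \<Rightarrow> real"
  assumes M: "prob_space M" and \<phi>[measurable]: "(\<lambda>(s, \<omega>). \<phi> s \<omega>) \<in> borel_measurable (borel \<Otimes>\<^sub>M M)"
    and W[measurable]: "W \<in> borel_measurable M" and t: "0 \<le> t"
    and K: "\<And>s. 0 \<le> s \<Longrightarrow> s \<le> t \<Longrightarrow> (\<integral>\<^sup>+\<omega>. ennreal \<bar>W \<omega> * \<phi> s \<omega>\<bar> \<partial>M) \<le> ennreal K"
  shows integrable_times_path_integral: "integrable M (\<lambda>\<omega>. W \<omega> * (LINT s|time_interval t. \<phi> s \<omega>))"
    and expectation_times_path_integral:
      "(LINT \<omega>|M. W \<omega> * (LINT s|time_interval t. \<phi> s \<omega>)) = (LINT s|time_interval t. LINT \<omega>|M. W \<omega> * \<phi> s \<omega>)"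
proof -
  interpret M: prob_space M by fact
  interpret T: finite_measure "time_interval t" by (rule finite_measure_time_interval)
  interpret P: pair_sigma_finite "time_interval t" M ..
  note [measurable] = measurable_time_interval_pair[OF \<phi>, of t]
  have *: "integrable (time_interval t \<Otimes>\<^sub>M M) (case_prod (\<lambda>s \<omega>. W \<omega> * \<phi> s \<omega>))"
  proof (rule integrableI_bounded)
    have "(\<integral>\<^sup>+p. ennreal (norm (case p of (s, \<omega>) \<Rightarrow> W \<omega> * \<phi> s \<omega>)) \<partial>(time_interval t \<Otimes>\<^sub>M M))
      = (\<integral>\<^sup>+s. \<integral>\<^sup>+\<omega>. ennreal \<bar>W \<omega> * \<phi> s \<omega>\<bar> \<partial>M \<partial>time_interval t)"
      by (subst M.nn_integral_fst[symmetric]) auto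
    also have "\<dots> \<le> (\<integral>\<^sup>+s. ennreal K \<partial>time_interval t)"
      by (intro nn_integral_mono K) (auto simp: space_restrict_space)
    also have "\<dots> < \<infinity>"
      using emeasure_time_interval[OF t] by (simp add: ennreal_mult_less_top)
    finally show "(\<integral>\<^sup>+p. ennreal (norm (case p of (s, \<omega>) \<Rightarrow> W \<omega> * \<phi> s \<omega>)) \<partial>(time_interval t \<Otimes>\<^sub>M M)) < \<infinity>" .
  qed measurable
  show "integrable M (\<lambda>\<omega>. W \<omega> * (LINT s|time_interval t. \<phi> s \<omega>))"
    using P.integrable_snd[OF *] by simp
  show "(LINT \<omega>|M. W \<omega> * (LINT s|time_interval t. \<phi> s \<omega>)) = (LINT s|time_interval t. LINT \<omega>|M. W \<omega> * \<phi> s \<omega>)"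
    using P.Fubini_integral[OF *] by simp
qed

lemma path_integral_measurable:
  fixes \<phi> :: "real \<Rightarrow> 'a \<Rightarrow> real"
  assumes \<phi>[measurable]: "(\<lambda>(s, \<omega>). \<phi> s \<omega>) \<in> borel_measurable (borel \<Otimes>\<^sub>M M)"
  shows "(\<lambda>\<omega>. LINT s|time_interval t. \<phi> s \<omega>) \<in> borel_measurable M"
proof -
  interpret T: finite_measure "time_interval t" by (rule finite_measure_time_interval)
  note m = measurable_time_interval_pair[OF \<phi>, of t]
  have "(\<lambda>p. \<phi> (snd p) (fst p)) \<in> borel_measurable (M \<Otimes>\<^sub>M time_interval t)"
    using measurable_compose[OF measurable_pair_swap' m] by (simp add: case_prod_beta)
  then show ?thesis by (intro T.borel_measurable_lebesgue_integral) (simp add: case_prod_beta)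
qed

lemma abs_integral_le_nn_integral:
  fixes f :: "'a \<Rightarrow> real"
  shows "ennreal \<bar>LINT x|N. f x\<bar> \<le> (\<integral>\<^sup>+x. ennreal \<bar>f x\<bar> \<partial>N)"
  using integral_norm_bound_ennreal[of N f]
  by (cases "integrable N f") (auto simp: not_integrable_integral_eq)

lemma
  fixes \<phi> :: "real \<Rightarrow> 'a \<Rightarrow> real"
  assumes M: "prob_space M" and \<phi>[measurable]: "(\<lambda>(s, \<omega>). \<phi> s \<omega>) \<in> borel_measurable (borel \<Otimes>\<^sub>M M)"
    and t: "0 \<le> t" and K0: "0 \<le> K"
    and K: "\<And>s r. 0 \<le> s \<Longrightarrow> s \<le> t \<Longrightarrow> 0 \<le> r \<Longrightarrow> r \<le> t \<Longrightarrow> (\<integral>\<^sup>+\<omega>. ennreal \<bar>\<phi> s \<omega> * \<phi> r \<omega>\<bar> \<partial>M) \<le> ennreal K"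
  shows integrable_path_integral_square: "integrable M (\<lambda>\<omega>. (LINT s|time_interval t. \<phi> s \<omega>)\<^sup>2)"
    and expectation_path_integral_square: "(LINT \<omega>|M. (LINT s|time_interval t. \<phi> s \<omega>)\<^sup>2)
      = (LINT s|time_interval t. LINT r|time_interval t. LINT \<omega>|M. \<phi> s \<omega> * \<phi> r \<omega>)"
proof -
  interpret M: prob_space M by fact
  interpret T: finite_measure "time_interval t" by (rule finite_measure_time_interval)
  interpret P: pair_sigma_finite "time_interval t" M ..
  note [measurable] = measurable_time_interval_pair[OF \<phi>, of t]
  define W where "W \<omega> = (LINT s|time_interval t. \<phi> s \<omega>)" for \<omega>
  have W[measurable]: "W \<in> borel_measurable M"
    unfolding W_def by (rule path_integral_measurable[OF \<phi>])
  have [measurable]: "\<phi> s \<in> borel_measurable M" for s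
    using measurable_compose[OF measurable_Pair1' \<phi>, of s] by simp
  have KW: "(\<integral>\<^sup>+\<omega>. ennreal \<bar>W \<omega> * \<phi> s \<omega>\<bar> \<partial>M) \<le> ennreal (t * K)" if s: "0 \<le> s" "s \<le> t" for s
  proof -
    have "(\<integral>\<^sup>+\<omega>. ennreal \<bar>W \<omega> * \<phi> s \<omega>\<bar> \<partial>M) = (\<integral>\<^sup>+\<omega>. ennreal \<bar>LINT r|time_interval t. \<phi> s \<omega> * \<phi> r \<omega>\<bar> \<partial>M)"
      by (simp add: W_def mult.commute)
    also have "\<dots> \<le> (\<integral>\<^sup>+\<omega>. \<integral>\<^sup>+r. ennreal \<bar>\<phi> s \<omega> * \<phi> r \<omega>\<bar> \<partial>time_interval t \<partial>M)"
      by (intro nn_integral_mono abs_integral_le_nn_integral)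
    also have "\<dots> = (\<integral>\<^sup>+r. \<integral>\<^sup>+\<omega>. ennreal \<bar>\<phi> s \<omega> * \<phi> r \<omega>\<bar> \<partial>M \<partial>time_interval t)"
      by (rule P.Fubini') measurable
    also have "\<dots> \<le> (\<integral>\<^sup>+r. ennreal K \<partial>time_interval t)"
      using s by (intro nn_integral_mono K) (auto simp: space_restrict_space)
    also have "\<dots> = ennreal (t * K)"
      using emeasure_time_interval[OF t] t K0 by (simp add: ennreal_mult' mult.commute)
    finally show ?thesis .
  qed
  have sq: "(LINT s|time_interval t. \<phi> s \<omega>)\<^sup>2 = W \<omega> * (LINT s|time_interval t. \<phi> s \<omega>)" for \<omega>
    by (simp add: W_def power2_eq_square)
  show "integrable M (\<lambda>\<omega>. (LINT s|time_interval t. \<phi> s \<omega>)\<^sup>2)"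
    unfolding sq by (rule integrable_times_path_integral[OF M \<phi> W t KW])
  have "(LINT \<omega>|M. (LINT s|time_interval t. \<phi> s \<omega>)\<^sup>2) = (LINT s|time_interval t. LINT \<omega>|M. W \<omega> * \<phi> s \<omega>)"
    unfolding sq by (rule expectation_times_path_integral[OF M \<phi> W t KW])
  also have "\<dots> = (LINT s|time_interval t. LINT r|time_interval t. LINT \<omega>|M. \<phi> s \<omega> * \<phi> r \<omega>)"
  proof (rule Bochner_Integration.integral_cong[OF refl])
    fix s assume "s \<in> space (time_interval t)"
    then have s: "0 \<le> s" "s \<le> t" by (auto simp: space_restrict_space)
    have "(LINT \<omega>|M. W \<omega> * \<phi> s \<omega>) = (LINT \<omega>|M. \<phi> s \<omega> * (LINT r|time_interval t. \<phi> r \<omega>))"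
      by (simp add: W_def mult.commute)
    also have "\<dots> = (LINT r|time_interval t. LINT \<omega>|M. \<phi> s \<omega> * \<phi> r \<omega>)"
      by (rule expectation_times_path_integral[OF M \<phi> _ t K[OF s]]) measurable
    finally show "(LINT \<omega>|M. W \<omega> * \<phi> s \<omega>) = (LINT r|time_interval t. LINT \<omega>|M. \<phi> s \<omega> * \<phi> r \<omega>)" .
  qed
  finally show "(LINT \<omega>|M. (LINT s|time_interval t. \<phi> s \<omega>)\<^sup>2)
      = (LINT s|time_interval t. LINT r|time_interval t. LINT \<omega>|M. \<phi> s \<omega> * \<phi> r \<omega>)" .
qed

lemma time_interval_integral_eq:
  fixes f :: "real \<Rightarrow> real"
  assumes c: "continuous_on {0..t} f"
  shows "(LINT s|time_interval t. f s) = integral {0..t} f"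
proof -
  have "(LINT s|time_interval t. f s) = (LINT s:{0..t}|lborel. f s)"
    by (simp add: integral_restrict_space set_lebesgue_integral_def)
  also have "\<dots> = integral {0..t} f"
    by (intro set_borel_integral_eq_integral borel_integrable_atLeastAtMost')
      (rule c)
  finally show ?thesis .
qed

section \<open>Riemann sums and linear differential equations\<close>

text \<open>Stated with an antiderivative \<open>F\<close>, so that the mean value theorem rewrites \<open>F t - F 0\<close> as a sum over the
  same grid.\<close>

lemma riemann_sums_tendsto:
  fixes f F :: "real \<Rightarrow> real"
  assumes t: "0 \<le> t" and f: "continuous_on {0..t} f"
    and F: "\<And>x. x \<in> {0..t} \<Longrightarrow> (F has_real_derivative f x) (at x within {0..t})"
  shows "(\<lambda>n. \<Sum>k<n. t / real n * f (real k * t / real n)) \<longlonglongrightarrow> F t - F 0"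
proof (cases "t = 0")
  case True then show ?thesis by simp
next
  case False
  with t have t: "0 < t" by simp
  have u: "uniformly_continuous_on {0..t} f" by (intro compact_uniformly_continuous f) simp
  show ?thesis
  proof (rule LIMSEQ_I)
    fix e :: real assume e: "e > 0"
    from u e t obtain d where d: "d > 0"
      "\<And>x y. x \<in> {0..t} \<Longrightarrow> y \<in> {0..t} \<Longrightarrow> \<bar>x - y\<bar> < d \<Longrightarrow> \<bar>f x - f y\<bar> < e / (2 * t)"
      unfolding uniformly_continuous_on_def dist_real_def
      by (metis abs_minus_commute divide_pos_pos mult_pos_pos zero_less_numeral)
    obtain N where N: "t / d < real N" using reals_Archimedean2 by blast
    show "\<exists>no. \<forall>n\<ge>no. norm ((\<Sum>k<n. t / real n * f (real k * t / real n)) - (F t - F 0)) < e"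
    proof (intro exI[of _ "Suc N"] allI impI)
      fix n assume n: "Suc N \<le> n"
      then have n0: "0 < real n" by simp
      have "t / d < real n" using N n by simp
      then have td: "t / n < d" using d n0 t by (simp add: field_simps)
      have step: "\<bar>t / n * f (k * t / n) - (F (real (Suc k) * t / n) - F (real k * t / n))\<bar> \<le> e / (2 * t) * (t / n)"
        if k: "k < n" for k
      proof -
        let ?a = "real k * t / n" and ?b = "real (Suc k) * t / n"
        have ab: "?a < ?b" using t n0 by (simp add: divide_strict_right_mono)
        have a0: "0 \<le> ?a" using t by simp
        have "real (Suc k) * t \<le> real n * t" using k t by (intro mult_right_mono) auto
        then have bt: "?b \<le> t" using n0 by (simp add: pos_divide_le_eq mult.commute)
        have "\<exists>z. ?a < z \<and> z < ?b \<and> F ?b - F ?a = (?b - ?a) * f z"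
        proof -
          have "\<exists>z\<in>{?a<..<?b}. F ?b - F ?a = f z * (?b - ?a)"
          proof (rule mvt_simple[OF ab, of F "\<lambda>z h. f z * h"])
            fix x assume "?a \<le> x" "x \<le> ?b"
            then have "(F has_real_derivative f x) (at x within {?a..?b})"
              using a0 bt by (intro has_field_derivative_subset[OF F]) auto
            then show "(F has_derivative (\<lambda>h. f x * h)) (at x within {?a..?b})"
              by (simp add: has_field_derivative_def)
          qed
          then show ?thesis by (auto simp: mult.commute)
        qed
        then obtain z where z: "?a < z" "z < ?b" "F ?b - F ?a = (?b - ?a) * f z" by blast
        have ba: "?b - ?a = t / n" by (simp add: algebra_simps add_divide_distrib)
        have "\<bar>?a - z\<bar> < d" using z ba td by linarith
        then have "\<bar>f ?a - f z\<bar> < e / (2 * t)" using z a0 bt by (intro d) auto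
        moreover have "t / n * f ?a - (F ?b - F ?a) = (t / n) * (f ?a - f z)"
          unfolding z(3) ba by (simp add: right_diff_distrib)
        ultimately have "\<bar>t / n * f ?a - (F ?b - F ?a)\<bar> = (t / n) * \<bar>f ?a - f z\<bar>"
          using t by (simp add: abs_mult)
        also have "\<dots> \<le> (t / n) * (e / (2 * t))"
          using \<open>\<bar>f ?a - f z\<bar> < e / (2 * t)\<close> t by (intro mult_left_mono) auto
        finally show ?thesis by (simp only: mult.commute)
      qed
      have "(\<Sum>k<n. F (real (Suc k) * t / n) - F (real k * t / n)) = F t - F 0"
        using sum_lessThan_telescope[of "\<lambda>k. F (real k * t / n)" n] n0 by simp
      then have "\<bar>(\<Sum>k<n. t / real n * f (real k * t / real n)) - (F t - F 0)\<bar>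
          = \<bar>\<Sum>k<n. t / real n * f (real k * t / real n) - (F (real (Suc k) * t / n) - F (real k * t / n))\<bar>"
        by (simp add: sum_subtractf)
      also have "\<dots> \<le> (\<Sum>k<n. e / (2 * t) * (t / n))"
        by (intro sum_abs[THEN order_trans] sum_mono step) auto
      also have "\<dots> = e / 2" using t n0 by simp
      finally show "norm ((\<Sum>k<n. t / real n * f (real k * t / real n)) - (F t - F 0)) < e" using e by simp
    qed
  qed
qed

lemma integral_reversed:
  fixes f :: "real \<Rightarrow> real"
  shows "integral {0..s} (\<lambda>r. f (s - r)) = integral {0..s} f"
proof -
  have "integral {0..s} (\<lambda>r. f (s - r)) = integral {- s..0} (\<lambda>x. f (x + s))"
    using Henstock_Kurzweil_Integration.integral_reflect_real[of "0" "- s" "\<lambda>x. f (x + s)"] by simp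
  also have "\<dots> = integral {0..s} f"
    using integral_shift_real_ivl[of 0 s s f] by simp
  finally show ?thesis .
qed

text \<open>Variation of constants: with \<open>I\<close> the integral of \<open>f\<close> and \<open>J\<close> that of \<open>exp (lam s) b s\<close>, the expression
  \<open>exp (lam x) I x - f 0 exp (lam x) / lam - sig J x\<close> has derivative \<open>0\<close>.\<close>

lemma linear_integral_equation:
  fixes f b :: "real \<Rightarrow> real"
  assumes lam: "lam \<noteq> 0" and t: "0 \<le> t" and f: "continuous_on {0..t} f" and b: "continuous_on {0..t} b"
    and eq: "\<And>s. 0 \<le> s \<Longrightarrow> s \<le> t \<Longrightarrow> f s = f 0 - lam * integral {0..s} f + sig * b s"
  shows "f t = exp (- lam * t) * f 0 + sig * b t - lam * sig * exp (- lam * t) * integral {0..t} (\<lambda>s. exp (lam * s) * b s)"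
proof -
  define J where "J s = integral {0..s} (\<lambda>s. exp (lam * s) * b s)" for s
  define I where "I s = integral {0..s} f" for s
  have I: "(I has_real_derivative f x) (at x within {0..t})" if "x \<in> {0..t}" for x
    unfolding I_def using that by (intro integral_has_real_derivative f)
  have J: "(J has_real_derivative exp (lam * x) * b x) (at x within {0..t})" if "x \<in> {0..t}" for x
    unfolding J_def using that by (intro integral_has_real_derivative continuous_intros b)
  have "\<exists>c. \<forall>x\<in>{0..t}. exp (lam * x) * I x - f 0 * exp (lam * x) / lam - sig * J x = c"
  proof (rule has_field_derivative_zero_constant)
    fix x assume x: "x \<in> {0..t}"
    show "((\<lambda>x. exp (lam * x) * I x - f 0 * exp (lam * x) / lam - sig * J x) has_real_derivative 0) (at x within {0..t})"
    proof (rule DERIV_cong)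
      show "((\<lambda>x. exp (lam * x) * I x - f 0 * exp (lam * x) / lam - sig * J x) has_real_derivative
        (exp (lam * x) * lam * I x + f x * exp (lam * x) - f 0 * (exp (lam * x) * lam) / lam - sig * (exp (lam * x) * b x)))
        (at x within {0..t})"
        by (auto intro!: derivative_eq_intros I J x)
      have "exp (lam * x) * lam * I x + f x * exp (lam * x) - f 0 * (exp (lam * x) * lam) / lam - sig * (exp (lam * x) * b x)
        = exp (lam * x) * (lam * I x + f x - f 0 - sig * b x)"
        using lam by (simp add: algebra_simps)
      also have "\<dots> = 0" using eq[of x] x by (simp add: I_def)
      finally show "exp (lam * x) * lam * I x + f x * exp (lam * x) - f 0 * (exp (lam * x) * lam) / lam
        - sig * (exp (lam * x) * b x) = 0" .
    qed
  qed simp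
  then obtain c where c: "\<And>x. x \<in> {0..t} \<Longrightarrow> exp (lam * x) * I x - f 0 * exp (lam * x) / lam - sig * J x = c" by blast
  have "I 0 = 0" "J 0 = 0" by (simp_all add: I_def J_def)
  with c[of 0] t have "c = - f 0 / lam" by simp
  with c[of t] t have "exp (lam * t) * I t = f 0 * exp (lam * t) / lam + sig * J t - f 0 / lam" by simp
  then have "exp (- lam * t) * (exp (lam * t) * I t) = exp (- lam * t) * (f 0 * exp (lam * t) / lam + sig * J t - f 0 / lam)" by simp
  then have "I t = f 0 / lam + exp (- lam * t) * sig * J t - exp (- lam * t) * f 0 / lam"
    by (simp add: algebra_simps mult_exp_exp)
  then have "lam * I t = lam * (f 0 / lam + exp (- lam * t) * sig * J t - exp (- lam * t) * f 0 / lam)" by simp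
  then have "lam * I t = f 0 + lam * sig * exp (- lam * t) * J t - exp (- lam * t) * f 0"
    using lam by (simp add: algebra_simps)
  with eq[OF t order_refl] show ?thesis
    unfolding I_def[symmetric] J_def[symmetric] by simp
qed

text \<open>Maximum principle on a half line. Subtracting \<open>eps exp (lam t)\<close>, which solves the equation \<open>e'' = lam\<^sup>2 e\<close>,
  sends a bounded \<open>d\<close> to minus infinity. A positive value would then give an interior positive maximum, where the
  second derivative would be positive.\<close>

lemma bounded_subsolution_nonpos:
  fixes d d' d'' :: "real \<Rightarrow> real"
  assumes lam: "0 < lam"
    and cont: "continuous_on {T..} d"
    and d1: "\<And>t. T < t \<Longrightarrow> (d has_real_derivative d' t) (at t)"
    and d2: "\<And>t. T < t \<Longrightarrow> (d' has_real_derivative d'' t) (at t)"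
    and ge: "\<And>t. T < t \<Longrightarrow> d'' t \<ge> lam\<^sup>2 * d t"
    and d0: "d T \<le> 0" and bd: "\<And>t. T \<le> t \<Longrightarrow> d t \<le> K" and t: "T \<le> t"
  shows "d t \<le> 0"
proof (rule ccontr)
  assume "\<not> d t \<le> 0"
  then have dt: "d t > 0" by simp
  define eps where "eps = d t / (2 * exp (lam * t))"
  have eps: "eps > 0" using dt by (simp add: eps_def)
  define e where "e s = d s - eps * exp (lam * s)" for s
  have et: "e t > 0" using dt by (simp add: e_def eps_def)
  have tT: "T < t" using d0 dt t by (cases "T = t") auto
  have "filterlim (\<lambda>s. eps * exp (lam * s)) at_top at_top"
    using eps lam by (intro filterlim_tendsto_pos_mult_at_top[OF tendsto_const] filterlim_compose[OF exp_at_top]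
      filterlim_ident) auto
  then have "eventually (\<lambda>s. eps * exp (lam * s) > K) at_top" by (simp add: filterlim_at_top_dense)
  then obtain T2 where T2: "\<And>s. s \<ge> T2 \<Longrightarrow> eps * exp (lam * s) > K" by (auto simp: eventually_at_top_linorder)
  define U where "U = max T2 (t + 1)"
  have U: "t < U" "e U < 0" using T2[of U] bd[of U] tT by (auto simp: U_def e_def max_def)
  have ec: "continuous_on {T..U} e" unfolding e_def
    by (intro continuous_intros continuous_on_subset[OF cont]) auto
  obtain m where m: "m \<in> {T..U}" "\<And>s. s \<in> {T..U} \<Longrightarrow> e s \<le> e m"
    using continuous_attains_sup[of "{T..U}" e] ec tT U by (auto simp: ball_def)
  have em: "e m > 0" using m(2)[of t] tT U et by auto
  have "e T < 0" using d0 mult_pos_pos[OF eps exp_gt_zero[of "lam * T"]] by (simp add: e_def)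
  then have mT: "T < m" "m < U" using m(1) em U by (auto simp: less_le)
  define e' where "e' s = d' s - eps * lam * exp (lam * s)" for s
  have e1: "(e has_real_derivative e' s) (at s)" if "T < s" for s
    unfolding e_def e'_def using d1[OF that] by (auto intro!: derivative_eq_intros)
  have e2: "(e' has_real_derivative d'' s - eps * lam\<^sup>2 * exp (lam * s)) (at s)" if "T < s" for s
    unfolding e'_def using d2[OF that] by (auto intro!: derivative_eq_intros simp: power2_eq_square)
  have "e' m = 0"
  proof (rule DERIV_local_max[OF e1[OF mT(1)]])
    show "min (m - T) (U - m) > 0" using mT by auto
    show "\<forall>y. \<bar>m - y\<bar> < min (m - T) (U - m) \<longrightarrow> e y \<le> e m" by (auto intro!: m(2))
  qed
  have "d'' m - eps * lam\<^sup>2 * exp (lam * m) \<ge> lam\<^sup>2 * e m"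
    using ge[OF mT(1)] by (simp add: e_def algebra_simps)
  moreover have "lam\<^sup>2 * e m > 0" using em lam by simp
  ultimately have pos: "d'' m - eps * lam\<^sup>2 * exp (lam * m) > 0" by simp
  obtain h where h: "h > 0" "\<And>k. k > 0 \<Longrightarrow> k < h \<Longrightarrow> e' m < e' (m + k)"
    using DERIV_pos_inc_right[OF e2[OF mT(1)] pos] by blast
  define k where "k = min (h / 2) (U - m)"
  have k: "k > 0" "k < h" "m + k \<le> U" using h mT by (auto simp: k_def)
  have "\<exists>z>m. z < m + k \<and> e (m + k) - e m = (m + k - m) * e' z"
    by (rule MVT2) (use k mT e1 in auto)
  then obtain z where z: "m < z" "z < m + k" "e (m + k) - e m = k * e' z" by auto
  have "e' z > 0" using h(2)[of "z - m"] z k \<open>e' m = 0\<close> by auto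
  then have "k * e' z > 0" using k by simp
  then have "e (m + k) > e m" using z by linarith
  then show False using m(2)[of "m + k"] k mT by auto
qed

text \<open>Comparison of \<open>r\<close> and \<open>- r\<close> with the barrier \<open>C t powr (- b)\<close>. For large \<open>t\<close> the second derivative of the
  barrier is at most half of \<open>lam\<^sup>2\<close> times the barrier, and the other half dominates the forcing term.\<close>

lemma decay_of_bounded_solution:
  fixes r r' f :: "real \<Rightarrow> real"
  assumes lam: "0 < lam" and b: "0 < b" and K: "0 \<le> K"
    and r1: "\<And>t. 0 < t \<Longrightarrow> (r has_real_derivative r' t) (at t)"
    and r2: "\<And>t. 0 < t \<Longrightarrow> (r' has_real_derivative lam\<^sup>2 * r t - f t) (at t)"
    and bd: "\<And>t. 0 \<le> t \<Longrightarrow> \<bar>r t\<bar> \<le> v"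
    and f: "\<And>t. 0 < t \<Longrightarrow> \<bar>f t\<bar> \<le> K * t powr (- b)"
  shows "\<exists>C T. 0 < C \<and> 0 < T \<and> (\<forall>t\<ge>T. \<bar>r t\<bar> \<le> C * t powr (- b))"
proof -
  \<comment> \<open>beyond \<open>T\<close> one has \<open>b (b + 1) / t\<^sup>2 \<le> lam\<^sup>2 / 2\<close>\<close>
  define T where "T = max 1 (sqrt (2 * b * (b + 1)) / lam)"
  have T: "1 \<le> T" by (simp add: T_def)
  have "sqrt (2 * b * (b + 1)) \<le> lam * T" using lam by (simp add: T_def max_def field_simps)
  then have "2 * b * (b + 1) \<le> (lam * T)\<^sup>2" by (rule sqrt_le_D)
  then have T2: "b * (b + 1) \<le> lam\<^sup>2 / 2 * T\<^sup>2" by (simp add: power_mult_distrib)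
  \<comment> \<open>the two entries dominate the forcing term beyond \<open>T\<close> and the value of \<open>r\<close> at \<open>T\<close>\<close>
  define C where "C = max (2 * K / lam\<^sup>2) (v * T powr b) + 1"
  have v0: "0 \<le> v" using bd[of 0] by auto
  have C0: "0 < C" using K v0 by (auto simp: C_def max_def add_nonneg_pos)
  have CK: "K \<le> C * lam\<^sup>2 / 2"
  proof -
    have "2 * K / lam\<^sup>2 \<le> C" by (simp add: C_def)
    then show ?thesis using lam by (simp add: field_simps)
  qed
  have Cv: "v \<le> C * T powr (- b)"
  proof -
    have "v * T powr b \<le> C" by (simp add: C_def)
    then have "v * T powr b * T powr (-b) \<le> C * T powr (- b)" by (intro mult_right_mono) auto
    then show ?thesis using T by (simp add: mult.assoc powr_add[symmetric])
  qed
  define w where "w t = C * t powr (- b)" for t :: real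
  define w' where "w' t = - C * b * t powr (- b - 1)" for t :: real
  define w'' where "w'' t = C * b * (b + 1) * t powr (- b - 2)" for t :: real
  have w1: "(w has_real_derivative w' t) (at t)" if "0 < t" for t
    unfolding w_def w'_def using that by (auto intro!: derivative_eq_intros)
  have w2: "(w' has_real_derivative w'' t) (at t)" if "0 < t" for t
    unfolding w'_def w''_def using that
    by (auto intro!: derivative_eq_intros simp: algebra_simps)
  have ww: "lam\<^sup>2 * w t - w'' t \<ge> K * t powr (- b)" if t: "T < t" for t
  proof -
    have "t powr (- b) = t\<^sup>2 * t powr (- b - 2)"
    proof -
      have "t\<^sup>2 = t powr 2" using t T by (simp add: powr_numeral)
      then show ?thesis by (simp add: powr_add[symmetric])
    qed
    moreover have "b * (b + 1) \<le> lam\<^sup>2 / 2 * t\<^sup>2"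
      by (rule order_trans[OF T2]) (use t T in \<open>auto intro!: mult_left_mono power_mono\<close>)
    ultimately have "b * (b + 1) * t powr (- b - 2) \<le> lam\<^sup>2 / 2 * t powr (- b)"
      using mult_right_mono[of "b * (b + 1)" "lam\<^sup>2 / 2 * t\<^sup>2" "t powr (- b - 2)"] by (simp add: mult.assoc)
    then have "C * (b * (b + 1) * t powr (- b - 2)) \<le> C * (lam\<^sup>2 / 2 * t powr (- b))"
      using C0 by (intro mult_left_mono) auto
    moreover have "K * t powr (- b) \<le> C * lam\<^sup>2 / 2 * t powr (- b)" by (intro mult_right_mono CK) auto
    ultimately show ?thesis by (simp add: w_def w''_def algebra_simps)
  qed
  have both: "c * r t - w t \<le> 0" if c: "c = 1 \<or> c = - 1" and t: "T \<le> t" for c t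
  proof (rule bounded_subsolution_nonpos[OF lam, where d="\<lambda>t. c * r t - w t" and T=T and K=v and d'="\<lambda>t. c * r' t - w' t"
        and d''="\<lambda>t. c * (lam\<^sup>2 * r t - f t) - w'' t"])
    show "continuous_on {T..} (\<lambda>t. c * r t - w t)"
    proof (rule continuous_at_imp_continuous_on, rule ballI)
      fix x assume "x \<in> {T..}"
      with T have "0 < x" by auto
      then show "isCont (\<lambda>t. c * r t - w t) x"
        by (intro continuous_intros DERIV_isCont[OF r1] DERIV_isCont[OF w1])
    qed
    show "((\<lambda>t. c * r t - w t) has_real_derivative c * r' t - w' t) (at t)" if "T < t" for t
      using that T by (auto intro!: derivative_eq_intros r1 w1)
    show "((\<lambda>t. c * r' t - w' t) has_real_derivative c * (lam\<^sup>2 * r t - f t) - w'' t) (at t)" if "T < t" for t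
      using that T by (auto intro!: derivative_eq_intros r2 w2)
    show "lam\<^sup>2 * (c * r t - w t) \<le> c * (lam\<^sup>2 * r t - f t) - w'' t" if "T < t" for t
    proof -
      have "0 < t" using that T by simp
      then have "\<bar>f t\<bar> \<le> K * t powr (- b)" by (rule f)
      moreover have "c * f t \<le> \<bar>f t\<bar>" using c by auto
      ultimately show ?thesis using ww[OF that] by (simp add: algebra_simps)
    qed
    show "c * r T - w T \<le> 0" using bd[of T] T Cv c by (auto simp: w_def)
    show "c * r t - w t \<le> v" if "T \<le> t" for t
    proof -
      have "0 \<le> w t" using C0 by (simp add: w_def)
      moreover have "c * r t \<le> \<bar>r t\<bar>" using c by auto
      ultimately show ?thesis using bd[of t] that T by auto
    qed
  qed (rule t)
  have "\<bar>r t\<bar> \<le> C * t powr (- b)" if "T \<le> t" for t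
    using both[of 1 t] both[of "-1" t] that by (simp add: w_def)
  then show ?thesis using C0 T by (intro exI[of _ C] exI[of _ T]) auto
qed

section \<open>The stationary solution is Gaussian\<close>

lemma (in prob_space) gaussian_law_pointwise_limit:
  assumes f: "\<And>n. \<exists>v\<ge>0. distr M borel (f n) = gaussian_law 0 v"
    and fm[measurable]: "\<And>n. f n \<in> borel_measurable M" and g[measurable]: "g \<in> borel_measurable M"
    and lim: "\<And>\<omega>. \<omega> \<in> space M \<Longrightarrow> (\<lambda>n. f n \<omega>) \<longlonglongrightarrow> g \<omega>"
  shows "\<exists>v\<ge>0. distr M borel g = gaussian_law 0 v"
proof -
  from f obtain v where v: "\<And>n. 0 \<le> v n" "\<And>n. distr M borel (f n) = gaussian_law 0 (v n)" by metis
  show ?thesis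
  proof (rule char_limit_gaussian[OF _ v(1)])
    show "real_distribution (distr M borel g)" by (rule real_distribution_distr) simp
    fix t
    have "(\<lambda>n. CLINT \<omega>|M. iexp (t * f n \<omega>)) \<longlonglongrightarrow> (CLINT \<omega>|M. iexp (t * g \<omega>))"
      by (rule integral_dominated_convergence[where w="\<lambda>_. 1"])
        (auto intro!: tendsto_intros lim)
    moreover have "(CLINT \<omega>|M. iexp (t * f n \<omega>)) = complex_of_real (exp (- (v n * t\<^sup>2) / 2))" for n
    proof -
      have "(CLINT \<omega>|M. iexp (t * f n \<omega>)) = char (distr M borel (f n)) t"
        unfolding char_def by (subst integral_distr) auto
      then show ?thesis unfolding v(2) using v(1) by (simp add: char_gaussian_law)
    qed
    moreover have "(CLINT \<omega>|M. iexp (t * g \<omega>)) = char (distr M borel g) t"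
      unfolding char_def by (subst integral_distr) auto
    ultimately show "(\<lambda>n. complex_of_real (exp (- (v n * t\<^sup>2) / 2))) \<longlonglongrightarrow> char (distr M borel g) t" by simp
  qed
qed

lemma abs_mult_le_half_sum_squares: "\<bar>x * y\<bar> \<le> (x\<^sup>2 + y\<^sup>2) / 2" for x y :: real
proof -
  have "2 * \<bar>x * y\<bar> \<le> x\<^sup>2 + y\<^sup>2"
    using sum_squares_bound[of "\<bar>x\<bar>" "\<bar>y\<bar>"] by (simp add: abs_mult mult.assoc)
  then show ?thesis by simp
qed

text \<open>Here \<open>X\<close> and \<open>B\<close> are continuous for every \<open>\<omega>\<close> and at all real times, which the original processes become
  after changing them on a null set and freezing them at negative times.\<close>

locale stationary_fOU = prob_space M for M :: "'a measure" +
  fixes X B :: "real \<Rightarrow> 'a \<Rightarrow> real" and H lam sig :: real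
  assumes H: "0 < H" "H < 1" and lam: "0 < lam" and sig: "0 < sig"
    and X_meas [measurable]: "\<And>t. X t \<in> borel_measurable M"
    and B_meas [measurable]: "\<And>t. B t \<in> borel_measurable M"
    and X_cont: "\<And>\<omega>. \<omega> \<in> space M \<Longrightarrow> continuous_on UNIV (\<lambda>t. X t \<omega>)"
    and B_cont: "\<And>\<omega>. \<omega> \<in> space M \<Longrightarrow> continuous_on UNIV (\<lambda>t. B t \<omega>)"
    and B_gaussian: "\<And>J c. finite J \<Longrightarrow> J \<subseteq> {0..} \<Longrightarrow> \<exists>v\<ge>0. distr M borel (\<lambda>\<omega>. \<Sum>t\<in>J. c t * B t \<omega>) = gaussian_law 0 v"
    and B_variance: "\<And>t. 0 \<le> t \<Longrightarrow> expectation (\<lambda>\<omega>. (B t \<omega>)\<^sup>2) = t powr (2 * H)"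
    and X_eq: "\<And>\<omega> t. \<omega> \<in> space M \<Longrightarrow> 0 \<le> t \<Longrightarrow> X t \<omega> = X 0 \<omega> - lam * integral {0..t} (\<lambda>s. X s \<omega>) + sig * B t \<omega>"
    and X_stationary: "\<And>s t h. 0 \<le> s \<Longrightarrow> 0 \<le> t \<Longrightarrow> 0 \<le> h \<Longrightarrow>
      distr M (borel \<Otimes>\<^sub>M borel) (\<lambda>\<omega>. (X (s + h) \<omega>, X (t + h) \<omega>)) = distr M (borel \<Otimes>\<^sub>M borel) (\<lambda>\<omega>. (X s \<omega>, X t \<omega>))"
begin

lemma X_joint_measurable [measurable]: "(\<lambda>(t, \<omega>). X t \<omega>) \<in> borel_measurable (borel \<Otimes>\<^sub>M M)"
  by (rule continuous_process_measurable[OF X_meas X_cont])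

definition B_combination :: "('a \<Rightarrow> real) \<Rightarrow> bool" where
  "B_combination f \<longleftrightarrow> (\<exists>J c. finite J \<and> J \<subseteq> {0..} \<and> f = (\<lambda>\<omega>. \<Sum>t\<in>J. c t * B t \<omega>))"

lemma B_combination_single: "0 \<le> t \<Longrightarrow> B_combination (\<lambda>\<omega>. a * B t \<omega>)"
  unfolding B_combination_def by (intro exI[of _ "{t}"] exI[of _ "\<lambda>_. a"]) auto

lemma B_combination_add:
  assumes "B_combination f" "B_combination g"
  shows "B_combination (\<lambda>\<omega>. f \<omega> + g \<omega>)"
proof -
  from assms obtain J c K d where
    J: "finite J" "J \<subseteq> {0..}" "f = (\<lambda>\<omega>. \<Sum>t\<in>J. c t * B t \<omega>)" and
    K: "finite K" "K \<subseteq> {0..}" "g = (\<lambda>\<omega>. \<Sum>t\<in>K. d t * B t \<omega>)"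
    unfolding B_combination_def by blast
  let ?e = "\<lambda>t. (if t \<in> J then c t else 0) + (if t \<in> K then d t else 0)"
  have "(\<Sum>t\<in>J \<union> K. ?e t * B t \<omega>) = f \<omega> + g \<omega>" for \<omega>
  proof -
    have "(\<Sum>t\<in>J \<union> K. ?e t * B t \<omega>) = (\<Sum>t\<in>J \<union> K. (if t \<in> J then c t * B t \<omega> else 0)) + (\<Sum>t\<in>J \<union> K. (if t \<in> K then d t * B t \<omega> else 0))"
      unfolding sum.distrib[symmetric] by (intro sum.cong) (auto simp: algebra_simps)
    also have "\<dots> = (\<Sum>t\<in>(J \<union> K) \<inter> J. c t * B t \<omega>) + (\<Sum>t\<in>(J \<union> K) \<inter> K. d t * B t \<omega>)"
      using J(1) K(1) by (simp only: sum.inter_restrict finite_Un)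
    also have "(J \<union> K) \<inter> J = J" by auto
    also have "(J \<union> K) \<inter> K = K" by auto
    finally show ?thesis by (simp add: J(3) K(3))
  qed
  then show ?thesis unfolding B_combination_def using J K
    by (intro exI[of _ "J \<union> K"] exI[of _ ?e]) (auto simp: fun_eq_iff)
qed

lemma B_combination_scale:
  assumes "B_combination f" shows "B_combination (\<lambda>\<omega>. a * f \<omega>)"
proof -
  from assms obtain J c where
    J: "finite J" "J \<subseteq> {0..}" "f = (\<lambda>\<omega>. \<Sum>t\<in>J. c t * B t \<omega>)" unfolding B_combination_def by blast
  then show ?thesis unfolding B_combination_def
    by (intro exI[of _ J] exI[of _ "\<lambda>t. a * c t"]) (auto simp: fun_eq_iff sum_distrib_left mult.assoc)
qed

lemma B_combination_sum:
  assumes "\<And>k. k < (n::nat) \<Longrightarrow> B_combination (f k)"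
  shows "B_combination (\<lambda>\<omega>. \<Sum>k<n. f k \<omega>)"
  using assms
proof (induction n)
  case 0
  then show ?case unfolding B_combination_def by (intro exI[of _ "{}"]) auto
next
  case (Suc n)
  then show ?case by (simp add: B_combination_add)
qed

lemma B_combination_gaussian:
  "B_combination f \<Longrightarrow> \<exists>v\<ge>0. distr M borel f = gaussian_law 0 v"
  unfolding B_combination_def using B_gaussian by blast

lemma B_combination_measurable: "B_combination f \<Longrightarrow> f \<in> borel_measurable M"
  unfolding B_combination_def by auto

text \<open>The part of \<open>X\<close> that is driven by the noise, \<open>sig B\<^sub>t - lam sig \<integral>\<^sub>0\<^sup>t exp (- lam (t - s)) B\<^sub>s ds\<close>.\<close>

definition Z :: "real \<Rightarrow> 'a \<Rightarrow> real" where
  "Z t \<omega> = X t \<omega> - exp (- lam * t) * X 0 \<omega>"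

lemma Z_measurable [measurable]: "Z t \<in> borel_measurable M"
  unfolding Z_def by measurable

lemma Z_limit_of_combinations:
  assumes t: "0 \<le> t"
  obtains f where "\<And>n. B_combination (f n)" "\<And>\<omega>. \<omega> \<in> space M \<Longrightarrow> (\<lambda>n. f n \<omega>) \<longlonglongrightarrow> Z t \<omega>"
proof -
  define f where "f n \<omega> = sig * B t \<omega> + (- lam * sig * exp (- lam * t)) *
    (\<Sum>k<n. (t / real n * exp (lam * (real k * t / real n))) * B (real k * t / real n) \<omega>)" for n \<omega>
  have 1: "B_combination (f n)" for n
    unfolding f_def[abs_def] using t
    by (intro B_combination_add B_combination_scale B_combination_sum B_combination_single) auto
  have 2: "(\<lambda>n. f n \<omega>) \<longlonglongrightarrow> Z t \<omega>" if w: "\<omega> \<in> space M" for \<omega>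
  proof -
    let ?J = "\<lambda>t. integral {0..t} (\<lambda>s. exp (lam * s) * B s \<omega>)" and ?c = "- lam * sig * exp (- lam * t)"
    let ?S = "\<lambda>n. \<Sum>k<n. t / real n * (exp (lam * (real k * t / real n)) * B (real k * t / real n) \<omega>)"
    have c: "continuous_on A (\<lambda>t. X t \<omega>)" "continuous_on A (\<lambda>t. B t \<omega>)" for A
      using X_cont[OF w] B_cont[OF w] by (auto intro: continuous_on_subset)
    have ce: "continuous_on A (\<lambda>s. exp (lam * s) * B s \<omega>)" for A
      by (intro continuous_intros c)
    have "Z t \<omega> = sig * B t \<omega> - lam * sig * exp (- lam * t) * ?J t"
    proof -
      have "lam \<noteq> 0" using lam by simp
      from linear_integral_equation[OF this t c(1) c(2) X_eq[OF w]] show ?thesis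
        by (simp add: Z_def)
    qed
    moreover have "?S
       \<longlonglongrightarrow> ?J t - ?J 0"
      by (rule riemann_sums_tendsto[OF t ce]) (rule integral_has_real_derivative[OF ce])
    then have "(\<lambda>n. sig * B t \<omega> + ?c * ?S n)
       \<longlonglongrightarrow> sig * B t \<omega> + ?c * (?J t - ?J 0)"
      by (intro tendsto_intros)
    ultimately show ?thesis by (simp add: f_def mult.assoc)
  qed
  from 1 2 show thesis by (rule that)
qed

lemma Z_pair_gaussian:
  assumes s: "0 \<le> s" and u: "0 \<le> u"
  shows "\<exists>v\<ge>0. distr M borel (\<lambda>\<omega>. c * Z s \<omega> + d * Z u \<omega>) = gaussian_law 0 v"
proof -
  obtain f where f: "\<And>n. B_combination (f n)" "\<And>\<omega>. \<omega> \<in> space M \<Longrightarrow> (\<lambda>n. f n \<omega>) \<longlonglongrightarrow> Z s \<omega>"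
    using Z_limit_of_combinations[OF s] by blast
  obtain g where g: "\<And>n. B_combination (g n)" "\<And>\<omega>. \<omega> \<in> space M \<Longrightarrow> (\<lambda>n. g n \<omega>) \<longlonglongrightarrow> Z u \<omega>"
    using Z_limit_of_combinations[OF u] by blast
  have comb: "B_combination (\<lambda>\<omega>. c * f n \<omega> + d * g n \<omega>)" for n
    by (intro B_combination_add B_combination_scale f g)
  show ?thesis
  proof (rule gaussian_law_pointwise_limit)
    show "\<exists>v\<ge>0. distr M borel (\<lambda>\<omega>. c * f n \<omega> + d * g n \<omega>) = gaussian_law 0 v" for n
      by (rule B_combination_gaussian[OF comb])
    show "(\<lambda>\<omega>. c * f n \<omega> + d * g n \<omega>) \<in> borel_measurable M" for n
      by (rule B_combination_measurable[OF comb])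
    show "(\<lambda>n. c * f n \<omega> + d * g n \<omega>) \<longlonglongrightarrow> c * Z s \<omega> + d * Z u \<omega>" if "\<omega> \<in> space M" for \<omega>
      by (intro tendsto_intros f g that)
  qed measurable
qed

lemma stationary_integral:
  fixes F :: "real \<times> real \<Rightarrow> 'b :: {banach, second_countable_topology}"
  assumes [measurable]: "F \<in> borel_measurable (borel \<Otimes>\<^sub>M borel)" and "0 \<le> s" "0 \<le> t" "0 \<le> h"
  shows "(LINT \<omega>|M. F (X (s + h) \<omega>, X (t + h) \<omega>)) = (LINT \<omega>|M. F (X s \<omega>, X t \<omega>))"
proof -
  have "(LINT \<omega>|M. F (X a \<omega>, X b \<omega>)) = integral\<^sup>L (distr M (borel \<Otimes>\<^sub>M borel) (\<lambda>\<omega>. (X a \<omega>, X b \<omega>))) F" for a b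
    by (subst integral_distr) auto
  then show ?thesis using X_stationary[OF assms(2-4)] by simp
qed

text \<open>The shifted combination \<open>c X (s + n) + d X (u + n)\<close> has the law of the original one, and it differs from the
  Gaussian variable \<open>c Z (s + n) + d Z (u + n)\<close> by a multiple of \<open>X 0\<close> that tends to \<open>0\<close>.\<close>

lemma X_pair_gaussian:
  assumes s: "0 \<le> s" and u: "0 \<le> u"
  shows "\<exists>v\<ge>0. distr M borel (\<lambda>\<omega>. c * X s \<omega> + d * X u \<omega>) = gaussian_law 0 v"
proof -
  define L where "L n \<omega> = c * Z (s + real n) \<omega> + d * Z (u + real n) \<omega>" for n \<omega>
  have L[measurable]: "L n \<in> borel_measurable M" for n unfolding L_def by measurable
  have "\<forall>n. \<exists>v\<ge>0. distr M borel (L n) = gaussian_law 0 v"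
    unfolding L_def[abs_def] using s u by (intro allI Z_pair_gaussian) auto
  then obtain v where v: "\<And>n. 0 \<le> v n" "\<And>n. distr M borel (L n) = gaussian_law 0 (v n)" by metis
  show ?thesis
  proof (rule char_limit_gaussian[OF _ v(1)])
    let ?N = "distr M borel (\<lambda>\<omega>. c * X s \<omega> + d * X u \<omega>)"
    show "real_distribution ?N" by (rule real_distribution_distr) simp
    fix t
    define del where "del n \<omega> = (c * exp (- lam * (s + real n)) + d * exp (- lam * (u + real n))) * X 0 \<omega>" for n \<omega>
    let ?phi = "\<lambda>n. complex_of_real (exp (- (v n * t\<^sup>2) / 2))" and ?err = "\<lambda>n. LINT \<omega>|M. norm (iexp (t * del n \<omega>) - 1)"
    let ?a = "\<lambda>n \<omega>. iexp (t * L n \<omega>)" and ?b = "\<lambda>n \<omega>. iexp (t * (L n \<omega> + del n \<omega>))"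
    have [measurable]: "del n \<in> borel_measurable M" for n unfolding del_def by measurable
    have "filterlim (\<lambda>n. lam * (a + real n)) at_top sequentially" for a
      using lam by (intro filterlim_tendsto_pos_mult_at_top[OF tendsto_const] filterlim_tendsto_add_at_top[OF tendsto_const] filterlim_real_sequentially) auto
    then have "(\<lambda>n. exp (- (lam * (a + real n)))) \<longlonglongrightarrow> 0" for a
      by (intro filterlim_compose[OF exp_at_bot] filterlim_compose[OF filterlim_uminus_at_bot_at_top])
    then have e0: "(\<lambda>n. exp (- lam * (a + real n))) \<longlonglongrightarrow> 0" for a by simp
    have del0: "(\<lambda>n. del n \<omega>) \<longlonglongrightarrow> 0" for \<omega>
      unfolding del_def by (rule tendsto_eq_intros e0 refl)+ simp
    have dom: "?err \<longlonglongrightarrow> (LINT \<omega>|M. 0)"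
    proof (rule integral_dominated_convergence[where w="\<lambda>_. 2"])
      show "AE \<omega> in M. (\<lambda>n. norm (iexp (t * del n \<omega>) - 1)) \<longlonglongrightarrow> 0"
      proof (rule AE_I2)
        fix \<omega>
        have "(\<lambda>n. norm (iexp (t * del n \<omega>) - 1)) \<longlonglongrightarrow> norm (iexp (t * 0) - 1)"
          by (intro tendsto_intros del0)
        then show "(\<lambda>n. norm (iexp (t * del n \<omega>) - 1)) \<longlonglongrightarrow> 0" by simp
      qed
      show "AE \<omega> in M. norm (norm (iexp (t * del n \<omega>) - 1)) \<le> 2" for n
      proof (rule AE_I2)
        fix \<omega>
        show "norm (norm (iexp (t * del n \<omega>) - 1)) \<le> 2"
          using norm_triangle_ineq4[of "iexp (t * del n \<omega>)" 1] by simp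
      qed
    qed auto
    have cN: "char ?N t = (CLINT \<omega>|M. ?b n \<omega>)" for n
    proof -
      have "char ?N t = (CLINT \<omega>|M. iexp (t * (c * X s \<omega> + d * X u \<omega>)))"
        unfolding char_def by (subst integral_distr) auto
      also have "\<dots> = (CLINT \<omega>|M. iexp (t * (c * X (s + real n) \<omega> + d * X (u + real n) \<omega>)))"
        using stationary_integral[of "\<lambda>p. iexp (t * (c * fst p + d * snd p))" s u "real n"] s u by simp
      also have "\<dots> = (CLINT \<omega>|M. ?b n \<omega>)"
        by (intro Bochner_Integration.integral_cong refl) (simp add: L_def del_def Z_def algebra_simps)
      finally show ?thesis .
    qed
    have cL: "?phi n = (CLINT \<omega>|M. ?a n \<omega>)" for n
    proof -
      have "(CLINT \<omega>|M. ?a n \<omega>) = char (distr M borel (L n)) t"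
        unfolding char_def by (subst integral_distr) auto
      then show ?thesis unfolding v(2) using v(1) by (simp add: char_gaussian_law)
    qed
    have bound: "norm (?phi n - char ?N t) \<le> ?err n" for n
    proof -
      have i: "integrable M (\<lambda>\<omega>. ?a n \<omega>)" "integrable M (\<lambda>\<omega>. ?b n \<omega>)"
        by (rule integrable_const_bound[where B=1]; simp)+
      have "?phi n - char ?N t = (CLINT \<omega>|M. ?a n \<omega> - ?b n \<omega>)"
        unfolding cN[of n] cL using i by simp
      also have "norm \<dots> \<le> (LINT \<omega>|M. norm (?a n \<omega> - ?b n \<omega>))"
        by (rule integral_norm_bound)
      also have "\<dots> = ?err n"
      proof (rule Bochner_Integration.integral_cong[OF refl])
        fix \<omega>
        have "?b n \<omega> = ?a n \<omega> * iexp (t * del n \<omega>)"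
          by (simp add: exp_add[symmetric] distrib_left)
        then have "?a n \<omega> - ?b n \<omega> = ?a n \<omega> * (1 - iexp (t * del n \<omega>))"
          by (simp only: right_diff_distrib mult_1_right)
        then have "norm (?a n \<omega> - ?b n \<omega>) = norm (1 - iexp (t * del n \<omega>))"
          by (simp only: norm_mult norm_exp_i_times mult_1_left)
        then show "norm (?a n \<omega> - ?b n \<omega>) = norm (iexp (t * del n \<omega>) - 1)"
          by (simp only: norm_minus_commute)
      qed
      finally show ?thesis .
    qed
    have "(\<lambda>n. ?phi n - char ?N t) \<longlonglongrightarrow> 0"
    proof (rule Lim_null_comparison)
      show "\<forall>\<^sub>F n in sequentially. norm (?phi n - char ?N t) \<le> ?err n"
        using bound by simp
      show "?err \<longlonglongrightarrow> 0" using dom by simp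
    qed
    then show "(\<lambda>n. ?phi n) \<longlonglongrightarrow> char ?N t"
      by (rule LIM_zero_cancel)
  qed
qed

definition autocov :: "real \<Rightarrow> real" where "autocov h = expectation (\<lambda>\<omega>. X 0 \<omega> * X \<bar>h\<bar> \<omega>)"

definition var :: real where "var = expectation (\<lambda>\<omega>. (X 0 \<omega>)\<^sup>2)"

lemma autocov_0: "autocov 0 = var" by (simp add: autocov_def var_def power2_eq_square)

lemma var_nonneg: "0 \<le> var" by (simp add: var_def)

lemma X_sq_integrable: assumes "0 \<le> s" shows "integrable M (\<lambda>\<omega>. (X s \<omega>)\<^sup>2)"
proof -
  obtain v where v: "0 \<le> v" "distr M borel (\<lambda>\<omega>. 1 * X s \<omega> + 0 * X s \<omega>) = gaussian_law 0 v"
    using X_pair_gaussian[OF assms assms] by blast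
  have "integrable (distr M borel (X s)) (\<lambda>x. x\<^sup>2)"
    using v integrable_gaussian_law_sq[OF v(1)] by simp
  then show ?thesis by (subst (asm) integrable_distr_eq) auto
qed

lemma X_sq: "0 \<le> s \<Longrightarrow> expectation (\<lambda>\<omega>. (X s \<omega>)\<^sup>2) = var"
  using stationary_integral[of "\<lambda>p. (fst p)\<^sup>2" 0 0 s] by (simp add: var_def)

lemma X_prod_integrable:
  assumes "0 \<le> s" "0 \<le> u" shows "integrable M (\<lambda>\<omega>. X s \<omega> * X u \<omega>)"
proof (rule Bochner_Integration.integrable_bound)
  show "integrable M (\<lambda>\<omega>. ((X s \<omega>)\<^sup>2 + (X u \<omega>)\<^sup>2) / 2)"
    using assms by (intro integrable_divide Bochner_Integration.integrable_add X_sq_integrable)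
  have "norm (x * y) \<le> norm ((x\<^sup>2 + y\<^sup>2) / 2)" for x y :: real
    using abs_mult_le_half_sum_squares[of x y] by simp
  then show "AE \<omega> in M. norm (X s \<omega> * X u \<omega>) \<le> norm (((X s \<omega>)\<^sup>2 + (X u \<omega>)\<^sup>2) / 2)" by simp
qed measurable

lemma X_prod_abs_le:
  assumes "0 \<le> s" "0 \<le> u" shows "(\<integral>\<^sup>+\<omega>. ennreal \<bar>X s \<omega> * X u \<omega>\<bar> \<partial>M) \<le> ennreal var"
proof -
  have "(\<integral>\<^sup>+\<omega>. ennreal \<bar>X s \<omega> * X u \<omega>\<bar> \<partial>M) \<le> (\<integral>\<^sup>+\<omega>. ennreal (((X s \<omega>)\<^sup>2 + (X u \<omega>)\<^sup>2) / 2) \<partial>M)"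
  proof (intro nn_integral_mono ennreal_leI)
    fix \<omega> show "\<bar>X s \<omega> * X u \<omega>\<bar> \<le> ((X s \<omega>)\<^sup>2 + (X u \<omega>)\<^sup>2) / 2"
      by (rule abs_mult_le_half_sum_squares)
  qed
  also have "\<dots> = ennreal (expectation (\<lambda>\<omega>. ((X s \<omega>)\<^sup>2 + (X u \<omega>)\<^sup>2) / 2))"
    using assms X_sq_integrable by (intro nn_integral_eq_integral) auto
  also have "expectation (\<lambda>\<omega>. ((X s \<omega>)\<^sup>2 + (X u \<omega>)\<^sup>2) / 2) = var"
    using assms X_sq_integrable by (simp add: X_sq)
  finally show ?thesis .
qed

lemma X_prod:
  assumes "0 \<le> s" "0 \<le> u" shows "expectation (\<lambda>\<omega>. X s \<omega> * X u \<omega>) = autocov (s - u)"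
proof (cases "s \<le> u")
  case True
  then show ?thesis
    using stationary_integral[of "\<lambda>p. fst p * snd p" 0 "u - s" s] assms by (simp add: autocov_def)
next
  case False
  then show ?thesis
    using stationary_integral[of "\<lambda>p. fst p * snd p" 0 "s - u" u] assms by (simp add: autocov_def mult.commute)
qed

lemma autocov_minus: "autocov (- h) = autocov h" by (simp add: autocov_def)

lemma autocov_abs_le: "\<bar>autocov h\<bar> \<le> var"
proof -
  have "ennreal \<bar>autocov h\<bar> \<le> ennreal var"
    unfolding autocov_def using abs_integral_le_nn_integral X_prod_abs_le[of 0 "\<bar>h\<bar>"] by (auto intro: order_trans)
  then show ?thesis using var_nonneg by simp
qed

lemma X_pair_law:
  assumes s: "0 \<le> s" and u: "0 \<le> u"
  shows "0 \<le> c\<^sup>2 * var + 2 * c * d * autocov (s - u) + d\<^sup>2 * var"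
    "distr M borel (\<lambda>\<omega>. c * X s \<omega> + d * X u \<omega>) = gaussian_law 0 (c\<^sup>2 * var + 2 * c * d * autocov (s - u) + d\<^sup>2 * var)"
proof -
  obtain v where v: "0 \<le> v" "distr M borel (\<lambda>\<omega>. c * X s \<omega> + d * X u \<omega>) = gaussian_law 0 v"
    using X_pair_gaussian[OF s u] by blast
  have "v = integral\<^sup>L (distr M borel (\<lambda>\<omega>. c * X s \<omega> + d * X u \<omega>)) (\<lambda>x. x\<^sup>2)"
    unfolding v(2) using v(1) by (simp add: integral_gaussian_law_sq)
  also have "\<dots> = expectation (\<lambda>\<omega>. (c * X s \<omega> + d * X u \<omega>)\<^sup>2)"
    by (subst integral_distr) auto
  also have "\<dots> = expectation (\<lambda>\<omega>. c\<^sup>2 * (X s \<omega>)\<^sup>2 + (2 * c * d) * (X s \<omega> * X u \<omega>) + d\<^sup>2 * (X u \<omega>)\<^sup>2)"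
    by (intro Bochner_Integration.integral_cong refl) (simp add: power2_eq_square algebra_simps)
  also have "\<dots> = c\<^sup>2 * var + 2 * c * d * autocov (s - u) + d\<^sup>2 * var"
    using s u X_sq_integrable X_prod_integrable by (simp add: X_sq X_prod)
  finally have "v = c\<^sup>2 * var + 2 * c * d * autocov (s - u) + d\<^sup>2 * var" .
  with v show "0 \<le> c\<^sup>2 * var + 2 * c * d * autocov (s - u) + d\<^sup>2 * var"
    "distr M borel (\<lambda>\<omega>. c * X s \<omega> + d * X u \<omega>) = gaussian_law 0 (c\<^sup>2 * var + 2 * c * d * autocov (s - u) + d\<^sup>2 * var)"
    by auto
qed

lemma X_pair_char:
  assumes s: "0 \<le> s" and u: "0 \<le> u"
  shows "(CLINT \<omega>|M. iexp (c * X s \<omega> + d * X u \<omega>)) = of_real (exp (- (c\<^sup>2 * var + 2 * c * d * autocov (s - u) + d\<^sup>2 * var) / 2))"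
proof -
  have "(CLINT \<omega>|M. iexp (c * X s \<omega> + d * X u \<omega>)) = char (distr M borel (\<lambda>\<omega>. c * X s \<omega> + d * X u \<omega>)) 1"
    unfolding char_def by (subst integral_distr) auto
  then show ?thesis using X_pair_law[OF s u, of c d] by (simp add: char_gaussian_law)
qed

text \<open>As \<open>X\<^sub>0 + X\<^sub>h\<close> is centred Gaussian, \<open>autocov h\<close> is a function of the expectation of the bounded variable
  \<open>cos (X\<^sub>0 + X\<^sub>h)\<close>, to which dominated convergence applies directly.\<close>

lemma autocov_continuous: "continuous_on A autocov"
proof -
  have e: "expectation (\<lambda>\<omega>. cos (X 0 \<omega> + X \<bar>h\<bar> \<omega>)) = exp (- (var + autocov h))" for h
  proof -
    have i: "integrable M (\<lambda>\<omega>. iexp (X 0 \<omega> + X \<bar>h\<bar> \<omega>))"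
      by (rule integrable_const_bound[where B=1]; simp)
    have "(CLINT \<omega>|M. iexp (X 0 \<omega> + X \<bar>h\<bar> \<omega>)) = of_real (exp (- (var + autocov h)))"
    proof -
      have e: "- (1\<^sup>2 * var + 2 * 1 * 1 * autocov (0 - \<bar>h\<bar>) + 1\<^sup>2 * var) / 2 = - (var + autocov h)"
        by (simp add: autocov_def field_simps)
      show ?thesis using X_pair_char[of 0 "\<bar>h\<bar>" 1 1] unfolding e by simp
    qed
    then have "exp (- (var + autocov h)) = Re (CLINT \<omega>|M. iexp (X 0 \<omega> + X \<bar>h\<bar> \<omega>))" by simp
    also have "\<dots> = (LINT \<omega>|M. Re (iexp (X 0 \<omega> + X \<bar>h\<bar> \<omega>)))"
      by (rule integral_Re[OF i, symmetric])
    finally show ?thesis by (simp add: Re_exp)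
  qed
  have "autocov h = - ln (expectation (\<lambda>\<omega>. cos (X 0 \<omega> + X \<bar>h\<bar> \<omega>))) - var" for h
    unfolding e by simp
  moreover have "continuous_on A (\<lambda>h. - ln (expectation (\<lambda>\<omega>. cos (X 0 \<omega> + X \<bar>h\<bar> \<omega>))) - var)"
  proof (intro continuous_intros)
    show "continuous_on A (\<lambda>h. expectation (\<lambda>\<omega>. cos (X 0 \<omega> + X \<bar>h\<bar> \<omega>)))"
      unfolding continuous_on_sequentially comp_def
    proof (intro allI ballI impI)
      fix x :: "nat \<Rightarrow> real" and a assume "(\<forall>n. x n \<in> A) \<and> x \<longlonglongrightarrow> a"
      then have xa: "x \<longlonglongrightarrow> a" by simp
      show "(\<lambda>n. expectation (\<lambda>\<omega>. cos (X 0 \<omega> + X \<bar>x n\<bar> \<omega>))) \<longlonglongrightarrow> expectation (\<lambda>\<omega>. cos (X 0 \<omega> + X \<bar>a\<bar> \<omega>))"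
      proof (rule integral_dominated_convergence[where w="\<lambda>_. 1"])
        show "AE \<omega> in M. (\<lambda>n. cos (X 0 \<omega> + X \<bar>x n\<bar> \<omega>)) \<longlonglongrightarrow> cos (X 0 \<omega> + X \<bar>a\<bar> \<omega>)"
        proof (rule AE_I2)
          fix \<omega> assume "\<omega> \<in> space M"
          then have "isCont (\<lambda>t. X t \<omega>) \<bar>a\<bar>"
            using X_cont by (simp add: continuous_on_eq_continuous_at)
          from isCont_tendsto_compose[OF this tendsto_rabs[OF xa]]
          show "(\<lambda>n. cos (X 0 \<omega> + X \<bar>x n\<bar> \<omega>)) \<longlonglongrightarrow> cos (X 0 \<omega> + X \<bar>a\<bar> \<omega>)"
            by (intro tendsto_intros)
        qed
      qed auto
    qed
    show "\<forall>x\<in>A. expectation (\<lambda>\<omega>. cos (X 0 \<omega> + X \<bar>x\<bar> \<omega>)) \<noteq> 0" unfolding e by simp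
  qed
  ultimately show ?thesis by simp
qed

text \<open>The variance of \<open>sig B\<^sub>t = X\<^sub>t - X\<^sub>0 + lam \<integral>\<^sub>0\<^sup>t X\<close> computed in two ways. The mixed terms
  \<open>E (X\<^sub>t \<integral>\<^sub>0\<^sup>t X)\<close> and \<open>E (X\<^sub>0 \<integral>\<^sub>0\<^sup>t X)\<close> are equal and cancel.\<close>

lemma autocov_integral_identity:
  assumes t: "0 \<le> t"
  shows "autocov t = var - sig\<^sup>2 * t powr (2 * H) / 2 + lam\<^sup>2 * integral {0..t} (\<lambda>s. integral {0..s} autocov)"
proof -
  define R where "R s = integral {0..s} autocov" for s
  define S where "S s = integral {0..s} R" for s
  have R: "(R has_real_derivative autocov x) (at x within {0..b})" if "x \<in> {0..b}" for x b
    unfolding R_def using that by (intro integral_has_real_derivative autocov_continuous)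
  have Rc: "continuous_on {0..b} R" for b
    using R by (intro DERIV_continuous_on) auto
  have S: "(S has_real_derivative R x) (at x within {0..b})" if "x \<in> {0..b}" for x b
    unfolding S_def using that by (intro integral_has_real_derivative Rc)
  have R0: "R 0 = 0" and S0: "S 0 = 0" by (simp_all add: R_def S_def)
  have ri: "autocov integrable_on {a..b}" for a b by (intro integrable_continuous_real autocov_continuous)
  have inner: "integral {0..t} (\<lambda>r. autocov (s - r)) = R s + R (t - s)" if s: "0 \<le> s" "s \<le> t" for s
  proof -
    have c: "continuous_on A (\<lambda>r. autocov (s - r))" for A
      by (rule continuous_on_compose2[OF autocov_continuous[of UNIV]]) (auto intro!: continuous_intros)
    have "integral {0..t} (\<lambda>r. autocov (s - r)) = integral {0..s} (\<lambda>r. autocov (s - r)) + integral {s..t} (\<lambda>r. autocov (s - r))"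
      using Henstock_Kurzweil_Integration.integral_combine[OF s integrable_continuous_real[OF c]] by simp
    also have "integral {0..s} (\<lambda>r. autocov (s - r)) = R s"
      unfolding R_def by (rule integral_reversed)
    also have "integral {s..t} (\<lambda>r. autocov (s - r)) = integral {s..t} (\<lambda>r. autocov (r + (- s)))"
    proof -
      have "autocov (s - r) = autocov (r + (- s))" for r using autocov_minus[of "s - r"] by simp
      then show ?thesis by simp
    qed
    also have "\<dots> = R (t - s)"
      unfolding R_def using integral_shift_real_ivl[of 0 "- s" "t - s" autocov] by simp
    finally show ?thesis .
  qed
  have Rneg: "R x = 0" if "x \<le> 0" for x using that by (cases "x = 0") (auto simp: R_def)
  have Rc': "continuous_on UNIV R"
  proof -
    have "R = (\<lambda>x. R (max 0 x))" using Rneg R0 by (auto simp: fun_eq_iff max_def)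
    moreover have "continuous_on UNIV (\<lambda>x. R (max 0 x))"
    proof (rule continuous_on_compose2[of "{0..}" R])
      show "continuous_on {0..} R"
        unfolding continuous_on_eq_continuous_within
      proof
        fix x :: real assume x: "x \<in> {0..}"
        from Rc[of "x + 1"] x have "continuous (at x within {0..x+1}) R" by (auto simp: continuous_on_eq_continuous_within)
        moreover have "at x within {0..x+1} = at x within {0..}"
          by (rule at_within_nhd[of _ "{..<x+1}"]) auto
        ultimately show "continuous (at x within {0..}) R" by simp
      qed
    qed (auto intro!: continuous_intros)
    ultimately show ?thesis by metis
  qed
  have outer: "integral {0..t} (\<lambda>s. R s + R (t - s)) = 2 * S t"
  proof -
    have c: "continuous_on A (\<lambda>s. R (t - s))" for A
      by (rule continuous_on_compose2[OF Rc']) (auto intro!: continuous_intros)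
    have "integral {0..t} (\<lambda>s. R s + R (t - s)) = integral {0..t} R + integral {0..t} (\<lambda>s. R (t - s))"
      by (intro Henstock_Kurzweil_Integration.integral_add integrable_continuous_real c Rc)
    then show ?thesis using integral_reversed[of t R] by (simp add: S_def)
  qed
  define I where "I \<omega> = (LINT s|time_interval t. X s \<omega>)" for \<omega>
  have [measurable]: "I \<in> borel_measurable M"
    unfolding I_def[abs_def] by (rule path_integral_measurable) measurable
  have sp: "s \<in> space (time_interval t) \<Longrightarrow> 0 \<le> s \<and> s \<le> t" for s by (simp add: space_restrict_space)
  note ps = prob_space_axioms
  have XI: "integrable M (\<lambda>\<omega>. X a \<omega> * I \<omega>)" "expectation (\<lambda>\<omega>. X a \<omega> * I \<omega>) = (LINT s|time_interval t. autocov (a - s))" if a: "0 \<le> a" for a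
  proof -
    note * = ps X_joint_measurable X_meas[of a] t X_prod_abs_le[OF a]
    show "integrable M (\<lambda>\<omega>. X a \<omega> * I \<omega>)"
      unfolding I_def by (rule integrable_times_path_integral[OF *])
    have "expectation (\<lambda>\<omega>. X a \<omega> * I \<omega>) = (LINT s|time_interval t. expectation (\<lambda>\<omega>. X a \<omega> * X s \<omega>))"
      unfolding I_def by (rule expectation_times_path_integral[OF *])
    also have "\<dots> = (LINT s|time_interval t. autocov (a - s))"
    proof (rule Bochner_Integration.integral_cong[OF refl])
      fix s assume "s \<in> space (time_interval t)"
      with sp[OF this] a show "expectation (\<lambda>\<omega>. X a \<omega> * X s \<omega>) = autocov (a - s)" by (simp add: X_prod)
    qed
    finally show "expectation (\<lambda>\<omega>. X a \<omega> * I \<omega>) = (LINT s|time_interval t. autocov (a - s))" .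
  qed
  have cr: "continuous_on A (\<lambda>s. autocov (a - s))" for a A
    by (rule continuous_on_compose2[OF autocov_continuous[of UNIV]]) (auto intro!: continuous_intros)
  have EtI: "expectation (\<lambda>\<omega>. X t \<omega> * I \<omega>) = R t"
    unfolding XI(2)[OF t] time_interval_integral_eq[OF cr] R_def by (rule integral_reversed)
  have E0I: "expectation (\<lambda>\<omega>. X 0 \<omega> * I \<omega>) = R t"
    unfolding XI(2)[OF order_refl] time_interval_integral_eq[OF cr] R_def by (simp add: autocov_minus)
  note II = ps X_joint_measurable t var_nonneg X_prod_abs_le
  have iII: "integrable M (\<lambda>\<omega>. (I \<omega>)\<^sup>2)"
    unfolding I_def by (rule integrable_path_integral_square[OF II])
  have EII: "expectation (\<lambda>\<omega>. (I \<omega>)\<^sup>2) = 2 * S t"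
  proof -
    have "expectation (\<lambda>\<omega>. (I \<omega>)\<^sup>2) = (LINT s|time_interval t. LINT r|time_interval t. expectation (\<lambda>\<omega>. X s \<omega> * X r \<omega>))"
      unfolding I_def by (rule expectation_path_integral_square[OF II])
    also have "\<dots> = (LINT s|time_interval t. LINT r|time_interval t. autocov (s - r))"
    proof (intro Bochner_Integration.integral_cong[OF refl])
      fix s r assume "s \<in> space (time_interval t)" "r \<in> space (time_interval t)"
      with sp[OF this(1)] sp[OF this(2)] show "expectation (\<lambda>\<omega>. X s \<omega> * X r \<omega>) = autocov (s - r)" by (simp add: X_prod)
    qed
    also have "\<dots> = (LINT s|time_interval t. R s + R (t - s))"
    proof (rule Bochner_Integration.integral_cong[OF refl])
      fix s assume "s \<in> space (time_interval t)"
      with sp[OF this] show "(LINT r|time_interval t. autocov (s - r)) = R s + R (t - s)"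
        by (simp add: time_interval_integral_eq[OF cr] inner)
    qed
    also have "\<dots> = integral {0..t} (\<lambda>s. R s + R (t - s))"
      by (intro time_interval_integral_eq continuous_intros Rc continuous_on_compose2[OF Rc']) auto
    finally show ?thesis using outer by simp
  qed
  have "sig\<^sup>2 * t powr (2 * H) = expectation (\<lambda>\<omega>. sig\<^sup>2 * (B t \<omega>)\<^sup>2)"
    using B_variance[OF t] by simp
  also have "\<dots> = expectation (\<lambda>\<omega>. (X t \<omega>)\<^sup>2 + (X 0 \<omega>)\<^sup>2 + (-2) * (X t \<omega> * X 0 \<omega>) + (2 * lam) * (X t \<omega> * I \<omega>)
      + (- 2 * lam) * (X 0 \<omega> * I \<omega>) + lam\<^sup>2 * (I \<omega>)\<^sup>2)"
  proof (rule Bochner_Integration.integral_cong[OF refl])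
    fix \<omega> assume w: "\<omega> \<in> space M"
    have "I \<omega> = integral {0..t} (\<lambda>s. X s \<omega>)"
      unfolding I_def using X_cont[OF w] by (intro time_interval_integral_eq) (auto intro: continuous_on_subset)
    then have "sig * B t \<omega> = X t \<omega> - X 0 \<omega> + lam * I \<omega>" using X_eq[OF w t] by simp
    moreover have "sig\<^sup>2 * (B t \<omega>)\<^sup>2 = (sig * B t \<omega>)\<^sup>2" by (simp add: power_mult_distrib)
    ultimately show "sig\<^sup>2 * (B t \<omega>)\<^sup>2 = (X t \<omega>)\<^sup>2 + (X 0 \<omega>)\<^sup>2 + (-2) * (X t \<omega> * X 0 \<omega>) + (2 * lam) * (X t \<omega> * I \<omega>)
      + (- 2 * lam) * (X 0 \<omega> * I \<omega>) + lam\<^sup>2 * (I \<omega>)\<^sup>2"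
      by (simp only:) (simp add: power2_eq_square algebra_simps)
  qed
  also have "\<dots> = var + var + (-2) * autocov t + (2 * lam) * R t + (-2 * lam) * R t + lam\<^sup>2 * (2 * S t)"
    using t X_sq_integrable X_prod_integrable XI(1) iII
    by (simp add: X_sq X_prod EtI E0I EII)
  finally show ?thesis unfolding S_def R_def by (simp add: field_simps)
qed

end

section \<open>Decay of correlations\<close>

context stationary_fOU
begin

lemma var_pos: "0 < var"
proof (rule ccontr)
  assume "\<not> 0 < var"
  with var_nonneg have v: "var = 0" by simp
  then have r: "autocov = (\<lambda>_. 0)" using autocov_abs_le by (auto simp: fun_eq_iff)
  from autocov_integral_identity[of 1] have "0 = - (sig\<^sup>2) / 2" unfolding r v by simp
  then show False using sig by simp
qed

text \<open>For \<open>H = 1/2\<close> the forcing term \<open>H (2H - 1) t powr (2H - 2)\<close> vanishes, and any exponent would do. One larger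
  than \<open>1\<close> makes the autocovariance integrable and avoids a logarithm in the final rate.\<close>

definition decay_exponent :: real where "decay_exponent = (if H = 1 / 2 then 2 else 2 - 2 * H)"

lemma decay_exponent_pos: "0 < decay_exponent" using H by (simp add: decay_exponent_def)

lemma autocov_decay: "\<exists>C T. 0 < C \<and> 0 < T \<and> (\<forall>t\<ge>T. \<bar>autocov t\<bar> \<le> C * t powr (- decay_exponent))"
proof -
  define R where "R s = integral {0..s} autocov" for s
  define S where "S s = integral {0..s} R" for s
  have R: "(R has_real_derivative autocov x) (at x within {0..b})" if "x \<in> {0..b}" for x b
    unfolding R_def using that by (intro integral_has_real_derivative autocov_continuous)
  have Rc: "continuous_on {0..b} R" for b
    using R by (intro DERIV_continuous_on) auto
  have S: "(S has_real_derivative R x) (at x within {0..b})" if "x \<in> {0..b}" for x b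
    unfolding S_def using that by (intro integral_has_real_derivative Rc)
  have R': "(R has_real_derivative autocov x) (at x)" if "0 < x" for x
    using R[of x "x + 1"] that at_within_Icc_at[of 0 x "x + 1"] by simp
  have S': "(S has_real_derivative R x) (at x)" if "0 < x" for x
    using S[of x "x + 1"] that at_within_Icc_at[of 0 x "x + 1"] by simp
  define r' where "r' t = - (sig\<^sup>2 * H * t powr (2 * H - 1)) + lam\<^sup>2 * R t" for t
  define f where "f t = sig\<^sup>2 * H * (2 * H - 1) * t powr (2 * H - 2)" for t
  show ?thesis
  proof (rule decay_of_bounded_solution[OF lam decay_exponent_pos, where r=autocov and r'=r' and f=f and v=var and K="sig\<^sup>2 * H * \<bar>2 * H - 1\<bar>"])
    show "0 \<le> sig\<^sup>2 * H * \<bar>2 * H - 1\<bar>" using H by simp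
    fix t :: real
    show "\<bar>autocov t\<bar> \<le> var" by (rule autocov_abs_le)
    assume t: "0 < t"
    have "((\<lambda>t. var - sig\<^sup>2 * t powr (2 * H) / 2 + lam\<^sup>2 * S t) has_real_derivative r' t) (at t)"
      unfolding r'_def using t by (auto intro!: derivative_eq_intros S')
    then show "(autocov has_real_derivative r' t) (at t)"
      by (rule has_field_derivative_transform_within_open[where S="{0<..}"])
        (use t in \<open>simp_all add: autocov_integral_identity S_def R_def[abs_def]\<close>)
    show "(r' has_real_derivative lam\<^sup>2 * autocov t - f t) (at t)"
      unfolding r'_def f_def using t by (auto intro!: derivative_eq_intros R')
    show "\<bar>f t\<bar> \<le> sig\<^sup>2 * H * \<bar>2 * H - 1\<bar> * t powr (- decay_exponent)"
    proof (cases "H = 1 / 2")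
      case True
      then have "2 * H - 1 = 0" by simp
      then show ?thesis by (simp add: f_def)
    next
      case False
      then show ?thesis using H by (simp add: f_def decay_exponent_def abs_mult)
    qed
  qed
qed

lemma autocov_tendsto_0: "(autocov \<longlongrightarrow> 0) at_top"
proof -
  obtain C T where CT: "0 < C" "0 < T" "\<And>t. t \<ge> T \<Longrightarrow> \<bar>autocov t\<bar> \<le> C * t powr (- decay_exponent)"
    using autocov_decay by blast
  have "((\<lambda>t::real. t powr (- decay_exponent)) \<longlongrightarrow> 0) at_top"
    by (rule tendsto_neg_powr) (use decay_exponent_pos in \<open>auto intro: filterlim_ident\<close>)
  then have "((\<lambda>t. C * t powr (- decay_exponent)) \<longlongrightarrow> C * 0) at_top" by (rule tendsto_mult_left)
  then show ?thesis
    by (intro Lim_null_comparison[of autocov "\<lambda>t. C * t powr (- decay_exponent)"])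
       (auto simp: eventually_at_top_linorder intro!: exI[of _ T] CT)
qed

text \<open>If \<open>X t\<close> were perfectly correlated with \<open>X 0\<close>, then by stationarity \<open>X (k t) = \<plusminus> X 0\<close> for all \<open>k\<close>, against the decay of
  correlations.\<close>

lemma autocov_abs_less:
  assumes t: "0 < t" shows "\<bar>autocov t\<bar> < var"
proof (rule ccontr)
  assume "\<not> \<bar>autocov t\<bar> < var"
  with autocov_abs_le[of t] have eq: "\<bar>autocov t\<bar> = var" by simp
  define e where "e = sgn (autocov t)"
  have e: "e * autocov t = var" "e * e = 1" using eq var_pos by (auto simp: e_def sgn_if)
  have step: "AE \<omega> in M. X (real (Suc k) * t) \<omega> = e * X (real k * t) \<omega>" for k
  proof -
    let ?a = "real (Suc k) * t" and ?b = "real k * t"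
    let ?D = "\<lambda>\<omega>. X ?a \<omega> - e * X ?b \<omega>" and ?Q = "\<lambda>\<omega>. (X ?a \<omega>)\<^sup>2 + (- 2 * e) * (X ?a \<omega> * X ?b \<omega>) + (X ?b \<omega>)\<^sup>2"
    have ab: "0 \<le> ?a" "0 \<le> ?b" "?a - ?b = t" using t by (auto simp: algebra_simps)
    have i: "integrable M (\<lambda>\<omega>. ?Q \<omega>)"
      using ab by (intro Bochner_Integration.integrable_add integrable_mult_right X_sq_integrable X_prod_integrable) auto
    have sq: "(?D \<omega>)\<^sup>2 = ?Q \<omega>" for \<omega>
    proof -
      have "(?D \<omega>)\<^sup>2 = (X ?a \<omega>)\<^sup>2 + (- 2 * e) * (X ?a \<omega> * X ?b \<omega>) + (e * e) * (X ?b \<omega>)\<^sup>2"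
        by (simp add: power2_eq_square algebra_simps)
      then show ?thesis by (simp add: e)
    qed
    have "expectation (\<lambda>\<omega>. (?D \<omega>)\<^sup>2) = var + (- 2 * e) * autocov (?a - ?b) + var"
      unfolding sq
      by (subst Bochner_Integration.integral_add; (subst Bochner_Integration.integral_add)?;
          (intro Bochner_Integration.integrable_add integrable_mult_right X_sq_integrable X_prod_integrable ab)?)
         (simp only: integral_mult_right_zero X_sq[OF ab(1)] X_sq[OF ab(2)] X_prod[OF ab(1,2)])
    also have "\<dots> = 0" using e unfolding ab by simp
    finally have "expectation (\<lambda>\<omega>. (?D \<omega>)\<^sup>2) = 0" .
    then have "AE \<omega> in M. (?D \<omega>)\<^sup>2 = 0"
      using integral_nonneg_eq_0_iff_AE[of M "\<lambda>\<omega>. (?D \<omega>)\<^sup>2"] i unfolding sq[symmetric] by simp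
    then show ?thesis by simp
  qed
  have all: "AE \<omega> in M. X (real k * t) \<omega> = e ^ k * X 0 \<omega>" for k
  proof (induction k)
    case (Suc k)
    from Suc step[of k] show ?case by eventually_elim simp
  qed simp
  have "\<bar>autocov (real k * t)\<bar> = var" for k
  proof -
    have "autocov (real k * t) = expectation (\<lambda>\<omega>. X 0 \<omega> * X (real k * t) \<omega>)" using t by (simp add: autocov_def)
    also have "\<dots> = expectation (\<lambda>\<omega>. e ^ k * (X 0 \<omega>)\<^sup>2)"
    proof (rule integral_cong_AE)
      show "AE \<omega> in M. X 0 \<omega> * X (real k * t) \<omega> = e ^ k * (X 0 \<omega>)\<^sup>2"
        using all[of k] by eventually_elim (simp add: power2_eq_square)
    qed measurable
    also have "\<dots> = e ^ k * var" by (simp add: var_def)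
    finally have "\<bar>autocov (real k * t)\<bar> = \<bar>e\<bar> ^ k * var" using var_pos by (simp add: abs_mult power_abs)
    moreover have "\<bar>e\<bar> = 1" using e(2) by (metis abs_mult_self_eq abs_1 abs_square_eq_1 power2_eq_square)
    ultimately show ?thesis by simp
  qed
  moreover have "(\<lambda>k. autocov (real k * t)) \<longlonglongrightarrow> 0"
    using t by (intro filterlim_compose[OF autocov_tendsto_0] filterlim_at_top_mult_tendsto_pos[OF tendsto_const] filterlim_real_sequentially)
  then have "(\<lambda>k. \<bar>autocov (real k * t)\<bar>) \<longlonglongrightarrow> 0" by (rule tendsto_rabs_zero)
  ultimately show False using var_pos by (simp add: LIMSEQ_const_iff)
qed

text \<open>Near \<open>0\<close> the term \<open>sig\<^sup>2 u powr (2H) / 2\<close> of the integral identity dominates the double integral, which is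
  of order \<open>u\<^sup>2\<close>. On the rest of the interval compactness applies.\<close>

lemma correlation_gap:
  assumes T: "0 < T"
  shows "\<exists>c>0. \<forall>u. 0 < u \<longrightarrow> u \<le> T \<longrightarrow> c * u powr (2 * H) \<le> 1 - (autocov u / var)\<^sup>2"
proof -
  define r where "r u = autocov u / var" for u
  have r1: "\<bar>r u\<bar> \<le> 1" for u using autocov_abs_le[of u] var_pos by (simp add: r_def abs_divide)
  have rl: "\<bar>r u\<bar> < 1" if "0 < u" for u using autocov_abs_less[OF that] var_pos by (simp add: r_def abs_divide)
  have rc: "continuous_on A r" for A unfolding r_def using var_pos by (intro continuous_intros autocov_continuous) auto
  define R where "R s = integral {0..s} autocov" for s
  have Rle: "R s \<le> var * s" if "0 \<le> s" for s
  proof -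
    have "norm (R s) \<le> var * (s - 0)"
      unfolding R_def by (rule integral_bound[OF that autocov_continuous]) (use autocov_abs_le in auto)
    then show ?thesis by simp
  qed
  have Rc: "continuous_on {0..b} R" for b
    unfolding R_def by (intro indefinite_integral_continuous_1 integrable_continuous_real autocov_continuous)
  have Sle: "integral {0..u} R \<le> var * u\<^sup>2" if u: "0 \<le> u" for u
  proof -
    have "integral {0..u} R \<le> integral {0..u} (\<lambda>_. var * u)"
    proof (rule integral_le)
      show "R integrable_on {0..u}" by (intro integrable_continuous_real Rc)
      show "R x \<le> var * u" if "x \<in> {0..u}" for x
        using that var_pos by (intro order_trans[OF Rle] mult_left_mono) auto
    qed (rule integrable_const_ivl)
    then show ?thesis using u by (simp add: power2_eq_square algebra_simps)
  qed
  have "isCont r 0" using rc[of UNIV] by (simp add: continuous_on_eq_continuous_at)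
  moreover have "r 0 = 1" using var_pos by (simp add: r_def autocov_0)
  ultimately have "eventually (\<lambda>u. r u > 0) (at 0)"
    by (intro order_tendstoD(1)[where y=1]) (auto simp: isCont_def)
  then obtain d where d: "d > 0" "\<And>u. u \<noteq> 0 \<Longrightarrow> \<bar>u\<bar> < d \<Longrightarrow> r u > 0"
    by (auto simp: eventually_at dist_real_def)
  \<comment> \<open>if \<open>u powr (2 - 2H) \<le> q\<close>, the double integral term is at most half of \<open>sig\<^sup>2 u powr (2H) / 2\<close>\<close>
  define q where "q = sig\<^sup>2 / (4 * lam\<^sup>2 * var)"
  have q: "q > 0" using sig lam var_pos by (simp add: q_def)
  define eps where "eps = min (d / 2) (min T (q powr (1 / (2 - 2 * H))))"
  have eps: "0 < eps" "eps \<le> T" "eps < d" using d T q by (auto simp: eps_def min_def)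
  have near: "sig\<^sup>2 / (4 * var) * u powr (2 * H) \<le> 1 - (r u)\<^sup>2" if u: "0 < u" "u \<le> eps" for u
  proof -
    have r0: "0 < r u" using d(2)[of u] u eps by auto
    have "u powr (2 - 2 * H) \<le> (q powr (1 / (2 - 2 * H))) powr (2 - 2 * H)"
      using u H by (intro powr_mono2) (auto simp: eps_def)
    also have "\<dots> = q" using H q by (simp add: powr_powr)
    finally have "u powr (2 - 2 * H) * u powr (2 * H) \<le> q * u powr (2 * H)" by (intro mult_right_mono) auto
    moreover have "u powr (2 - 2 * H) * u powr (2 * H) = u\<^sup>2" using u by (simp add: powr_add[symmetric])
    ultimately have "u\<^sup>2 \<le> q * u powr (2 * H)" by simp
    then have "lam\<^sup>2 * (var * u\<^sup>2) \<le> lam\<^sup>2 * (var * (q * u powr (2 * H)))"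
      using var_pos by (intro mult_left_mono) auto
    also have "\<dots> = sig\<^sup>2 * u powr (2 * H) / 4" using var_pos lam by (simp add: q_def)
    finally have "lam\<^sup>2 * integral {0..u} R \<le> sig\<^sup>2 * u powr (2 * H) / 4"
      using mult_left_mono[OF Sle[of u], of "lam\<^sup>2"] u by simp
    then have "var - autocov u \<ge> sig\<^sup>2 * u powr (2 * H) / 4"
      using autocov_integral_identity[of u] u by (simp add: R_def[abs_def])
    then have "(var - autocov u) / var \<ge> sig\<^sup>2 * u powr (2 * H) / 4 / var" using var_pos by (intro divide_right_mono) auto
    moreover have "(var - autocov u) / var = 1 - r u" using var_pos by (simp add: r_def diff_divide_distrib)
    ultimately have "1 - r u \<ge> sig\<^sup>2 / (4 * var) * u powr (2 * H)" by (simp add: field_simps)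
    moreover have "(r u)\<^sup>2 \<le> r u" using r0 r1[of u] by (simp add: power2_eq_square mult_left_le)
    ultimately show ?thesis by simp
  qed
  have "continuous_on {eps..T} (\<lambda>u. 1 - (r u)\<^sup>2)" by (intro continuous_intros rc)
  from continuous_attains_inf[OF compact_Icc _ this] eps
  obtain m where m: "m \<in> {eps..T}" "\<And>u. u \<in> {eps..T} \<Longrightarrow> 1 - (r m)\<^sup>2 \<le> 1 - (r u)\<^sup>2"
    by auto
  have mp: "1 - (r m)\<^sup>2 > 0" using rl[of m] m(1) eps by (simp add: abs_square_less_1)
  define c where "c = min (sig\<^sup>2 / (4 * var)) ((1 - (r m)\<^sup>2) / T powr (2 * H))"
  have c: "c > 0" using sig var_pos mp T by (simp add: c_def)
  have "c * u powr (2 * H) \<le> 1 - (r u)\<^sup>2" if u: "0 < u" "u \<le> T" for u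
  proof (cases "u \<le> eps")
    case True
    have "c * u powr (2 * H) \<le> sig\<^sup>2 / (4 * var) * u powr (2 * H)" by (intro mult_right_mono) (auto simp: c_def)
    with near[OF u(1) True] show ?thesis by simp
  next
    case False
    have "c * u powr (2 * H) \<le> (1 - (r m)\<^sup>2) / T powr (2 * H) * T powr (2 * H)"
      using u H mp T by (intro mult_mono powr_mono2) (auto simp: c_def)
    also have "\<dots> = 1 - (r m)\<^sup>2" using T by simp
    also have "\<dots> \<le> 1 - (r u)\<^sup>2" using False u by (intro m) auto
    finally show ?thesis .
  qed
  then show ?thesis using c by (auto simp: r_def)
qed

end

section \<open>Bivariate Gaussian densities\<close>

text \<open>The centred bivariate normal density with variances \<open>v\<close> and correlation \<open>r\<close>, written as a marginal times
  a conditional density so that integrating out \<open>y\<close> first is immediate.\<close>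

definition binormal_density :: "real \<Rightarrow> real \<Rightarrow> real \<Rightarrow> real \<Rightarrow> real" where
  "binormal_density v r x y = normal_density 0 (sqrt v) x * normal_density (r * x) (sqrt (v * (1 - r\<^sup>2))) y"

lemma binormal_density_nonneg: "0 \<le> binormal_density v r x y"
  by (simp add: binormal_density_def)

lemma binormal_density_measurable [measurable]:
  "(\<lambda>p. binormal_density v r (fst p) (snd p)) \<in> borel_measurable (borel \<Otimes>\<^sub>M borel)"
  unfolding binormal_density_def normal_density_def by measurable

lemma binormal_density_eq:
  assumes v: "0 < v" and r: "\<bar>r\<bar> < 1"
  shows "binormal_density v r x y =
    1 / (2 * pi * v * sqrt (1 - r\<^sup>2)) * exp (- (x\<^sup>2 - 2 * r * x * y + y\<^sup>2) / (2 * v * (1 - r\<^sup>2)))"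
proof -
  let ?Q = "x\<^sup>2 - 2 * r * x * y + y\<^sup>2" and ?q = "1 - r\<^sup>2"
  have q: "0 < 1 - r\<^sup>2" using r by (simp add: abs_square_less_1)
  have e: "- (x\<^sup>2) / (2 * v) + - ((y - r * x)\<^sup>2) / (2 * (v * ?q)) = - ?Q / (2 * v * ?q)"
  proof -
    have "- (x\<^sup>2) / (2 * v) = - (x\<^sup>2 * ?q) / (2 * v * ?q)" using q by simp
    then have "- (x\<^sup>2) / (2 * v) + - ((y - r * x)\<^sup>2) / (2 * (v * ?q))
        = (- (x\<^sup>2 * ?q) + - ((y - r * x)\<^sup>2)) / (2 * v * ?q)"
      by (simp only: add_divide_distrib mult.assoc)
    also have "- (x\<^sup>2 * ?q) + - ((y - r * x)\<^sup>2) = - ?Q"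
      by (simp add: power2_eq_square algebra_simps)
    finally show ?thesis .
  qed
  have "sqrt (2 * pi * v) * sqrt (2 * pi * (v * ?q)) = sqrt ((2 * pi * v)\<^sup>2 * ?q)"
    unfolding real_sqrt_mult[symmetric] by (simp add: power2_eq_square algebra_simps)
  also have "\<dots> = 2 * pi * v * sqrt ?q" using v by (simp add: real_sqrt_mult)
  finally have s: "sqrt (2 * pi * v) * sqrt (2 * pi * (v * ?q)) = 2 * pi * v * sqrt ?q" .
  have "binormal_density v r x y = (1 / sqrt (2 * pi * v) * exp (- (x\<^sup>2) / (2 * v))) *
      (1 / sqrt (2 * pi * (v * ?q)) * exp (- ((y - r * x)\<^sup>2) / (2 * (v * ?q))))"
    using v q by (simp add: binormal_density_def normal_density_def)
  also have "\<dots> = 1 / (sqrt (2 * pi * v) * sqrt (2 * pi * (v * ?q))) *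
      exp (- (x\<^sup>2) / (2 * v) + - ((y - r * x)\<^sup>2) / (2 * (v * ?q)))"
    by (simp only: exp_add) simp
  finally show ?thesis unfolding s e .
qed

text \<open>The largest eigenvalue of the correlation matrix is \<open>1 + \<bar>r\<bar> \<le> 2\<close>.\<close>

lemma binormal_density_le:
  assumes v: "0 < v" and r: "\<bar>r\<bar> < 1"
  shows "binormal_density v r x y \<le> 1 / (2 * pi * v) / sqrt (1 - r\<^sup>2) * (exp (- x\<^sup>2 / (4 * v)) * exp (- y\<^sup>2 / (4 * v)))"
proof -
  let ?Q = "x\<^sup>2 - 2 * r * x * y + y\<^sup>2" and ?q = "1 - r\<^sup>2"
  have q: "0 < 1 - r\<^sup>2" using r by (simp add: abs_square_less_1)
  have "(x\<^sup>2 + y\<^sup>2) * ?q \<le> 2 * ?Q"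
  proof -
    have "2 * ?Q - (x\<^sup>2 + y\<^sup>2) * ?q = (x - r * y)\<^sup>2 + (y - r * x)\<^sup>2 + 0"
      by (simp add: power2_eq_square algebra_simps)
    moreover have "0 \<le> (x - r * y)\<^sup>2 + (y - r * x)\<^sup>2" by simp
    ultimately show ?thesis by linarith
  qed
  then have "(x\<^sup>2 + y\<^sup>2) / (4 * v) \<le> ?Q / (2 * v * ?q)"
  proof -
    assume *: "(x\<^sup>2 + y\<^sup>2) * ?q \<le> 2 * ?Q"
    have "(x\<^sup>2 + y\<^sup>2) / (4 * v) = (x\<^sup>2 + y\<^sup>2) * ?q / (4 * v * ?q)"
      using q by (intro nonzero_mult_divide_mult_cancel_right[symmetric]) simp
    also have "\<dots> \<le> 2 * ?Q / (4 * v * ?q)"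
      using v q by (intro divide_right_mono *) auto
    also have "\<dots> = 2 * ?Q / (2 * (2 * v * ?q))" by (simp only: mult.assoc)
    also have "\<dots> = ?Q / (2 * v * ?q)"
      by (rule nonzero_mult_divide_mult_cancel_left) simp
    finally show ?thesis .
  qed
  then have "exp (- ?Q / (2 * v * ?q)) \<le> exp (- x\<^sup>2 / (4 * v) + - y\<^sup>2 / (4 * v))"
  proof -
    assume *: "(x\<^sup>2 + y\<^sup>2) / (4 * v) \<le> ?Q / (2 * v * ?q)"
    have e: "- x\<^sup>2 / (4 * v) + - y\<^sup>2 / (4 * v) = - ((x\<^sup>2 + y\<^sup>2) / (4 * v))" by (simp add: add_divide_distrib)
    have e': "- P / Q = - (P / Q)" for P Q :: real by simp
    show ?thesis unfolding e exp_le_cancel_iff unfolding e' by (rule le_imp_neg_le[OF *])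
  qed
  then have "1 / (2 * pi * v * sqrt ?q) * exp (- ?Q / (2 * v * ?q))
     \<le> 1 / (2 * pi * v * sqrt ?q) * exp (- x\<^sup>2 / (4 * v) + - y\<^sup>2 / (4 * v))"
    using v q by (intro mult_left_mono) auto
  then show ?thesis unfolding binormal_density_eq[OF assms] by (simp only: exp_add) simp
qed

lemma abs_exp_minus_1_le: "\<bar>exp a - 1\<bar> \<le> \<bar>a\<bar> * exp \<bar>a\<bar>" for a :: real
proof (cases "0 \<le> a")
  case True
  have "1 - a \<le> exp (- a)" using exp_ge_add_one_self[of "- a"] by simp
  then have "(1 - a) * exp a \<le> exp (- a) * exp a" by (intro mult_right_mono) auto
  then have "exp a - 1 \<le> a * exp a" by (simp add: exp_minus algebra_simps)
  then show ?thesis using True by simp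
next
  case False
  then have "\<bar>exp a - 1\<bar> = 1 - exp a" "\<bar>a\<bar> = - a" by auto
  then have "\<bar>exp a - 1\<bar> \<le> \<bar>a\<bar> * 1" using exp_ge_add_one_self[of a] by linarith
  also have "\<dots> \<le> \<bar>a\<bar> * exp \<bar>a\<bar>" by (intro mult_left_mono) auto
  finally show ?thesis .
qed

text \<open>The quotient of the two densities is \<open>exp a\<close> with \<open>\<bar>a\<bar> \<le> \<bar>r\<bar> (1 + 2s/3)\<close>, where \<open>s = (x\<^sup>2 + y\<^sup>2) / v\<close>. For
  \<open>\<bar>r\<bar> \<le> 1/8\<close> the growth of \<open>\<bar>a\<bar> exp \<bar>a\<bar>\<close> is absorbed by lowering the exponent from \<open>s/2\<close> to \<open>s/3\<close>. What
  matters about \<open>1/3\<close> is that it exceeds \<open>1/4\<close>: then the square of \<open>exp (- x\<^sup>2/(3v))\<close> divided by the normal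
  density is integrable.\<close>

lemma binormal_density_diff_le:
  assumes v: "0 < v" and r: "\<bar>r\<bar> \<le> 1 / 8"
  shows "\<bar>binormal_density v r x y - binormal_density v 0 x y\<bar>
    \<le> 8 / (pi * v) * \<bar>r\<bar> * (exp (- x\<^sup>2 / (3 * v)) * exp (- y\<^sup>2 / (3 * v)))"
proof -
  define s where "s = (x\<^sup>2 + y\<^sup>2) / v"
  let ?q = "1 - r\<^sup>2" and ?u = "2 * r * (x * y) / v - r\<^sup>2 * s"
  have s0: "0 \<le> s" using v by (simp add: s_def)
  have r2: "r\<^sup>2 \<le> \<bar>r\<bar> / 8"
    using mult_left_mono[OF r, of "\<bar>r\<bar>"] by (simp add: power2_eq_square)
  then have q: "63 / 64 \<le> 1 - r\<^sup>2" using r by linarith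
  have r1: "\<bar>r\<bar> < 1" using r by simp
  define a where "a = - ln ?q / 2 + ?u / (2 * ?q)"
  have dens: "binormal_density v r x y = 1 / (2 * pi * v) * exp (- s / 2) * exp a"
  proof -
    have "exp (- ln ?q / 2) = 1 / sqrt ?q"
    proof -
      have "exp (- ln ?q / 2) = ?q powr (- (1 / 2))" using q by (simp add: powr_def)
      then show ?thesis using q by (simp add: powr_minus powr_half_sqrt inverse_eq_divide)
    qed
    moreover have "- s / 2 + ?u / (2 * ?q) = - (x\<^sup>2 - 2 * r * x * y + y\<^sup>2) / (2 * v * ?q)"
    proof -
      have qn: "1 - r\<^sup>2 \<noteq> 0" using q by linarith
      have "- s / 2 = - s * ?q / (2 * ?q)"
        using qn by (rule nonzero_mult_divide_mult_cancel_right[symmetric])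
      then have "- s / 2 + ?u / (2 * ?q) = (- s * ?q + ?u) / (2 * ?q)"
        by (simp only: add_divide_distrib)
      also have "- s * ?q + ?u = - (x\<^sup>2 - 2 * r * x * y + y\<^sup>2) / v"
        by (simp add: s_def algebra_simps add_divide_distrib diff_divide_distrib)
      finally show ?thesis by (simp add: mult.assoc)
    qed
    ultimately show ?thesis
      unfolding binormal_density_eq[OF v r1] a_def exp_add
      by (simp add: exp_add[symmetric])
  qed
  have dens0: "binormal_density v 0 x y = 1 / (2 * pi * v) * exp (- s / 2)"
  proof -
    have "\<bar>0::real\<bar> < 1" by simp
    from binormal_density_eq[OF v this] show ?thesis
      by (simp add: s_def minus_divide_left[symmetric] diff_divide_distrib add_divide_distrib mult.commute)
  qed
  have a1: "\<bar>a\<bar> \<le> \<bar>r\<bar> * (1 + 2 * s / 3)"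
  proof -
    have l0: "0 \<le> - ln ?q" using q by (simp add: ln_le_zero_iff)
    have "- ln ?q = ln (1 / ?q)" using q by (simp add: ln_div)
    also have "\<dots> \<le> 1 / ?q - 1" using q by (intro ln_le_minus_one) auto
    also have "\<dots> \<le> 2 * \<bar>r\<bar>"
    proof -
      have "1 / ?q - 1 = r\<^sup>2 / ?q" using q by (simp add: field_simps)
      also have "\<dots> \<le> r\<^sup>2 / (63 / 64)" using q by (intro divide_left_mono) auto
      also have "\<dots> \<le> 2 * \<bar>r\<bar>" using r2 by simp
      finally show ?thesis .
    qed
    finally have l1: "\<bar>- ln ?q / 2\<bar> \<le> \<bar>r\<bar>" using l0 by simp
    have "\<bar>?u\<bar> \<le> \<bar>2 * r * (x * y) / v\<bar> + \<bar>r\<^sup>2 * s\<bar>" by (rule abs_triangle_ineq4)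
    also have "\<dots> \<le> \<bar>r\<bar> * s + \<bar>r\<bar> / 8 * s"
    proof (rule add_mono)
      have "2 * \<bar>x * y\<bar> \<le> x\<^sup>2 + y\<^sup>2" using abs_mult_le_half_sum_squares[of x y] by simp
      then have "2 * \<bar>x * y\<bar> / v \<le> s"
        unfolding s_def using v by (intro divide_right_mono) auto
      then have "\<bar>r\<bar> * (2 * \<bar>x * y\<bar> / v) \<le> \<bar>r\<bar> * s" by (intro mult_left_mono) auto
      then show "\<bar>2 * r * (x * y) / v\<bar> \<le> \<bar>r\<bar> * s" using v by (simp add: abs_mult mult.left_commute mult.assoc)
      show "\<bar>r\<^sup>2 * s\<bar> \<le> \<bar>r\<bar> / 8 * s" using mult_right_mono[OF r2 s0] s0 by (simp add: abs_mult)
    qed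
    finally have n: "\<bar>?u\<bar> \<le> 9 / 8 * (\<bar>r\<bar> * s)"
      by (simp add: mult.commute[of s])
    have "\<bar>?u / (2 * ?q)\<bar> = \<bar>?u\<bar> / (2 * ?q)"
      using q by (simp add: abs_divide)
    also have "\<dots> \<le> 9 / 8 * (\<bar>r\<bar> * s) / (63 / 32)"
      using n q s0 by (intro frac_le) auto
    also have "\<dots> \<le> 2 / 3 * (\<bar>r\<bar> * s)" using s0 by simp
    finally have l2: "\<bar>?u / (2 * ?q)\<bar> \<le> 2 / 3 * (\<bar>r\<bar> * s)" .
    have "\<bar>a\<bar> \<le> \<bar>- ln ?q / 2\<bar> + \<bar>?u / (2 * ?q)\<bar>"
      unfolding a_def by (rule abs_triangle_ineq)
    then show ?thesis using l1 l2 by (simp add: algebra_simps)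
  qed
  have "\<bar>r\<bar> * (1 + 2 * s / 3) \<le> 1 / 8 * (1 + 2 * s / 3)" using r s0 by (intro mult_right_mono) auto
  then have a2: "\<bar>a\<bar> \<le> 1 / 8 + s / 12" using a1 by simp
  have "exp \<bar>a\<bar> \<le> exp (1 / 8) * exp (s / 12)" using a2 by (simp add: exp_add[symmetric])
  also have "exp (1 / 8 :: real) \<le> 2"
    using exp_le_cancel_iff[of "1/8" "ln 2::real"] ln2_ge_two_thirds by simp
  finally have e1: "exp \<bar>a\<bar> \<le> 2 * exp (s / 12)" by simp
  have e2: "1 + 2 * s / 3 \<le> 8 * exp (s / 12)"
    using exp_ge_add_one_self[of "s / 12"] by linarith
  have "\<bar>binormal_density v r x y - binormal_density v 0 x y\<bar> = 1 / (2 * pi * v) * exp (- s / 2) * \<bar>exp a - 1\<bar>"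
  proof -
    have "binormal_density v r x y - binormal_density v 0 x y = (1 / (2 * pi * v) * exp (- s / 2)) * (exp a - 1)"
      unfolding dens dens0 by (simp only: right_diff_distrib mult_1_right)
    then show ?thesis using v by (simp add: abs_mult)
  qed
  also have "\<dots> \<le> 1 / (2 * pi * v) * exp (- s / 2) * ((\<bar>r\<bar> * (8 * exp (s / 12))) * (2 * exp (s / 12)))"
  proof (rule mult_left_mono)
    have "\<bar>exp a - 1\<bar> \<le> \<bar>a\<bar> * exp \<bar>a\<bar>" by (rule abs_exp_minus_1_le)
    also have "\<dots> \<le> (\<bar>r\<bar> * (8 * exp (s / 12))) * (2 * exp (s / 12))"
    proof (intro mult_mono e1)
      show "\<bar>a\<bar> \<le> \<bar>r\<bar> * (8 * exp (s / 12))"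
        by (rule order_trans[OF a1]) (intro mult_left_mono e2, simp)
    qed auto
    finally show "\<bar>exp a - 1\<bar> \<le> (\<bar>r\<bar> * (8 * exp (s / 12))) * (2 * exp (s / 12))" .
  qed (use v in auto)
  also have "\<dots> = 8 / (pi * v) * \<bar>r\<bar> * exp (- s / 2 + (s / 12 + s / 12))"
    unfolding exp_add by simp
  also have "- s / 2 + (s / 12 + s / 12) = - x\<^sup>2 / (3 * v) + - y\<^sup>2 / (3 * v)"
    using v by (simp add: s_def field_simps)
  finally show ?thesis by (simp only: exp_add)
qed

lemma nn_integral_normal_density:
  assumes "0 < s" shows "(\<integral>\<^sup>+y. ennreal (normal_density m s y) \<partial>lborel) = 1"
proof -
  interpret prob_space "density lborel (normal_density m s)" by (rule prob_space_normal_density[OF assms])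
  show ?thesis using emeasure_space_1 by (simp add: emeasure_density)
qed

lemma char_normal_density:
  assumes w: "0 < w"
  shows "(CLINT y|lborel. normal_density m (sqrt w) y *\<^sub>R iexp (b * y)) = iexp (m * b) * of_real (exp (- (w * b\<^sup>2) / 2))"
proof -
  have "char (gaussian_law m w) b = (CLINT y|density lborel (\<lambda>x. ennreal (normal_density m (sqrt w) x)). iexp (b * y))"
    using w by (simp add: char_def gaussian_law_def)
  also have "\<dots> = (CLINT y|lborel. normal_density m (sqrt w) y *\<^sub>R iexp (b * y))"
    by (subst integral_density) auto
  finally show ?thesis using char_gaussian_law[of w m b] w by simp
qed

abbreviation plane :: "(real \<times> real) measure" where
  "plane \<equiv> lborel \<Otimes>\<^sub>M lborel"

abbreviation on_square :: "real set \<Rightarrow> real \<times> real \<Rightarrow> 'b::semiring_1" where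
  "on_square A p \<equiv> indicator A (fst p) * indicator A (snd p)"

abbreviation gauss_product :: "real \<Rightarrow> real \<times> real \<Rightarrow> real" where
  "gauss_product w p \<equiv> exp (- (fst p)\<^sup>2 / w) * exp (- (snd p)\<^sup>2 / w)"

abbreviation binormal_at :: "real \<Rightarrow> real \<Rightarrow> real \<times> real \<Rightarrow> real" where
  "binormal_at v r p \<equiv> binormal_density v r (fst p) (snd p)"

definition binormal :: "real \<Rightarrow> real \<Rightarrow> (real \<times> real) measure" where
  "binormal v r = density plane (\<lambda>p. ennreal (binormal_at v r p))"

lemma binormal_density_measurable' [measurable]:
  "(\<lambda>p. binormal_at v r p) \<in> borel_measurable plane"
proof -
  have "sets plane = sets (borel \<Otimes>\<^sub>M borel :: (real \<times> real) measure)"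
    by (intro sets_pair_measure_cong) auto
  then show ?thesis using binormal_density_measurable measurable_cong_sets by blast
qed

lemma nn_integral_binormal_density:
  assumes v: "0 < v" and r: "\<bar>r\<bar> < 1"
  shows "(\<integral>\<^sup>+p. ennreal (binormal_at v r p) \<partial>plane) = 1"
proof -
  have q: "0 < 1 - r\<^sup>2" using r by (simp add: abs_square_less_1)
  have "(\<integral>\<^sup>+p. ennreal (binormal_at v r p) \<partial>plane)
    = (\<integral>\<^sup>+x. \<integral>\<^sup>+y. ennreal (binormal_density v r x y) \<partial>lborel \<partial>lborel)"
    by (subst lborel.nn_integral_fst[symmetric]) auto
  also have "\<dots> = (\<integral>\<^sup>+x. ennreal (normal_density 0 (sqrt v) x) \<partial>lborel)"
    using v q by (simp add: binormal_density_def ennreal_mult' nn_integral_cmult nn_integral_normal_density)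
  also have "\<dots> = 1" using v by (simp add: nn_integral_normal_density)
  finally show ?thesis .
qed

lemma integrable_binormal_density:
  assumes v: "0 < v" and r: "\<bar>r\<bar> < 1"
  shows "integrable plane (\<lambda>p. binormal_at v r p)"
  by (rule integrableI_bounded) (auto simp: nn_integral_binormal_density[OF assms] binormal_density_nonneg)

lemma prob_space_binormal:
  assumes v: "0 < v" and r: "\<bar>r\<bar> < 1"
  shows "prob_space (binormal v r)"
proof (rule prob_spaceI)
  have "emeasure (binormal v r) (space (binormal v r))
      = (\<integral>\<^sup>+p. ennreal (binormal_at v r p) * indicator (space plane) p \<partial>plane)"
    unfolding binormal_def space_density by (rule emeasure_density[OF _ sets.top]) measurable
  also have "\<dots> = (\<integral>\<^sup>+p. ennreal (binormal_at v r p) \<partial>plane)"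
    by (rule nn_integral_cong) auto
  finally show "emeasure (binormal v r) (space (binormal v r)) = 1"
    by (simp only: nn_integral_binormal_density[OF assms])
qed

lemma char_binormal:
  assumes v: "0 < v" and r: "\<bar>r\<bar> < 1"
  shows "(CLINT p|binormal v r. iexp (a * fst p + b * snd p)) = of_real (exp (- (a\<^sup>2 * v + 2 * a * b * (r * v) + b\<^sup>2 * v) / 2))"
proof -
  have q: "0 < 1 - r\<^sup>2" using r by (simp add: abs_square_less_1)
  have int: "integrable plane (\<lambda>p. binormal_at v r p *\<^sub>R iexp (a * fst p + b * snd p))"
    by (rule Bochner_Integration.integrable_bound[OF integrable_binormal_density[OF v r]]) auto
  have inner: "(CLINT y|lborel. binormal_density v r x y *\<^sub>R iexp (a * x + b * y))
     = of_real (exp (- (v * (1 - r\<^sup>2) * b\<^sup>2) / 2)) * (normal_density 0 (sqrt v) x *\<^sub>R iexp ((a + r * b) * x))" for x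
  proof -
    have "(CLINT y|lborel. binormal_density v r x y *\<^sub>R iexp (a * x + b * y))
      = (CLINT y|lborel. (normal_density 0 (sqrt v) x *\<^sub>R iexp (a * x)) * (normal_density (r * x) (sqrt (v * (1 - r\<^sup>2))) y *\<^sub>R iexp (b * y)))"
    proof (rule Bochner_Integration.integral_cong[OF refl])
      fix y
      have "iexp (a * x + b * y) = iexp (a * x) * iexp (b * y)" by (simp add: exp_add distrib_left)
      then show "binormal_density v r x y *\<^sub>R iexp (a * x + b * y) =
        (normal_density 0 (sqrt v) x *\<^sub>R iexp (a * x)) * (normal_density (r * x) (sqrt (v * (1 - r\<^sup>2))) y *\<^sub>R iexp (b * y))"
        by (simp only: binormal_density_def scaleR_conv_of_real of_real_mult mult.assoc mult.left_commute)
    qed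
    also have "\<dots> = (normal_density 0 (sqrt v) x *\<^sub>R iexp (a * x)) * (iexp (r * x * b) * of_real (exp (- (v * (1 - r\<^sup>2) * b\<^sup>2) / 2)))"
      using v q char_normal_density[of "v * (1 - r\<^sup>2)" "r * x" b] by (simp only: integral_mult_right_zero mult_pos_pos)
    also have "\<dots> = of_real (exp (- (v * (1 - r\<^sup>2) * b\<^sup>2) / 2)) * (normal_density 0 (sqrt v) x *\<^sub>R iexp ((a + r * b) * x))"
    proof -
      have "(a + r * b) * x = a * x + r * x * b" by (simp add: algebra_simps)
      then have "iexp ((a + r * b) * x) = iexp (a * x) * iexp (r * x * b)" by (simp only: of_real_add distrib_left exp_add)
      then show ?thesis by (simp only: scaleR_conv_of_real mult.assoc mult.left_commute mult.commute)
    qed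
    finally show ?thesis .
  qed
  have "(CLINT p|binormal v r. iexp (a * fst p + b * snd p)) = (CLINT p|plane. binormal_at v r p *\<^sub>R iexp (a * fst p + b * snd p))"
    unfolding binormal_def by (subst integral_density) (auto simp: binormal_density_nonneg)
  also have "\<dots> = (CLINT x|lborel. CLINT y|lborel. binormal_density v r x y *\<^sub>R iexp (a * x + b * y))"
    using lborel_pair.integral_fst'[OF int] by simp
  also have "\<dots> = of_real (exp (- (v * (1 - r\<^sup>2) * b\<^sup>2) / 2)) * (iexp (0 * (a + r * b)) * of_real (exp (- (v * (a + r * b)\<^sup>2) / 2)))"
    unfolding inner using char_normal_density[OF v, of 0 "a + r * b"] by (simp only: integral_mult_right_zero)
  also have "\<dots> = of_real (exp (- (v * (1 - r\<^sup>2) * b\<^sup>2) / 2 + - (v * (a + r * b)\<^sup>2) / 2))"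
    by (simp only: exp_add of_real_mult) simp
  also have "- (v * (1 - r\<^sup>2) * b\<^sup>2) / 2 + - (v * (a + r * b)\<^sup>2) / 2 = - (a\<^sup>2 * v + 2 * a * b * (r * v) + b\<^sup>2 * v) / 2"
    by (simp add: power2_eq_square field_simps)
  finally show ?thesis .
qed

text \<open>Gaussian masses without normalisation, so that several widths can be compared on the same set.\<close>

definition gauss_mass :: "real \<Rightarrow> real set \<Rightarrow> ennreal" where
  "gauss_mass w A = (\<integral>\<^sup>+x. ennreal (exp (- x\<^sup>2 / w)) * indicator A x \<partial>lborel)"

lemma gauss_mass_UNIV:
  assumes "0 < w" shows "gauss_mass w UNIV = ennreal (sqrt (pi * w))"
proof -
  have "normal_density 0 (sqrt (w / 2)) x = 1 / sqrt (pi * w) * exp (- x\<^sup>2 / w)" for x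
    using assms by (simp add: normal_density_def)
  then have "exp (- x\<^sup>2 / w) = sqrt (pi * w) * normal_density 0 (sqrt (w / 2)) x" for x
    using assms by simp
  then have "gauss_mass w UNIV = (\<integral>\<^sup>+x. ennreal (sqrt (pi * w)) * ennreal (normal_density 0 (sqrt (w / 2)) x) \<partial>lborel)"
    using assms by (simp add: gauss_mass_def ennreal_mult')
  also have "\<dots> = ennreal (sqrt (pi * w))"
    using assms by (subst nn_integral_cmult) (auto simp: nn_integral_normal_density)
  finally show ?thesis .
qed

lemma gauss_mass_mono:
  assumes "0 < w" "w \<le> w'" "A \<subseteq> A'" shows "gauss_mass w A \<le> gauss_mass w' A'"
  unfolding gauss_mass_def
proof (intro nn_integral_mono mult_mono)
  fix x :: real
  have "x\<^sup>2 / w' \<le> x\<^sup>2 / w" using assms by (intro divide_left_mono) auto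
  then show "ennreal (exp (- x\<^sup>2 / w)) \<le> ennreal (exp (- x\<^sup>2 / w'))" by (intro ennreal_leI) simp
  show "indicator A x \<le> (indicator A' x :: ennreal)" using assms by (auto split: split_indicator)
qed auto

lemma gauss_mass_finite: assumes "0 < w" shows "gauss_mass w A < \<infinity>"
  using gauss_mass_mono[OF assms order_refl subset_UNIV[of A]] gauss_mass_UNIV[OF assms]
  by (simp add: order_le_less_trans)

lemma gauss_mass_prod:
  assumes [measurable]: "A \<in> sets borel"
  shows "(\<integral>\<^sup>+p. ennreal (gauss_product w p) * on_square A p \<partial>plane)
     = (gauss_mass w A)\<^sup>2"
proof -
  have "(\<integral>\<^sup>+p. ennreal (gauss_product w p) * on_square A p \<partial>plane)
    = (\<integral>\<^sup>+x. \<integral>\<^sup>+y. (ennreal (exp (- x\<^sup>2 / w)) * indicator A x) * (ennreal (exp (- y\<^sup>2 / w)) * indicator A y) \<partial>lborel \<partial>lborel)"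
    by (subst lborel.nn_integral_fst[symmetric]) (auto simp: ennreal_mult' ac_simps)
  also have "\<dots> = (\<integral>\<^sup>+x. (ennreal (exp (- x\<^sup>2 / w)) * indicator A x) * gauss_mass w A \<partial>lborel)"
    unfolding gauss_mass_def by (intro nn_integral_cong nn_integral_cmult) measurable
  also have "\<dots> = (gauss_mass w A)\<^sup>2"
    unfolding power2_eq_square[of "gauss_mass w A"] by (subst nn_integral_multc) (auto simp: gauss_mass_def)
  finally show ?thesis .
qed

text \<open>Splits \<open>exp (- x\<^sup>2/(3v))\<close> as \<open>exp (- x\<^sup>2/(4v)) exp (- x\<^sup>2/(12v))\<close>; up to a constant, the right-hand side is the normal law of \<open>A\<close>.\<close>

lemma gauss_mass_Cauchy_Schwarz:
  assumes v: "0 < v" and [measurable]: "A \<in> sets borel"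
  shows "(gauss_mass (3 * v) A)\<^sup>2 \<le> ennreal (sqrt (pi * (6 * v))) * gauss_mass (2 * v) A"
proof -
  have "(gauss_mass (3 * v) A)\<^sup>2 = (\<integral>\<^sup>+x. (ennreal (exp (- x\<^sup>2 / (4 * v))) * indicator A x) * ennreal (exp (- x\<^sup>2 / (12 * v))) \<partial>lborel)\<^sup>2"
  proof -
    have "- x\<^sup>2 / (3 * v) = - x\<^sup>2 / (4 * v) + - x\<^sup>2 / (12 * v)" for x using v by (simp add: field_simps)
    then show ?thesis unfolding gauss_mass_def by (simp only: exp_add ennreal_mult' exp_ge_zero mult.assoc mult.commute mult.left_commute)
  qed
  also have "\<dots> \<le> (\<integral>\<^sup>+x. (ennreal (exp (- x\<^sup>2 / (4 * v))) * indicator A x)\<^sup>2 \<partial>lborel) * (\<integral>\<^sup>+x. (ennreal (exp (- x\<^sup>2 / (12 * v))))\<^sup>2 \<partial>lborel)"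
    by (rule Cauchy_Schwarz_nn_integral) auto
  also have "(\<integral>\<^sup>+x. (ennreal (exp (- x\<^sup>2 / (4 * v))) * indicator A x)\<^sup>2 \<partial>lborel) = gauss_mass (2 * v) A"
    unfolding gauss_mass_def
  proof (rule nn_integral_cong)
    fix x :: real
    have "(exp (- x\<^sup>2 / (4 * v)))\<^sup>2 = exp (- x\<^sup>2 / (2 * v))"
      by (simp add: power2_eq_square exp_add[symmetric])
    then show "(ennreal (exp (- x\<^sup>2 / (4 * v))) * indicator A x)\<^sup>2 = ennreal (exp (- x\<^sup>2 / (2 * v))) * indicator A x"
      by (simp add: power_mult_distrib ennreal_power split: split_indicator)
  qed
  also have "(\<integral>\<^sup>+x. (ennreal (exp (- x\<^sup>2 / (12 * v))))\<^sup>2 \<partial>lborel) = gauss_mass (6 * v) UNIV"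
    unfolding gauss_mass_def
  proof (rule nn_integral_cong)
    fix x :: real
    have "(exp (- x\<^sup>2 / (12 * v)))\<^sup>2 = exp (- x\<^sup>2 / (6 * v))"
      by (simp add: power2_eq_square exp_add[symmetric])
    then show "(ennreal (exp (- x\<^sup>2 / (12 * v))))\<^sup>2 = ennreal (exp (- x\<^sup>2 / (6 * v))) * indicator UNIV x"
      by (simp add: ennreal_power)
  qed
  also have "\<dots> = ennreal (sqrt (pi * (6 * v)))" using v by (intro gauss_mass_UNIV) auto
  finally show ?thesis by (simp add: mult.commute)
qed

section \<open>Covariances of indicators along the process\<close>

context stationary_fOU
begin

definition nu :: "real set \<Rightarrow> real" where "nu A = measure (distr M borel (X 0)) A"

lemma X_law: "0 \<le> s \<Longrightarrow> distr M borel (X s) = gaussian_law 0 var"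
  using X_pair_law(2)[of s s 1 0] by simp

lemma nu_nonneg: "0 \<le> nu A" by (simp add: nu_def)

lemma nu_le_1: "nu A \<le> 1"
proof -
  interpret D: prob_space "distr M borel (X 0)" by (rule prob_space_distr) simp
  show ?thesis unfolding nu_def by (rule D.prob_le_1)
qed

lemma expectation_indicator_X:
  assumes s: "0 \<le> s" and [measurable]: "A \<in> sets borel"
  shows "expectation (\<lambda>\<omega>. indicator A (X s \<omega>)) = nu A"
proof -
  have "expectation (\<lambda>\<omega>. indicator A (X s \<omega>) :: real) = (LINT x|distr M borel (X s). indicator A x)"
    by (subst integral_distr) auto
  also have "\<dots> = measure (distr M borel (X s)) A" by simp
  finally show ?thesis unfolding nu_def X_law[OF s] X_law[OF order_refl] .
qed

lemma nu_eq_gauss_mass: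
  assumes [measurable]: "A \<in> sets borel"
  shows "ennreal (nu A) = ennreal (1 / sqrt (2 * pi * var)) * gauss_mass (2 * var) A"
proof -
  interpret D: prob_space "distr M borel (X 0)" by (rule prob_space_distr) simp
  have "ennreal (nu A) = emeasure (distr M borel (X 0)) A" by (simp add: nu_def D.emeasure_eq_measure)
  also have "\<dots> = emeasure (gaussian_law 0 var) A" by (simp only: X_law[OF order_refl])
  also have "\<dots> = (\<integral>\<^sup>+x. ennreal (normal_density 0 (sqrt var) x) * indicator A x \<partial>lborel)"
    using var_pos by (simp add: gaussian_law_def emeasure_density)
  also have "\<dots> = (\<integral>\<^sup>+x. ennreal (1 / sqrt (2 * pi * var)) * (ennreal (exp (- x\<^sup>2 / (2 * var))) * indicator A x) \<partial>lborel)"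
    using var_pos by (intro nn_integral_cong) (simp add: normal_density_def ennreal_mult'[symmetric] mult.assoc[symmetric])
  also have "\<dots> = ennreal (1 / sqrt (2 * pi * var)) * gauss_mass (2 * var) A"
    unfolding gauss_mass_def by (rule nn_integral_cmult) measurable
  finally show ?thesis .
qed

text \<open>The pair is Gaussian with correlation of modulus less than \<open>1\<close>, so its characteristic function is that of
  the bivariate normal law.\<close>

lemma X_pair_prob:
  assumes s: "0 \<le> s" and u: "0 \<le> u" and su: "s \<noteq> u" and A[measurable]: "A \<in> sets borel"
  shows "expectation (\<lambda>\<omega>. indicator A (X s \<omega>) * indicator A (X u \<omega>) :: real)
    = (LINT p|plane. binormal_at var (autocov (s - u) / var) p * on_square A p)"
proof -
  define r where "r = autocov (s - u) / var"
  have "autocov (s - u) = autocov \<bar>s - u\<bar>" by (simp add: autocov_def)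
  then have r: "\<bar>r\<bar> < 1" using autocov_abs_less[of "\<bar>s - u\<bar>"] su var_pos by (simp add: r_def abs_divide)
  have rv: "r * var = autocov (s - u)" using var_pos by (simp add: r_def)
  have "expectation (\<lambda>\<omega>. indicator A (X s \<omega>) * indicator A (X u \<omega>) :: real)
     = (LINT p|binormal var r. on_square A p)"
  proof (rule char_uniqueness_rectangles[OF prob_space_axioms prob_space_binormal[OF var_pos r]])
    show "(CLINT \<omega>|M. iexp (a * X s \<omega> + b * X u \<omega>)) = (CLINT p|binormal var r. iexp (a * fst p + b * snd p))" for a b
      unfolding X_pair_char[OF s u] char_binormal[OF var_pos r] rv by simp
  qed (auto simp: binormal_def)
  also have "\<dots> = (LINT p|plane. binormal_at var r p *\<^sub>R on_square A p)"
    unfolding binormal_def by (subst integral_density) (auto simp: binormal_density_nonneg)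
  finally show ?thesis by (simp add: r_def)
qed

lemma nu_sq_eq:
  assumes [measurable]: "A \<in> sets borel"
  shows "(nu A)\<^sup>2 = (LINT p|plane. binormal_at var 0 p * on_square A p)"
proof -
  have nuA: "nu A = (LINT x|lborel. normal_density 0 (sqrt var) x * indicator A x)"
  proof -
    have "nu A = (LINT x|distr M borel (X 0). indicator A x)" by (simp add: nu_def)
    also have "\<dots> = (LINT x|gaussian_law 0 var. indicator A x)" by (simp only: X_law[OF order_refl])
    also have "\<dots> = (LINT x|lborel. normal_density 0 (sqrt var) x *\<^sub>R indicator A x)"
    proof -
      have "gaussian_law 0 var = density lborel (\<lambda>x. ennreal (normal_density 0 (sqrt var) x))"
        using var_pos by (simp add: gaussian_law_def)
      then show ?thesis by (simp only:) (subst integral_density; simp)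
    qed
    finally show ?thesis by simp
  qed
  have int: "integrable plane (\<lambda>p. binormal_at var 0 p * on_square A p)"
    by (rule Bochner_Integration.integrable_bound[OF integrable_binormal_density[OF var_pos, of 0]])
       (auto simp: binormal_density_nonneg split: split_indicator)
  have "(LINT p|plane. binormal_at var 0 p * on_square A p)
    = (LINT x|lborel. LINT y|lborel. (normal_density 0 (sqrt var) x * indicator A x) * (normal_density 0 (sqrt var) y * indicator A y))"
    using lborel_pair.integral_fst'[OF int] by (simp add: binormal_density_def ac_simps)
  also have "\<dots> = (nu A)\<^sup>2" unfolding power2_eq_square nuA by simp
  finally show ?thesis by simp
qed

definition cov :: "real set \<Rightarrow> real \<Rightarrow> real \<Rightarrow> real" where
  "cov A s u = expectation (\<lambda>\<omega>. (indicator A (X s \<omega>) - nu A) * (indicator A (X u \<omega>) - nu A))"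

lemma cov_eq:
  assumes s: "0 \<le> s" and u: "0 \<le> u" and A[measurable]: "A \<in> sets borel"
  shows "cov A s u = expectation (\<lambda>\<omega>. indicator A (X s \<omega>) * indicator A (X u \<omega>)) - (nu A)\<^sup>2"
proof -
  have i: "integrable M (\<lambda>\<omega>. indicator A (X s \<omega>) * indicator A (X u \<omega>) :: real)" "integrable M (\<lambda>\<omega>. indicator A (X t \<omega>) :: real)" for t
    by (rule integrable_const_bound[where B=1]; simp add: indicator_def)+
  have "cov A s u = expectation (\<lambda>\<omega>. indicator A (X s \<omega>) * indicator A (X u \<omega>) - nu A * indicator A (X s \<omega>) - nu A * indicator A (X u \<omega>) + (nu A)\<^sup>2)"
    unfolding cov_def by (intro Bochner_Integration.integral_cong refl) (simp add: power2_eq_square algebra_simps)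
  also have "\<dots> = expectation (\<lambda>\<omega>. indicator A (X s \<omega>) * indicator A (X u \<omega>)) - nu A * nu A - nu A * nu A + (nu A)\<^sup>2"
    using i by (simp add: expectation_indicator_X[OF s A] expectation_indicator_X[OF u A] prob_space)
  finally show ?thesis by (simp add: power2_eq_square)
qed

lemma cov_le_nu:
  assumes s: "0 \<le> s" and u: "0 \<le> u" and A[measurable]: "A \<in> sets borel"
  shows "\<bar>cov A s u\<bar> \<le> nu A"
proof -
  have "expectation (\<lambda>\<omega>. indicator A (X s \<omega>) * indicator A (X u \<omega>) :: real) \<le> expectation (\<lambda>\<omega>. indicator A (X s \<omega>))"
    by (intro integral_mono integrable_const_bound[where B=1]) (auto simp: indicator_def)
  moreover have "0 \<le> expectation (\<lambda>\<omega>. indicator A (X s \<omega>) * indicator A (X u \<omega>) :: real)" by simp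
  moreover have "(nu A)\<^sup>2 \<le> nu A" using nu_nonneg[of A] nu_le_1[of A] by (simp add: power2_eq_square mult_left_le)
  moreover have "0 \<le> (nu A)\<^sup>2" by simp
  ultimately show ?thesis unfolding cov_eq[OF assms] expectation_indicator_X[OF s A] by linarith
qed

text \<open>The case of distant times: the pair density is close to the product density.\<close>

lemma cov_le_of_small_correlation:
  assumes s: "0 \<le> s" and u: "0 \<le> u" and su: "s \<noteq> u" and A[measurable]: "A \<in> sets borel"
    and r: "\<bar>autocov (s - u) / var\<bar> \<le> 1 / 8"
  shows "ennreal \<bar>cov A s u\<bar> \<le> ennreal (8 / (pi * var) * \<bar>autocov (s - u) / var\<bar>) * (gauss_mass (3 * var) A)\<^sup>2"
proof -
  define r where "r = autocov (s - u) / var"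
  have r1: "\<bar>r\<bar> < 1" using r unfolding r_def[symmetric] by linarith
  have i: "integrable plane (\<lambda>p. binormal_at var r' p * on_square A p)"
    if "\<bar>r'\<bar> < 1" for r'
    by (rule Bochner_Integration.integrable_bound[OF integrable_binormal_density[OF var_pos that]])
       (auto simp: binormal_density_nonneg split: split_indicator)
  have "cov A s u = (LINT p|plane. (binormal_at var r p - binormal_at var 0 p) * on_square A p)"
    unfolding cov_eq[OF s u A] X_pair_prob[OF s u su A] nu_sq_eq[OF A] r_def[symmetric]
    unfolding left_diff_distrib
    by (rule Bochner_Integration.integral_diff[symmetric]) (rule i, use r1 in simp)+
  then have "ennreal \<bar>cov A s u\<bar> \<le> (\<integral>\<^sup>+p. ennreal \<bar>(binormal_at var r p - binormal_at var 0 p) * on_square A p\<bar> \<partial>plane)"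
    by (simp only: abs_integral_le_nn_integral)
  also have "\<dots> \<le> (\<integral>\<^sup>+p. ennreal (8 / (pi * var) * \<bar>r\<bar>) * (ennreal (gauss_product (3 * var) p) * on_square A p) \<partial>plane)"
  proof (rule nn_integral_mono)
    fix p :: "real \<times> real"
    show "ennreal \<bar>(binormal_at var r p - binormal_at var 0 p) * on_square A p\<bar>
      \<le> ennreal (8 / (pi * var) * \<bar>r\<bar>) * (ennreal (gauss_product (3 * var) p) * on_square A p)"
    proof (cases "fst p \<in> A \<and> snd p \<in> A")
      case True
      have "ennreal \<bar>binormal_at var r p - binormal_at var 0 p\<bar>
        \<le> ennreal ((8 / (pi * var) * \<bar>r\<bar>) * (gauss_product (3 * var) p))"
        using r by (intro ennreal_leI binormal_density_diff_le var_pos) (simp add: r_def)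
      also have "\<dots> = ennreal (8 / (pi * var) * \<bar>r\<bar>) * ennreal (gauss_product (3 * var) p)"
        by (rule ennreal_mult') (use var_pos in simp)
      finally show ?thesis using True by simp
    next
      case False
      then show ?thesis by (auto simp: indicator_def)
    qed
  qed
  also have "\<dots> = ennreal (8 / (pi * var) * \<bar>r\<bar>) * (gauss_mass (3 * var) A)\<^sup>2"
    by (subst nn_integral_cmult) (simp_all only: gauss_mass_prod[OF A], measurable)
  finally show ?thesis by (simp only: r_def)
qed

text \<open>The case of close times. The joint and the product term are bounded separately, as nothing is gained from
  their difference there.\<close>

lemma cov_le_general:
  assumes s: "0 \<le> s" and u: "0 \<le> u" and su: "s \<noteq> u" and A[measurable]: "A \<in> sets borel"
  shows "ennreal \<bar>cov A s u\<bar> \<le> ennreal (1 / (pi * var) / sqrt (1 - (autocov (s - u) / var)\<^sup>2)) * (gauss_mass (4 * var) A)\<^sup>2"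
proof -
  define r where "r = autocov (s - u) / var"
  have "autocov (s - u) = autocov \<bar>s - u\<bar>" by (simp add: autocov_def)
  then have r1: "\<bar>r\<bar> < 1" using autocov_abs_less[of "\<bar>s - u\<bar>"] su var_pos by (simp add: r_def abs_divide)
  then have q: "0 < 1 - r\<^sup>2" by (simp add: abs_square_less_1)
  then have q1: "sqrt (1 - r\<^sup>2) \<le> 1" by simp
  have gen: "ennreal \<bar>LINT p|plane. binormal_at var r' p * on_square A p\<bar>
     \<le> ennreal (1 / (2 * pi * var) / sqrt (1 - r'\<^sup>2)) * (gauss_mass (4 * var) A)\<^sup>2" if r': "\<bar>r'\<bar> < 1" for r'
  proof -
    have "ennreal \<bar>LINT p|plane. binormal_at var r' p * on_square A p\<bar>
      \<le> (\<integral>\<^sup>+p. ennreal \<bar>binormal_at var r' p * on_square A p\<bar> \<partial>plane)"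
      by (rule abs_integral_le_nn_integral)
    also have "\<dots> \<le> (\<integral>\<^sup>+p. ennreal (1 / (2 * pi * var) / sqrt (1 - r'\<^sup>2)) * (ennreal (gauss_product (4 * var) p) * on_square A p) \<partial>plane)"
    proof (rule nn_integral_mono)
      fix p :: "real \<times> real"
      show "ennreal \<bar>binormal_at var r' p * on_square A p\<bar>
        \<le> ennreal (1 / (2 * pi * var) / sqrt (1 - r'\<^sup>2)) * (ennreal (gauss_product (4 * var) p) * on_square A p)"
      proof (cases "fst p \<in> A \<and> snd p \<in> A")
        case True
        have "ennreal (binormal_at var r' p)
          \<le> ennreal ((1 / (2 * pi * var) / sqrt (1 - r'\<^sup>2)) * (gauss_product (4 * var) p))"
          by (intro ennreal_leI binormal_density_le var_pos r')
        also have "\<dots> = ennreal (1 / (2 * pi * var) / sqrt (1 - r'\<^sup>2)) * ennreal (gauss_product (4 * var) p)"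
          by (rule ennreal_mult'') simp
        finally show ?thesis using True by (simp add: binormal_density_nonneg)
      next
        case False
        then show ?thesis by (auto simp: indicator_def)
      qed
    qed
    also have "\<dots> = ennreal (1 / (2 * pi * var) / sqrt (1 - r'\<^sup>2)) * (gauss_mass (4 * var) A)\<^sup>2"
      by (subst nn_integral_cmult) (simp_all only: gauss_mass_prod[OF A], measurable)
    finally show ?thesis .
  qed
  have "ennreal \<bar>cov A s u\<bar> \<le> ennreal (\<bar>LINT p|plane. binormal_at var r p * on_square A p\<bar>
     + \<bar>LINT p|plane. binormal_at var 0 p * on_square A p\<bar>)"
    unfolding cov_eq[OF s u A] X_pair_prob[OF s u su A] nu_sq_eq[OF A] r_def[symmetric]
    by (intro ennreal_leI abs_triangle_ineq4)
  also have "\<dots> \<le> ennreal (1 / (2 * pi * var) / sqrt (1 - r\<^sup>2)) * (gauss_mass (4 * var) A)\<^sup>2 + ennreal (1 / (2 * pi * var) / sqrt (1 - 0\<^sup>2)) * (gauss_mass (4 * var) A)\<^sup>2"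
    by (simp only: ennreal_plus abs_ge_zero) (intro add_mono gen r1; simp)
  also have "\<dots> = ennreal (1 / (2 * pi * var) / sqrt (1 - r\<^sup>2) + 1 / (2 * pi * var) / sqrt (1 - 0\<^sup>2)) * (gauss_mass (4 * var) A)\<^sup>2"
    using var_pos q by (subst ennreal_plus) (auto simp: distrib_right)
  also have "\<dots> \<le> ennreal (1 / (pi * var) / sqrt (1 - r\<^sup>2)) * (gauss_mass (4 * var) A)\<^sup>2"
  proof (intro mult_right_mono ennreal_leI)
    have "1 / (2 * pi * var) / 1 \<le> 1 / (2 * pi * var) / sqrt (1 - r\<^sup>2)"
      using q q1 var_pos by (intro divide_left_mono) auto
    then have "1 / (2 * pi * var) / sqrt (1 - r\<^sup>2) + 1 / (2 * pi * var) / sqrt (1 - 0\<^sup>2) \<le> 2 * (1 / (2 * pi * var) / sqrt (1 - r\<^sup>2))"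
      by simp
    also have "\<dots> = 1 / (pi * var) / sqrt (1 - r\<^sup>2)" by simp
    finally show "1 / (2 * pi * var) / sqrt (1 - r\<^sup>2) + 1 / (2 * pi * var) / sqrt (1 - 0\<^sup>2) \<le> 1 / (pi * var) / sqrt (1 - r\<^sup>2)" .
  qed simp
  finally show ?thesis by (simp only: r_def)
qed

end

section \<open>Fluctuations of occupation times\<close>

lemma ennreal_square_le_imp_le:
  assumes "x\<^sup>2 \<le> (ennreal c)\<^sup>2" "0 \<le> c" shows "x \<le> ennreal c"
proof (cases x)
  case (real r)
  with assms have "r\<^sup>2 \<le> c\<^sup>2" by (simp add: ennreal_power)
  then have "r \<le> c" using assms(2) by (rule power2_le_imp_le)
  with real show ?thesis by (simp add: ennreal_leI)
next
  case top
  then have "x\<^sup>2 = \<top>" by (simp add: power2_eq_square ennreal_top_mult)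
  moreover have "(ennreal c)\<^sup>2 = ennreal (c\<^sup>2)" using assms(2) by (rule ennreal_power)
  ultimately show ?thesis using assms(1) by (simp add: top_unique)
qed

context stationary_fOU
begin

definition rate_exponent :: real where "rate_exponent = (if H \<le> 1 / 2 then 1 / 2 else 1 - H)"

lemma rate_exponent_pos: "0 < rate_exponent" and rate_exponent_le: "rate_exponent \<le> 1 / 2"
  using H by (auto simp: rate_exponent_def)

text \<open>One majorant \<open>G\<close> of the lag serves both estimates: \<open>u powr (- H)\<close> up to some time \<open>T\<close>, where the densities of
  pairs are controlled by the correlation gap, and the decay of the autocovariance afterwards. Its integral over
  \<open>[0,t]\<close> is bounded if \<open>H \<le> 1/2\<close> and of order \<open>t powr (2H - 1)\<close> otherwise; the lower bound \<open>t0\<close> on \<open>t\<close> allows the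
  contribution of \<open>[0,T]\<close> to be absorbed into that order.\<close>

lemma covariance_majorant:
  obtains G where "G \<in> borel_measurable borel"
    and "\<And>A s u. A \<in> sets borel \<Longrightarrow> 0 \<le> s \<Longrightarrow> 0 \<le> u \<Longrightarrow> s \<noteq> u \<Longrightarrow>
      ennreal \<bar>cov A s u\<bar> \<le> G \<bar>s - u\<bar> * ennreal (nu A)"
    and "\<And>A s u. A \<in> sets borel \<Longrightarrow> 0 \<le> s \<Longrightarrow> 0 \<le> u \<Longrightarrow> s \<noteq> u \<Longrightarrow>
      ennreal \<bar>cov A s u\<bar> \<le> G \<bar>s - u\<bar> * (gauss_mass (4 * var) A)\<^sup>2"
    and "\<And>t0. 0 < t0 \<Longrightarrow> \<exists>L>0. \<forall>t\<ge>t0. (\<integral>\<^sup>+x. G x * indicator {0..t} x \<partial>lborel) \<le> ennreal (L * t powr (1 - 2 * rate_exponent))"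
proof -
  obtain C T1 where C: "0 < C" "0 < T1" "\<And>t. t \<ge> T1 \<Longrightarrow> \<bar>autocov t\<bar> \<le> C * t powr (- decay_exponent)"
    using autocov_decay by blast
  have "eventually (\<lambda>t. \<bar>autocov t\<bar> < var / 8) at_top"
    using order_tendstoD(2)[OF tendsto_rabs[OF autocov_tendsto_0], of "var / 8"] var_pos by simp
  then obtain T2 where T2: "\<And>t. t \<ge> T2 \<Longrightarrow> \<bar>autocov t\<bar> < var / 8" by (auto simp: eventually_at_top_linorder)
  define T where "T = max T1 T2"
  have T: "0 < T" using C by (simp add: T_def)
  obtain c where c: "c > 0" "\<And>u. 0 < u \<Longrightarrow> u \<le> T \<Longrightarrow> c * u powr (2 * H) \<le> 1 - (autocov u / var)\<^sup>2"
    using correlation_gap[OF T] by blast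
  define K where "K = sqrt (pi * (6 * var)) * sqrt (2 * pi * var)"
  define E where "E = 8 * C / (pi * var * var)"
  define D where "D = T powr H + 1 / (pi * var) / sqrt c + E * (1 + K)"
  have pos: "0 < E" "0 < K" "0 < T powr H" "0 < 1 / (pi * var) / sqrt c"
    using C c var_pos T by (simp_all add: E_def K_def)
  have D: "0 < D" "T powr H \<le> D" "1 / (pi * var) / sqrt c \<le> D" "E \<le> D" "E * K \<le> D"
  proof -
    have EK: "0 < E * K" using pos by simp
    have D_eq: "D = T powr H + 1 / (pi * var) / sqrt c + (E + E * K)" by (simp add: D_def distrib_left)
    note p = less_imp_le[OF pos(1)] less_imp_le[OF EK] less_imp_le[OF pos(3)] less_imp_le[OF pos(4)]
    show "0 < D" unfolding D_eq by (intro add_pos_pos pos EK)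
    show "T powr H \<le> D" "1 / (pi * var) / sqrt c \<le> D" "E \<le> D" "E * K \<le> D"
      unfolding D_eq using p by (simp_all only: add_increasing add_increasing2 order_refl add_nonneg_nonneg)
  qed
  define g where "g x = D * (if x \<le> T then x powr (- H) else x powr (- decay_exponent))" for x
  define G where "G x = ennreal (g x)" for x
  have 1: "G \<in> borel_measurable borel" unfolding G_def g_def by measurable
  have autocov_abs: "autocov (s - u) = autocov \<bar>s - u\<bar>" for s u by (simp add: autocov_def)
  have mass3: "(gauss_mass (3 * var) A)\<^sup>2 \<le> ennreal K * ennreal (nu A)" if [measurable]: "A \<in> sets borel" for A
  proof -
    have "ennreal (sqrt (2 * pi * var)) * ennreal (nu A) = gauss_mass (2 * var) A"
      unfolding nu_eq_gauss_mass[OF that] mult.assoc[symmetric] ennreal_mult'[symmetric, OF real_sqrt_ge_zero]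
      using var_pos by (simp add: ennreal_mult'[symmetric])
    then have "ennreal K * ennreal (nu A) = ennreal (sqrt (pi * (6 * var))) * gauss_mass (2 * var) A"
      unfolding K_def using var_pos by (simp add: ennreal_mult' mult.assoc)
    then show ?thesis using gauss_mass_Cauchy_Schwarz[OF var_pos that] by simp
  qed
  have far: "ennreal \<bar>cov A s u\<bar> \<le> ennreal (E * \<bar>s - u\<bar> powr (- decay_exponent)) * (gauss_mass (3 * var) A)\<^sup>2"
    if A: "A \<in> sets borel" and s: "0 \<le> s" and u: "0 \<le> u" and su: "T < \<bar>s - u\<bar>" for A s u
  proof -
    have ne: "s \<noteq> u" using su T by auto
    have "\<bar>autocov \<bar>s - u\<bar>\<bar> < var / 8" using su by (intro T2) (simp add: T_def)
    then have "\<bar>autocov (s - u) / var\<bar> \<le> 1 / 8" using var_pos autocov_abs[of s u] by (simp add: abs_divide field_simps)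
    note cov_le_of_small_correlation[OF s u ne A this]
    also have "ennreal (8 / (pi * var) * \<bar>autocov (s - u) / var\<bar>) * (gauss_mass (3 * var) A)\<^sup>2
      \<le> ennreal (E * \<bar>s - u\<bar> powr (- decay_exponent)) * (gauss_mass (3 * var) A)\<^sup>2"
    proof (intro mult_right_mono ennreal_leI)
      have "\<bar>autocov (s - u)\<bar> \<le> C * \<bar>s - u\<bar> powr (- decay_exponent)" unfolding autocov_abs[of s u] using su by (intro C) (simp add: T_def)
      then have "8 / (pi * var) * (\<bar>autocov (s - u)\<bar> / var) \<le> 8 / (pi * var) * (C * \<bar>s - u\<bar> powr (- decay_exponent) / var)"
        using var_pos by (intro mult_left_mono divide_right_mono) auto
      then show "8 / (pi * var) * \<bar>autocov (s - u) / var\<bar> \<le> E * \<bar>s - u\<bar> powr (- decay_exponent)"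
        using var_pos by (simp add: E_def abs_divide)
    qed simp
    finally show ?thesis .
  qed
  have 2: "ennreal \<bar>cov A s u\<bar> \<le> G \<bar>s - u\<bar> * ennreal (nu A)"
    if A: "A \<in> sets borel" and s: "0 \<le> s" and u: "0 \<le> u" and su: "s \<noteq> u" for A s u
  proof (cases "\<bar>s - u\<bar> \<le> T")
    case True
    have "1 = T powr H * T powr (- H)" using T by (simp add: powr_add[symmetric])
    also have "\<dots> \<le> D * \<bar>s - u\<bar> powr (- H)"
      using True D su H by (intro mult_mono powr_mono2') auto
    finally have "1 \<le> g \<bar>s - u\<bar>" using True by (simp add: g_def)
    then have "1 * nu A \<le> g \<bar>s - u\<bar> * nu A" by (intro mult_right_mono nu_nonneg)
    then have "\<bar>cov A s u\<bar> \<le> g \<bar>s - u\<bar> * nu A" using cov_le_nu[OF s u A] by simp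
    then have "ennreal \<bar>cov A s u\<bar> \<le> ennreal (g \<bar>s - u\<bar> * nu A)" by (rule ennreal_leI)
    then show ?thesis by (simp add: G_def ennreal_mult'' nu_nonneg)
  next
    case False
    then have "ennreal \<bar>cov A s u\<bar> \<le> ennreal (E * \<bar>s - u\<bar> powr (- decay_exponent)) * (gauss_mass (3 * var) A)\<^sup>2"
      by (intro far A s u) auto
    also have "\<dots> \<le> ennreal (E * \<bar>s - u\<bar> powr (- decay_exponent)) * (ennreal K * ennreal (nu A))"
      by (intro mult_left_mono mass3 A) simp
    also have "\<dots> = ennreal (E * K * \<bar>s - u\<bar> powr (- decay_exponent)) * ennreal (nu A)"
    proof -
      have "E * K * \<bar>s - u\<bar> powr (- decay_exponent) = E * \<bar>s - u\<bar> powr (- decay_exponent) * K" by (simp only: mult.assoc mult.commute mult.left_commute)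
      then have "ennreal (E * K * \<bar>s - u\<bar> powr (- decay_exponent)) = ennreal (E * \<bar>s - u\<bar> powr (- decay_exponent)) * ennreal K"
        using pos by (simp only: ennreal_mult'' less_imp_le)
      then show ?thesis by (simp only: mult.assoc)
    qed
    also have "\<dots> \<le> G \<bar>s - u\<bar> * ennreal (nu A)"
      unfolding G_def using False D by (intro mult_right_mono ennreal_leI) (auto simp: g_def mult_right_mono)
    finally show ?thesis .
  qed
  have 3: "ennreal \<bar>cov A s u\<bar> \<le> G \<bar>s - u\<bar> * (gauss_mass (4 * var) A)\<^sup>2"
    if A: "A \<in> sets borel" and s: "0 \<le> s" and u: "0 \<le> u" and su: "s \<noteq> u" for A s u
  proof (cases "\<bar>s - u\<bar> \<le> T")
    case True
    let ?x = "\<bar>s - u\<bar>"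
    have x: "0 < ?x" using su by simp
    have "sqrt (c * ?x powr (2 * H)) \<le> sqrt (1 - (autocov ?x / var)\<^sup>2)" using c(2)[OF x True] by simp
    moreover have "sqrt (c * ?x powr (2 * H)) = sqrt c * ?x powr H"
    proof -
      have "?x powr (2 * H) = (?x powr H)\<^sup>2" using powr_add[of ?x H H] by (simp add: power2_eq_square)
      then show ?thesis by (simp add: real_sqrt_mult)
    qed
    ultimately have le: "sqrt c * ?x powr H \<le> sqrt (1 - (autocov ?x / var)\<^sup>2)" by simp
    have "1 / (pi * var) / sqrt (1 - (autocov (s - u) / var)\<^sup>2) \<le> 1 / (pi * var) / (sqrt c * ?x powr H)"
      unfolding autocov_abs[of s u] using le x c(1) var_pos by (intro divide_left_mono) (auto intro!: mult_pos_pos less_le_trans[OF _ le])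
    also have "\<dots> = 1 / (pi * var) / sqrt c * ?x powr (- H)" by (simp add: powr_minus divide_inverse)
    also have "\<dots> \<le> g ?x" using mult_right_mono[OF D(3), of "?x powr (- H)"] True by (simp add: g_def)
    finally have "ennreal (1 / (pi * var) / sqrt (1 - (autocov (s - u) / var)\<^sup>2)) \<le> G ?x" unfolding G_def by (rule ennreal_leI)
    then show ?thesis
      by (intro order_trans[OF cov_le_general[OF s u su A]] mult_right_mono) auto
  next
    case False
    then have "ennreal \<bar>cov A s u\<bar> \<le> ennreal (E * \<bar>s - u\<bar> powr (- decay_exponent)) * (gauss_mass (3 * var) A)\<^sup>2"
      by (intro far A s u) auto
    also have "\<dots> \<le> G \<bar>s - u\<bar> * (gauss_mass (4 * var) A)\<^sup>2"
    proof (intro mult_mono power_mono gauss_mass_mono)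
      show "ennreal (E * \<bar>s - u\<bar> powr (- decay_exponent)) \<le> G \<bar>s - u\<bar>"
        unfolding G_def using False D by (intro ennreal_leI) (auto simp: g_def mult_right_mono)
    qed (use var_pos in auto)
    finally show ?thesis .
  qed
  have 4: "\<exists>L>0. \<forall>t\<ge>t0. (\<integral>\<^sup>+x. G x * indicator {0..t} x \<partial>lborel) \<le> ennreal (L * t powr (1 - 2 * rate_exponent))" if t0: "0 < t0" for t0
  proof -
    define k where "k = 1 - 2 * rate_exponent"
    let ?int = "\<lambda>t. \<integral>\<^sup>+x. G x * indicator {0..t} x \<partial>lborel"
    let ?tail = "\<lambda>S. \<integral>\<^sup>+x. ennreal (x powr (- decay_exponent)) * indicator S x \<partial>lborel"
    have k: "0 \<le> k" using rate_exponent_le by (simp add: k_def)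
    define a where "a = T powr (- H + 1) / (- H + 1)"
    have a: "0 < a" using T H by (simp add: a_def)
    have near: "(\<integral>\<^sup>+x. ennreal (x powr (- H)) * indicator {0..T} x \<partial>lborel) = ennreal a"
      unfolding a_def using H T by (intro nn_integral_has_integral_lebesgue' has_integral_powr_from_0) auto
    have major: "?int t \<le> ennreal (D * (a + b))"
      if b: "?tail (S \<inter> {T<..t}) \<le> ennreal b" "0 \<le> b" and S: "{T<..t} \<subseteq> S" and [measurable]: "S \<in> sets borel" for t b S
    proof -
      have S': "x \<in> S" if "T < x" "x \<le> t" for x using S that by auto
      have "?int t
        \<le> (\<integral>\<^sup>+x. ennreal D * (ennreal (x powr (- H)) * indicator {0..T} x + ennreal (x powr (- decay_exponent)) * indicator (S \<inter> {T<..t}) x) \<partial>lborel)"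
        using S' D(1) by (intro nn_integral_mono) (auto simp: G_def g_def ennreal_mult' split: split_indicator)
      also have "\<dots> = ennreal D * (ennreal a + ?tail (S \<inter> {T<..t}))"
        by (subst nn_integral_cmult, measurable, subst nn_integral_add, measurable) (simp only: near)
      also have "\<dots> \<le> ennreal D * (ennreal a + ennreal b)"
        by (intro mult_left_mono add_left_mono b) simp
      also have "\<dots> = ennreal (D * (a + b))"
        using a b D by (simp add: ennreal_mult')
      finally show ?thesis .
    qed
    show ?thesis
    proof (cases "H \<le> 1 / 2")
      case True
      then have kk: "k = 0" by (simp add: k_def rate_exponent_def)
      have b1: "1 < decay_exponent" using True by (auto simp: decay_exponent_def)
      define b where "b = - (T powr (- decay_exponent + 1)) / (- decay_exponent + 1)"
      have b: "0 \<le> b" unfolding b_def using b1 by (intro divide_nonpos_neg) auto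
      have hi: "?tail {T..} = ennreal b"
        unfolding b_def using b1 T by (intro nn_integral_has_integral_lebesgue' has_integral_powr_to_inf) auto
      have "?int t \<le> ennreal (D * (a + b))" for t
      proof (rule major[of "{T..}" t b])
        have "?tail ({T..} \<inter> {T<..t}) \<le> ?tail {T..}"
          by (intro nn_integral_mono) (auto split: split_indicator)
        then show "?tail ({T..} \<inter> {T<..t}) \<le> ennreal b" using hi by simp
      qed (use b in auto)
      then show ?thesis using kk D(1) a b t0 unfolding k_def[symmetric]
        by (intro exI[of _ "D * (a + b)"]) (auto intro!: mult_pos_pos)
    next
      case False
      have bb: "decay_exponent = 2 - 2 * H" "k = - decay_exponent + 1" "0 < k" using False H by (auto simp: k_def rate_exponent_def decay_exponent_def)
      define L where "L = D * (a / t0 powr k + 1 / k)"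
      have L: "0 < L" using D a t0 bb by (auto simp: L_def intro!: mult_pos_pos add_pos_pos)
      have "?int t \<le> ennreal (L * t powr k)" if t: "t \<ge> t0" for t
      proof -
        have hi: "?tail {0..t} = ennreal (t powr k / k)"
          unfolding bb(2) using bb t t0 by (intro nn_integral_has_integral_lebesgue' has_integral_powr_from_0) auto
        have "?int t \<le> ennreal (D * (a + t powr k / k))"
        proof (rule major[of UNIV t "t powr k / k"])
          have "?tail (UNIV \<inter> {T<..t}) \<le> ?tail {0..t}"
            using T by (intro nn_integral_mono) (auto split: split_indicator)
          then show "?tail (UNIV \<inter> {T<..t}) \<le> ennreal (t powr k / k)" using hi by simp
        qed (use bb in auto)
        also have "\<dots> \<le> ennreal (L * t powr k)"
        proof (rule ennreal_leI)
          have "a / t0 powr k * t0 powr k \<le> a / t0 powr k * t powr k"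
            using a bb t t0 by (intro mult_left_mono powr_mono2) auto
          then have "a + t powr k / k \<le> (a / t0 powr k + 1 / k) * t powr k" using t0 by (simp add: distrib_right)
          then have "D * (a + t powr k / k) \<le> D * ((a / t0 powr k + 1 / k) * t powr k)" using D by (intro mult_left_mono) auto
          then show "D * (a + t powr k / k) \<le> L * t powr k" by (simp only: L_def mult.assoc)
        qed
        finally show ?thesis .
      qed
      then show ?thesis using L unfolding k_def[symmetric] by blast
    qed
  qed
  show thesis by (rule that[OF 1 2 3 4])
qed

definition occupation_fraction :: "real \<Rightarrow> 'a \<Rightarrow> real set \<Rightarrow> real" where
  "occupation_fraction t \<omega> A = (1 / t) * (LINT s|time_interval t. indicator A (X s \<omega>))"

text \<open>The mean square of \<open>\<integral>\<^sub>0\<^sup>t (1\<^sub>A(X\<^sub>s) - \<nu>(A)) ds\<close> is the double integral of the covariances, hence at most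
  \<open>2 t w \<integral>\<^sub>0\<^sup>t G\<close>. The factor \<open>w\<close> stands for either \<open>\<nu>(A)\<close> or the square of a Gaussian mass of \<open>A\<close>.\<close>

lemma occupation_fraction_deviation:
  assumes G: "G \<in> borel_measurable borel" and t: "0 < t" and A[measurable]: "A \<in> sets borel"
    and cov: "\<And>s u. 0 \<le> s \<Longrightarrow> 0 \<le> u \<Longrightarrow> s \<noteq> u \<Longrightarrow> ennreal \<bar>cov A s u\<bar> \<le> G \<bar>s - u\<bar> * ennreal w"
    and w: "0 \<le> w" and L: "0 \<le> L"
    and GL: "(\<integral>\<^sup>+x. G x * indicator {0..t} x \<partial>lborel) \<le> ennreal (L * t powr (1 - 2 * rate_exponent))"
  shows "(\<integral>\<^sup>+\<omega>. ennreal \<bar>occupation_fraction t \<omega> A - nu A\<bar> \<partial>M) \<le> ennreal (sqrt (2 * L) * t powr (- rate_exponent) * sqrt w)"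
proof -
  let ?int = "\<integral>\<^sup>+x. G x * indicator {0..t} x \<partial>lborel" and ?L = "L * t powr (1 - 2 * rate_exponent)"
  let ?bound = "sqrt (2 * L) * t powr (- rate_exponent) * sqrt w"
  note [measurable] = G
  interpret T: finite_measure "time_interval t" by (rule finite_measure_time_interval)
  have t0: "0 \<le> t" using t by simp
  define phi where "phi s \<omega> = indicator A (X s \<omega>) - nu A" for s \<omega>
  have jm[measurable]: "(\<lambda>(s, \<omega>). phi s \<omega>) \<in> borel_measurable (borel \<Otimes>\<^sub>M M)" unfolding phi_def by measurable
  have phi_le: "\<bar>phi s \<omega>\<bar> \<le> 1" for s \<omega> using nu_nonneg[of A] nu_le_1[of A] by (auto simp: phi_def indicator_def)
  define J where "J \<omega> = (LINT s|time_interval t. phi s \<omega>)" for \<omega>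
  have [measurable]: "J \<in> borel_measurable M" unfolding J_def[abs_def] by (rule path_integral_measurable[OF jm])
  have K: "(\<integral>\<^sup>+\<omega>. ennreal \<bar>phi s \<omega> * phi r \<omega>\<bar> \<partial>M) \<le> ennreal 1" for s r
  proof -
    have "(\<integral>\<^sup>+\<omega>. ennreal \<bar>phi s \<omega> * phi r \<omega>\<bar> \<partial>M) \<le> (\<integral>\<^sup>+\<omega>. ennreal 1 \<partial>M)"
      by (intro nn_integral_mono ennreal_leI) (auto simp: abs_mult intro!: mult_le_one phi_le)
    then show ?thesis by (simp add: emeasure_space_1)
  qed
  have sp: "space (time_interval t) = {0..t}" by (simp add: space_restrict_space)
  have inner: "(\<integral>\<^sup>+r. G \<bar>s - r\<bar> \<partial>time_interval t) \<le> 2 * ennreal ?L" if s: "0 \<le> s" "s \<le> t" for s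
  proof -
    have "(\<integral>\<^sup>+r. G \<bar>s - r\<bar> \<partial>time_interval t) = (\<integral>\<^sup>+r. G \<bar>s - r\<bar> * indicator {0..t} r \<partial>lborel)"
      by (subst nn_integral_restrict_space) auto
    also have "\<dots> \<le> (\<integral>\<^sup>+r. (G (s - r) * indicator {0..t} (s - r)) + (G (r - s) * indicator {0..t} (r - s)) \<partial>lborel)"
      using s by (intro nn_integral_mono) (auto split: split_indicator simp: abs_if)
    also have "\<dots> = (\<integral>\<^sup>+r. G (s - r) * indicator {0..t} (s - r) \<partial>lborel) + (\<integral>\<^sup>+r. G (r - s) * indicator {0..t} (r - s) \<partial>lborel)"
      by (rule nn_integral_add) auto
    also have "(\<integral>\<^sup>+r. G (s - r) * indicator {0..t} (s - r) \<partial>lborel) = ?int"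
      using nn_integral_real_affine[of "\<lambda>x. G x * indicator {0..t} x" "-1" s] by simp
    also have "(\<integral>\<^sup>+r. G (r - s) * indicator {0..t} (r - s) \<partial>lborel) = ?int"
      using nn_integral_real_affine[of "\<lambda>x. G x * indicator {0..t} x" "1" "- s"] by simp
    finally have "(\<integral>\<^sup>+r. G \<bar>s - r\<bar> \<partial>time_interval t) \<le> 2 * ?int"
      by (simp add: mult_2)
    also have "\<dots> \<le> 2 * ennreal ?L" by (intro mult_left_mono GL) simp
    finally show ?thesis .
  qed
  have AEne: "AE r in time_interval t. r \<noteq> s" for s
  proof -
    have "AE r in lborel. r \<noteq> s" by (rule AE_lborel_singleton)
    then show ?thesis by (subst AE_restrict_space_iff) auto
  qed
  have "(\<integral>\<^sup>+\<omega>. ennreal ((J \<omega>)\<^sup>2) \<partial>M) = ennreal (expectation (\<lambda>\<omega>. (J \<omega>)\<^sup>2))"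
    unfolding J_def by (intro nn_integral_eq_integral integrable_path_integral_square[OF prob_space_axioms jm t0 zero_le_one K]) auto
  also have "expectation (\<lambda>\<omega>. (J \<omega>)\<^sup>2) = (LINT s|time_interval t. LINT r|time_interval t. cov A s r)"
  proof -
    have "expectation (\<lambda>\<omega>. (J \<omega>)\<^sup>2) = (LINT s|time_interval t. LINT r|time_interval t. expectation (\<lambda>\<omega>. phi s \<omega> * phi r \<omega>))"
      unfolding J_def by (rule expectation_path_integral_square[OF prob_space_axioms jm t0 zero_le_one K])
    then show ?thesis by (simp only: cov_def phi_def)
  qed
  also have "ennreal \<dots> \<le> ennreal \<bar>\<dots>\<bar>" by (intro ennreal_leI abs_ge_self)
  also have "\<dots> \<le> (\<integral>\<^sup>+s. ennreal \<bar>LINT r|time_interval t. cov A s r\<bar> \<partial>time_interval t)"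
    by (rule abs_integral_le_nn_integral)
  also have "\<dots> \<le> (\<integral>\<^sup>+s. 2 * ennreal ?L * ennreal w \<partial>time_interval t)"
  proof (rule nn_integral_mono)
    fix s assume "s \<in> space (time_interval t)"
    then have s: "0 \<le> s" "s \<le> t" by (auto simp: sp)
    have "ennreal \<bar>LINT r|time_interval t. cov A s r\<bar> \<le> (\<integral>\<^sup>+r. ennreal \<bar>cov A s r\<bar> \<partial>time_interval t)"
      by (rule abs_integral_le_nn_integral)
    also have "\<dots> \<le> (\<integral>\<^sup>+r. G \<bar>s - r\<bar> * ennreal w \<partial>time_interval t)"
    proof (rule nn_integral_mono_AE)
      show "AE r in time_interval t. ennreal \<bar>cov A s r\<bar> \<le> G \<bar>s - r\<bar> * ennreal w"
        using AEne[of s] AE_space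
      proof eventually_elim
        case (elim r)
        then show ?case using s by (intro cov) (auto simp: sp)
      qed
    qed
    also have "\<dots> = (\<integral>\<^sup>+r. G \<bar>s - r\<bar> \<partial>time_interval t) * ennreal w"
      by (rule nn_integral_multc) measurable
    also have "\<dots> \<le> 2 * ennreal ?L * ennreal w"
      by (intro mult_right_mono inner s) simp
    finally show "ennreal \<bar>LINT r|time_interval t. cov A s r\<bar> \<le> 2 * ennreal ?L * ennreal w" .
  qed
  also have "\<dots> = ennreal (t * (2 * L * t powr (1 - 2 * rate_exponent) * w))"
  proof -
    have "2 * ennreal ?L * ennreal w = ennreal (2 * L * t powr (1 - 2 * rate_exponent) * w)"
      using L w by (simp add: ennreal_mult'[symmetric] ennreal_numeral[symmetric] mult.assoc del: ennreal_numeral)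
    then show ?thesis using emeasure_time_interval[OF t0] t0 L w
      by (simp add: ennreal_mult'[symmetric] mult.commute)
  qed
  also have "t * (2 * L * t powr (1 - 2 * rate_exponent) * w) = (t * ?bound)\<^sup>2"
  proof -
    have "t\<^sup>2 * (t powr (- rate_exponent))\<^sup>2 = t * t powr (1 - 2 * rate_exponent)"
    proof -
      have "t powr (1 - 2 * rate_exponent) = t powr 1 * (t powr (- rate_exponent) * t powr (- rate_exponent))"
        unfolding powr_add[symmetric] by simp
      then show ?thesis using t by (simp add: power2_eq_square)
    qed
    then show ?thesis using L w by (simp add: power_mult_distrib)
  qed
  finally have sq: "(\<integral>\<^sup>+\<omega>. ennreal ((J \<omega>)\<^sup>2) \<partial>M) \<le> ennreal ((t * ?bound)\<^sup>2)" .
  have "(\<integral>\<^sup>+\<omega>. ennreal \<bar>J \<omega>\<bar> \<partial>M)\<^sup>2 = (\<integral>\<^sup>+\<omega>. ennreal \<bar>J \<omega>\<bar> * 1 \<partial>M)\<^sup>2" by simp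
  also have "\<dots> \<le> (\<integral>\<^sup>+\<omega>. (ennreal \<bar>J \<omega>\<bar>)\<^sup>2 \<partial>M) * (\<integral>\<^sup>+\<omega>. 1\<^sup>2 \<partial>M)"
    by (rule Cauchy_Schwarz_nn_integral) auto
  also have "\<dots> = (\<integral>\<^sup>+\<omega>. ennreal ((J \<omega>)\<^sup>2) \<partial>M)" by (simp add: emeasure_space_1 ennreal_power)
  also note sq
  finally have "(\<integral>\<^sup>+\<omega>. ennreal \<bar>J \<omega>\<bar> \<partial>M)\<^sup>2 \<le> (ennreal (t * ?bound))\<^sup>2"
    using t L w by (simp add: ennreal_power)
  then have J1: "(\<integral>\<^sup>+\<omega>. ennreal \<bar>J \<omega>\<bar> \<partial>M) \<le> ennreal (t * ?bound)"
    by (rule ennreal_square_le_imp_le) (use t L w in simp)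
  have "(\<integral>\<^sup>+\<omega>. ennreal \<bar>occupation_fraction t \<omega> A - nu A\<bar> \<partial>M) = (\<integral>\<^sup>+\<omega>. ennreal (1 / t) * ennreal \<bar>J \<omega>\<bar> \<partial>M)"
  proof (rule nn_integral_cong)
    fix \<omega> assume w: "\<omega> \<in> space M"
    have m: "(\<lambda>s. indicator A (X s \<omega>) :: real) \<in> borel_measurable borel"
    proof -
      have [measurable]: "(\<lambda>s. X s \<omega>) \<in> borel_measurable borel"
        by (rule borel_measurable_continuous_onI[OF X_cont[OF w]])
      show ?thesis by measurable
    qed
    have "integrable (time_interval t) (\<lambda>s. indicator A (X s \<omega>) :: real)"
      by (rule T.integrable_const_bound[where B=1]) (use measurable_time_intervalI[OF m] in \<open>auto simp: indicator_def\<close>)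
    then have "J \<omega> = (LINT s|time_interval t. indicator A (X s \<omega>)) - t * nu A"
      unfolding J_def phi_def using t0 by (simp add: measure_restrict_space sp)
    then have "occupation_fraction t \<omega> A - nu A = (1 / t) * J \<omega>" using t by (simp add: occupation_fraction_def field_simps)
    then show "ennreal \<bar>occupation_fraction t \<omega> A - nu A\<bar> = ennreal (1 / t) * ennreal \<bar>J \<omega>\<bar>"
      using t by (simp add: abs_mult ennreal_mult'[symmetric])
  qed
  also have "\<dots> = ennreal (1 / t) * (\<integral>\<^sup>+\<omega>. ennreal \<bar>J \<omega>\<bar> \<partial>M)" by (rule nn_integral_cmult) measurable
  also have "\<dots> \<le> ennreal (1 / t) * ennreal (t * ?bound)"
    by (intro mult_left_mono J1) simp
  also have "\<dots> = ennreal ?bound"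
    using t by (simp add: ennreal_mult'[symmetric])
  finally show ?thesis .
qed

lemma expectation_occ_le:
  assumes t: "0 < t" and A[measurable]: "A \<in> sets borel"
  shows "(\<integral>\<^sup>+\<omega>. ennreal \<bar>occupation_fraction t \<omega> A - nu A\<bar> \<partial>M) \<le> ennreal (2 * nu A)"
proof -
  have t0: "0 \<le> t" using t by simp
  define ph where "ph s \<omega> = (indicator A (X s \<omega>) :: real)" for s \<omega>
  have jm[measurable]: "(\<lambda>(s, \<omega>). ph s \<omega>) \<in> borel_measurable (borel \<Otimes>\<^sub>M M)" unfolding ph_def by measurable
  have K: "(\<integral>\<^sup>+\<omega>. ennreal \<bar>1 * ph s \<omega>\<bar> \<partial>M) \<le> ennreal 1" for s
  proof -
    have "(\<integral>\<^sup>+\<omega>. ennreal \<bar>1 * ph s \<omega>\<bar> \<partial>M) \<le> (\<integral>\<^sup>+\<omega>. ennreal 1 \<partial>M)"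
      by (intro nn_integral_mono ennreal_leI) (auto simp: ph_def indicator_def)
    then show ?thesis by (simp add: emeasure_space_1)
  qed
  note * = prob_space_axioms jm _ t0 K
  have i: "integrable M (\<lambda>\<omega>. LINT s|time_interval t. ph s \<omega>)"
    using integrable_times_path_integral[OF *] by simp
  have "expectation (\<lambda>\<omega>. LINT s|time_interval t. ph s \<omega>) = (LINT s|time_interval t. expectation (\<lambda>\<omega>. ph s \<omega>))"
    using expectation_times_path_integral[OF *] by simp
  also have "\<dots> = (LINT s|time_interval t. nu A)"
    unfolding ph_def by (intro Bochner_Integration.integral_cong refl expectation_indicator_X A) (auto simp: space_restrict_space)
  also have "\<dots> = t * nu A" using t0 by (simp add: measure_restrict_space space_restrict_space)
  finally have e: "expectation (\<lambda>\<omega>. LINT s|time_interval t. ph s \<omega>) = t * nu A" .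
  have oc: "occupation_fraction t \<omega> A = (1 / t) * (LINT s|time_interval t. ph s \<omega>)" for \<omega> by (simp add: occupation_fraction_def ph_def)
  have o0: "0 \<le> occupation_fraction t \<omega> A" for \<omega> using t by (auto simp: oc ph_def)
  have "(\<integral>\<^sup>+\<omega>. ennreal \<bar>occupation_fraction t \<omega> A - nu A\<bar> \<partial>M) \<le> (\<integral>\<^sup>+\<omega>. ennreal (occupation_fraction t \<omega> A + nu A) \<partial>M)"
  proof (intro nn_integral_mono ennreal_leI)
    show "\<bar>occupation_fraction t \<omega> A - nu A\<bar> \<le> occupation_fraction t \<omega> A + nu A" for \<omega> using o0[of \<omega>] nu_nonneg[of A] by (simp add: abs_if)
  qed
  also have "\<dots> = ennreal (expectation (\<lambda>\<omega>. occupation_fraction t \<omega> A + nu A))"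
    using i o0 nu_nonneg by (intro nn_integral_eq_integral) (auto simp: oc)
  also have "expectation (\<lambda>\<omega>. occupation_fraction t \<omega> A + nu A) = 2 * nu A"
    unfolding oc using i e t by (simp add: prob_space)
  finally show ?thesis .
qed

end

section \<open>Coupling along a countable partition\<close>

lemma nn_integral_countable_partition:
  fixes f :: "'a \<Rightarrow> 'i::countable"
  assumes f[measurable]: "f \<in> measurable N (count_space UNIV)" and g[measurable]: "g \<in> borel_measurable N"
  shows "(\<integral>\<^sup>+x. h (f x) * g x \<partial>N) = (\<integral>\<^sup>+k. h k * (\<integral>\<^sup>+x. indicator {x. f x = k} x * g x \<partial>N) \<partial>count_space UNIV)"
proof -
  have "(\<integral>\<^sup>+x. h (f x) * g x \<partial>N) = (\<integral>\<^sup>+x. \<integral>\<^sup>+k. h k * (indicator {x. f x = k} x * g x) \<partial>count_space UNIV \<partial>N)"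
  proof (rule nn_integral_cong)
    fix x
    have "(\<integral>\<^sup>+k. h k * (indicator {x. f x = k} x * g x) \<partial>count_space UNIV) = (\<integral>\<^sup>+k. (h k * g x) * indicator {f x} k \<partial>count_space UNIV)"
      by (intro nn_integral_cong) (auto simp: indicator_def)
    also have "\<dots> = h (f x) * g x" by (subst nn_integral_indicator_singleton) auto
    finally show "h (f x) * g x = (\<integral>\<^sup>+k. h k * (indicator {x. f x = k} x * g x) \<partial>count_space UNIV)" by simp
  qed
  also have "\<dots> = (\<integral>\<^sup>+k. \<integral>\<^sup>+x. h k * (indicator {x. f x = k} x * g x) \<partial>N \<partial>count_space UNIV)"
    by (rule nn_integral_count_space_nn_integral) measurable
  also have "\<dots> = (\<integral>\<^sup>+k. h k * (\<integral>\<^sup>+x. indicator {x. f x = k} x * g x \<partial>N) \<partial>count_space UNIV)"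
    by (intro nn_integral_cong nn_integral_cmult) measurable
  finally show ?thesis .
qed

lemma nn_integral_countable_partition_mass:
  fixes f :: "real \<Rightarrow> 'i::countable"
  assumes f: "f \<in> measurable borel (count_space UNIV)" and N: "finite_measure N" "sets N = sets borel"
  shows "(\<integral>\<^sup>+x. h (f x) \<partial>N) = (\<integral>\<^sup>+k. h k * ennreal (measure N {x. f x = k}) \<partial>count_space UNIV)"
proof -
  interpret finite_measure N by fact
  have fN[measurable]: "f \<in> measurable N (count_space UNIV)" using f N(2) measurable_cong_sets by blast
  have sp: "space N = UNIV" using sets_eq_imp_space_eq[OF N(2)] by simp
  have m: "{x. f x = k} \<in> sets N" for k
    using measurable_sets[OF fN, of "{k}"] by (simp add: sp vimage_def)
  have "(\<integral>\<^sup>+x. h (f x) * 1 \<partial>N) = (\<integral>\<^sup>+k. h k * (\<integral>\<^sup>+x. indicator {x. f x = k} x * 1 \<partial>N) \<partial>count_space UNIV)"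
    by (rule nn_integral_countable_partition[OF fN]) simp
  then show ?thesis by (simp add: m emeasure_eq_measure)
qed

context
  fixes f :: "real \<Rightarrow> 'i::countable"
  assumes f [measurable]: "f \<in> measurable borel (count_space UNIV)"
begin

text \<open>The cells are the level sets of \<open>f\<close>. The coupling of \<open>N\<close> and \<open>N'\<close> has a density with respect to the product
  measure. The diagonal part transports the common mass \<open>min (N(F)) (N'(F))\<close> of each cell \<open>F\<close> inside \<open>F\<close>, the
  residual part is the normalised product of what is left over from \<open>N\<close> and from \<open>N'\<close>. Division by zero
  yielding zero takes care of cells without mass, and of measures that agree on all cells.\<close>

definition cell_mass :: "real measure \<Rightarrow> 'i \<Rightarrow> real" where
  "cell_mass N k = measure N {x. f x = k}"

definition excess :: "real measure \<Rightarrow> real measure \<Rightarrow> 'i \<Rightarrow> real" where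
  "excess N N' k = (cell_mass N k - min (cell_mass N k) (cell_mass N' k)) / cell_mass N k"

definition total_excess :: "real measure \<Rightarrow> real measure \<Rightarrow> ennreal" where
  "total_excess N N' = (\<integral>\<^sup>+x. ennreal (excess N N' (f x)) \<partial>N)"

definition diagonal_density :: "real measure \<Rightarrow> real measure \<Rightarrow> real \<Rightarrow> real \<Rightarrow> ennreal" where
  "diagonal_density N N' x y = (if f x = f y then ennreal (min (cell_mass N (f x)) (cell_mass N' (f x)) / (cell_mass N (f x) * cell_mass N' (f x))) else 0)"

definition residual_density :: "real measure \<Rightarrow> real measure \<Rightarrow> real \<Rightarrow> real \<Rightarrow> ennreal" where
  "residual_density N N' x y = ennreal (excess N N' (f x)) * ennreal (excess N' N (f y)) / total_excess N N'"

abbreviation transport_plan :: "real measure \<Rightarrow> real measure \<Rightarrow> (real \<times> real) measure" where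
  "transport_plan N N' \<equiv>
    density (N \<Otimes>\<^sub>M N') (\<lambda>p. diagonal_density N N' (fst p) (snd p) + residual_density N N' (fst p) (snd p))"

abbreviation leftover :: "real measure \<Rightarrow> real measure \<Rightarrow> 'i \<Rightarrow> real" where
  "leftover N N' k \<equiv> cell_mass N k - min (cell_mass N k) (cell_mass N' k)"

lemma cell_mass_nonneg: "0 \<le> cell_mass N k" by (simp add: cell_mass_def)

lemma excess_nonneg: "0 \<le> excess N N' k"
  by (simp add: excess_def cell_mass_nonneg)

lemma cell_mass_times_excess: "ennreal (excess N N' k) * ennreal (cell_mass N k) = ennreal (leftover N N' k)"
proof -
  have "excess N N' k * cell_mass N k = leftover N N' k"
    using cell_mass_nonneg[of N' k] by (cases "cell_mass N k = 0") (auto simp: excess_def)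
  then show ?thesis by (simp add: ennreal_mult'[symmetric] excess_nonneg)
qed

lemma total_excess_eq:
  assumes N: "prob_space N" "sets N = sets borel"
  shows "total_excess N N' = (\<integral>\<^sup>+k. ennreal (leftover N N' k) \<partial>count_space UNIV)"
proof -
  interpret prob_space N by fact
  show ?thesis unfolding total_excess_def
    using nn_integral_countable_partition_mass[OF f finite_measure_axioms N(2), of "\<lambda>k. ennreal (excess N N' k)"]
    by (simp add: cell_mass_times_excess cell_mass_def[symmetric])
qed

lemma sum_cell_mass:
  assumes N: "prob_space N" "sets N = sets borel"
  shows "(\<integral>\<^sup>+k. ennreal (cell_mass N k) \<partial>count_space UNIV) = 1"
proof -
  interpret prob_space N by fact
  show ?thesis
    using nn_integral_countable_partition_mass[OF f finite_measure_axioms N(2), of "\<lambda>_. 1"]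
    by (simp add: cell_mass_def emeasure_space_1)
qed

lemma total_excess_plus:
  assumes N: "prob_space N" "sets N = sets borel"
  shows "(\<integral>\<^sup>+k. ennreal (min (cell_mass N k) (cell_mass N' k)) \<partial>count_space UNIV) + total_excess N N' = 1"
proof -
  have "(\<integral>\<^sup>+k. ennreal (min (cell_mass N k) (cell_mass N' k)) \<partial>count_space UNIV) + total_excess N N'
     = (\<integral>\<^sup>+k. ennreal (min (cell_mass N k) (cell_mass N' k)) + ennreal (leftover N N' k) \<partial>count_space UNIV)"
    unfolding total_excess_eq[OF N] by (rule nn_integral_add[symmetric]) auto
  also have "\<dots> = (\<integral>\<^sup>+k. ennreal (cell_mass N k) \<partial>count_space UNIV)"
    by (intro nn_integral_cong) (simp add: cell_mass_nonneg ennreal_plus[symmetric] del: ennreal_plus)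
  finally show ?thesis using sum_cell_mass[OF N] by simp
qed

text \<open>Both leftovers complement the same common mass to \<open>1\<close>.\<close>

lemma total_excess_sym:
  assumes "prob_space N" "sets N = sets borel" "prob_space N'" "sets N' = sets borel"
  shows "total_excess N N' = total_excess N' N"
proof -
  let ?m = "\<integral>\<^sup>+k. ennreal (min (cell_mass N k) (cell_mass N' k)) \<partial>count_space UNIV"
  have 1: "?m + total_excess N N' = 1" by (rule total_excess_plus) fact+
  have 2: "?m + total_excess N' N = 1" using total_excess_plus[OF assms(3,4), of N] by (simp add: min.commute)
  have "?m \<noteq> \<top>" using 1 by auto
  moreover have "?m + total_excess N N' = ?m + total_excess N' N" using 1 2 by (rule trans[OF _ sym])
  ultimately show ?thesis by (simp only: ennreal_add_left_cancel) simp
qed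

lemma total_excess_le_1:
  assumes "prob_space N" "sets N = sets borel" shows "total_excess N N' \<le> 1"
  unfolding total_excess_plus[OF assms, of N', symmetric] by (rule add_increasing) simp_all

text \<open>Integrating out \<open>y\<close>, the diagonal part contributes the fraction of the cell of \<open>x\<close> that is common mass, the
  residual part the fraction that is left over. Both fractions make sense only on cells of positive mass,
  which carry almost every \<open>x\<close>.\<close>

lemma transport_marginal:
  assumes N: "prob_space N" "sets N = sets borel" and N': "prob_space N'" "sets N' = sets borel"
  shows "AE x in N. (\<integral>\<^sup>+y. diagonal_density N N' x y + residual_density N N' x y \<partial>N') = 1"
proof -
  interpret N: prob_space N by fact
  interpret N': prob_space N' by fact
  have [measurable]: "f \<in> measurable N (count_space UNIV)" "f \<in> measurable N' (count_space UNIV)"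
    using f N(2) N'(2) measurable_cong_sets by blast+
  have "(\<integral>\<^sup>+x. indicator {k. cell_mass N k = 0} (f x) \<partial>N) = (\<integral>\<^sup>+k. indicator {k. cell_mass N k = 0} k * ennreal (measure N {x. f x = k}) \<partial>count_space UNIV)"
    by (rule nn_integral_countable_partition_mass[OF f N.finite_measure_axioms N(2)])
  also have "\<dots> = 0" unfolding cell_mass_def[symmetric] by (intro nn_integral_zero') (auto simp: indicator_def)
  finally have "AE x in N. indicator {k. cell_mass N k = 0} (f x) = (0::ennreal)"
    by (subst (asm) nn_integral_0_iff_AE) measurable
  then have pos: "AE x in N. cell_mass N (f x) > 0"
    by eventually_elim (use cell_mass_nonneg[of N] in \<open>auto simp: indicator_def less_le split: if_splits\<close>)
  have res0: "AE x in N. total_excess N N' = 0 \<longrightarrow> excess N N' (f x) = 0"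
  proof (cases "total_excess N N' = 0")
    case True
    then have "AE x in N. ennreal (excess N N' (f x)) = 0"
      unfolding total_excess_def by (subst (asm) nn_integral_0_iff_AE) auto
    then show ?thesis by eventually_elim (simp add: excess_nonneg ennreal_eq_0_iff order_antisym)
  qed simp
  from pos res0 show ?thesis
  proof eventually_elim
    case (elim x)
    let ?k = "f x"
    let ?a = "cell_mass N ?k" and ?b = "cell_mass N' ?k"
    have b0: "0 \<le> ?b" by (rule cell_mass_nonneg)
    have "(\<integral>\<^sup>+y. diagonal_density N N' x y \<partial>N') = (\<integral>\<^sup>+y. (if f x = f y then ennreal (min ?a ?b / (?a * ?b)) else 0) \<partial>N')"
      by (simp add: diagonal_density_def)
    also have "\<dots> = (\<integral>\<^sup>+k. (if f x = k then ennreal (min ?a ?b / (?a * ?b)) else 0) * ennreal (measure N' {x. f x = k}) \<partial>count_space UNIV)"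
      by (rule nn_integral_countable_partition_mass[OF f N'.finite_measure_axioms N'(2)])
    also have "\<dots> = (\<integral>\<^sup>+k. (ennreal (min ?a ?b / (?a * ?b)) * ennreal (cell_mass N' k)) * indicator {?k} k \<partial>count_space UNIV)"
      by (intro nn_integral_cong) (auto simp: cell_mass_def indicator_def)
    also have "\<dots> = ennreal (min ?a ?b / (?a * ?b)) * ennreal ?b" by (subst nn_integral_indicator_singleton) auto
    also have "\<dots> = ennreal (min ?a ?b / ?a)" using b0 elim(1) by (cases "?b = 0") (auto simp: ennreal_mult''[symmetric])
    finally have d: "(\<integral>\<^sup>+y. diagonal_density N N' x y \<partial>N') = ennreal (min ?a ?b / ?a)" .
    have "(\<integral>\<^sup>+y. residual_density N N' x y \<partial>N') = (\<integral>\<^sup>+y. (ennreal (excess N N' (f x)) / total_excess N N') * ennreal (excess N' N (f y)) \<partial>N')"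
      unfolding residual_density_def by (intro nn_integral_cong) (simp add: divide_ennreal_def mult_ac)
    also have "\<dots> = (ennreal (excess N N' (f x)) / total_excess N N') * total_excess N' N"
      unfolding total_excess_def[of N' N] by (rule nn_integral_cmult) measurable
    also have "\<dots> = ennreal (excess N N' (f x))"
    proof (cases "total_excess N N' = 0")
      case True
      then show ?thesis using elim(2) by simp
    next
      case False
      have "total_excess N N' \<noteq> \<top>" using total_excess_le_1[OF N, of N'] by (auto simp: top_unique)
      then have "total_excess N N' / total_excess N N' = 1" using False by (intro ennreal_divide_self) (auto simp: less_top)
      moreover have "(ennreal (excess N N' (f x)) / total_excess N N') * total_excess N N' = ennreal (excess N N' (f x)) * (total_excess N N' / total_excess N N')"
        by (simp only: divide_ennreal_def mult.assoc mult.commute mult.left_commute)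
      ultimately show ?thesis unfolding total_excess_sym[OF N N', symmetric] by simp
    qed
    finally have r: "(\<integral>\<^sup>+y. residual_density N N' x y \<partial>N') = ennreal (excess N N' (f x))" .
    have "(\<integral>\<^sup>+y. diagonal_density N N' x y + residual_density N N' x y \<partial>N') = ennreal (min ?a ?b / ?a) + ennreal (excess N N' (f x))"
      unfolding d[symmetric] r[symmetric] by (rule nn_integral_add) (simp_all add: diagonal_density_def residual_density_def)
    also have "\<dots> = ennreal (min ?a ?b / ?a + excess N N' (f x))"
      using elim(1) b0 by (intro ennreal_plus[symmetric] excess_nonneg) auto
    also have "min ?a ?b / ?a + excess N N' (f x) = 1"
      using elim(1) unfolding excess_def by (simp add: add_divide_distrib[symmetric])
    finally show ?case by simp
  qed
qed

lemma diagonal_density_sym: "diagonal_density N N' x y = diagonal_density N' N y x"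
  by (simp add: diagonal_density_def min.commute mult.commute)

lemma residual_density_sym:
  assumes "prob_space N" "sets N = sets borel" "prob_space N'" "sets N' = sets borel"
  shows "residual_density N N' x y = residual_density N' N y x"
  unfolding residual_density_def total_excess_sym[OF assms] by (simp add: mult.commute)

lemma emeasure_distr_density:
  assumes [measurable]: "D \<in> borel_measurable P" "g \<in> measurable P borel" "A \<in> sets borel"
  shows "emeasure (distr (density P D) borel g) A = (\<integral>\<^sup>+p. indicator A (g p) * D p \<partial>P)"
proof -
  have "emeasure (distr (density P D) borel g) A = (\<integral>\<^sup>+x. indicator A x \<partial>distr (density P D) borel g)" by simp
  also have "\<dots> = (\<integral>\<^sup>+p. indicator A (g p) \<partial>density P D)" by (intro nn_integral_distr) auto
  also have "\<dots> = (\<integral>\<^sup>+p. D p * indicator A (g p) \<partial>P)" by (intro nn_integral_density) measurable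
  finally show ?thesis by (simp only: mult.commute)
qed

lemma transport_coupling:
  assumes N: "prob_space N" "sets N = sets borel" and N': "prob_space N'" "sets N' = sets borel"
  shows "transport_plan N N' \<in> couplings N N'"
proof -
  interpret N: prob_space N by fact
  interpret N': prob_space N' by fact
  interpret P: pair_prob_space N N' ..
  have fm[measurable]: "f \<in> measurable N (count_space UNIV)" "f \<in> measurable N' (count_space UNIV)"
    using f N(2) N'(2) measurable_cong_sets by blast+
  have sp: "space N = UNIV" "space N' = UNIV" using sets_eq_imp_space_eq[OF N(2)] sets_eq_imp_space_eq[OF N'(2)] by auto
  let ?D = "\<lambda>p. diagonal_density N N' (fst p) (snd p) + residual_density N N' (fst p) (snd p)"
  have D[measurable]: "?D \<in> borel_measurable (N \<Otimes>\<^sub>M N')"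
    unfolding diagonal_density_def residual_density_def by measurable
  have [measurable]: "fst \<in> measurable (N \<Otimes>\<^sub>M N') borel" "snd \<in> measurable (N \<Otimes>\<^sub>M N') borel"
    using measurable_fst[of N N'] measurable_snd[of N N'] N(2) N'(2) measurable_cong_sets by blast+
  have 1: "sets (density (N \<Otimes>\<^sub>M N') ?D) = sets (borel \<Otimes>\<^sub>M borel)"
    using sets_pair_measure_cong[OF N(2) N'(2)] by simp
  have 2: "distr (density (N \<Otimes>\<^sub>M N') ?D) borel fst = N"
  proof (rule measure_eqI)
    fix A assume "A \<in> sets (distr (density (N \<Otimes>\<^sub>M N') ?D) borel fst)"
    then have A: "A \<in> sets borel" by simp
    then have AN[measurable]: "A \<in> sets N" using N(2) by simp
    have "emeasure (distr (density (N \<Otimes>\<^sub>M N') ?D) borel fst) A = (\<integral>\<^sup>+p. indicator A (fst p) * ?D p \<partial>(N \<Otimes>\<^sub>M N'))"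
      by (rule emeasure_distr_density[OF D _ A]) measurable
    also have "\<dots> = (\<integral>\<^sup>+x. \<integral>\<^sup>+y. indicator A x * (diagonal_density N N' x y + residual_density N N' x y) \<partial>N' \<partial>N)"
      by (subst N'.nn_integral_fst[symmetric]) auto
    also have "\<dots> = (\<integral>\<^sup>+x. indicator A x * (\<integral>\<^sup>+y. (diagonal_density N N' x y + residual_density N N' x y) \<partial>N') \<partial>N)"
      by (intro nn_integral_cong nn_integral_cmult) (simp add: diagonal_density_def residual_density_def)
    also have "\<dots> = (\<integral>\<^sup>+x. indicator A x \<partial>N)"
      using transport_marginal[OF N N'] by (intro nn_integral_cong_AE) (auto elim!: eventually_mono)
    also have "\<dots> = emeasure N A" using AN by simp
    finally show "emeasure (distr (density (N \<Otimes>\<^sub>M N') ?D) borel fst) A = emeasure N A" .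
  qed (use N in simp)
  have 3: "distr (density (N \<Otimes>\<^sub>M N') ?D) borel snd = N'"
  proof (rule measure_eqI)
    fix A assume "A \<in> sets (distr (density (N \<Otimes>\<^sub>M N') ?D) borel snd)"
    then have A: "A \<in> sets borel" by simp
    then have AN[measurable]: "A \<in> sets N'" using N'(2) by simp
    have "emeasure (distr (density (N \<Otimes>\<^sub>M N') ?D) borel snd) A = (\<integral>\<^sup>+p. indicator A (snd p) * ?D p \<partial>(N \<Otimes>\<^sub>M N'))"
      by (rule emeasure_distr_density[OF D _ A]) measurable
    also have "\<dots> = (\<integral>\<^sup>+y. \<integral>\<^sup>+x. indicator A y * (diagonal_density N N' x y + residual_density N N' x y) \<partial>N \<partial>N')"
      by (subst P.nn_integral_snd[symmetric]) auto
    also have "\<dots> = (\<integral>\<^sup>+y. indicator A y * (\<integral>\<^sup>+x. (diagonal_density N' N y x + residual_density N' N y x) \<partial>N) \<partial>N')"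
      unfolding diagonal_density_sym[of N N'] residual_density_sym[OF N N']
      by (intro nn_integral_cong nn_integral_cmult) (simp add: diagonal_density_def residual_density_def)
    also have "\<dots> = (\<integral>\<^sup>+x. indicator A x \<partial>N')"
      using transport_marginal[OF N' N] by (intro nn_integral_cong_AE) (auto elim!: eventually_mono)
    also have "\<dots> = emeasure N' A" using AN by simp
    finally show "emeasure (distr (density (N \<Otimes>\<^sub>M N') ?D) borel snd) A = emeasure N' A" .
  qed (use N' in simp)
  show ?thesis using 1 2 3 by (simp add: couplings_def)
qed

text \<open>The bound \<open>w (f x) + w (f y)\<close> on the cost separates the variables, so the residual part only sees the leftover
  mass of each cell, which is the positive or the negative part of \<open>N(F) - N'(F)\<close>.\<close>

lemma transport_cost:
  assumes N: "prob_space N" "sets N = sets borel" and N': "prob_space N'" "sets N' = sets borel"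
    and c[measurable]: "(\<lambda>p. c (fst p) (snd p)) \<in> borel_measurable (borel \<Otimes>\<^sub>M borel)"
    and diag: "\<And>x y. f x = f y \<Longrightarrow> c x y \<le> ennreal d" and off: "\<And>x y. c x y \<le> ennreal (w (f x)) + ennreal (w (f y))"
    and w: "\<And>k. 0 \<le> w k"
  shows "(\<integral>\<^sup>+p. c (fst p) (snd p) \<partial>transport_plan N N')
    \<le> ennreal d + (\<integral>\<^sup>+k. ennreal (w k * \<bar>cell_mass N k - cell_mass N' k\<bar>) \<partial>count_space UNIV)"
proof -
  interpret N: prob_space N by fact
  interpret N': prob_space N' by fact
  interpret P: pair_prob_space N N' ..
  have fm[measurable]: "f \<in> measurable N (count_space UNIV)" "f \<in> measurable N' (count_space UNIV)"
    using f N(2) N'(2) measurable_cong_sets by blast+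
  have cP[measurable]: "(\<lambda>p. c (fst p) (snd p)) \<in> borel_measurable (N \<Otimes>\<^sub>M N')"
    using c sets_pair_measure_cong[OF N(2) N'(2)] measurable_cong_sets by blast
  let ?D1 = "\<lambda>p. diagonal_density N N' (fst p) (snd p)" and ?D2 = "\<lambda>p. residual_density N N' (fst p) (snd p)"
  have D1[measurable]: "?D1 \<in> borel_measurable (N \<Otimes>\<^sub>M N')" unfolding diagonal_density_def by measurable
  have D2[measurable]: "?D2 \<in> borel_measurable (N \<Otimes>\<^sub>M N')" unfolding residual_density_def by measurable
  let ?R = "total_excess N N'"
  let ?left = "\<lambda>K K'. \<integral>\<^sup>+k. ennreal (w k) * ennreal (leftover K K' k) \<partial>count_space UNIV"
  have mass1: "(\<integral>\<^sup>+p. ?D1 p \<partial>(N \<Otimes>\<^sub>M N')) \<le> 1"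
  proof -
    have "(\<integral>\<^sup>+p. ?D1 p \<partial>(N \<Otimes>\<^sub>M N')) \<le> (\<integral>\<^sup>+p. ?D1 p + ?D2 p \<partial>(N \<Otimes>\<^sub>M N'))"
      by (intro nn_integral_mono) simp
    also have "\<dots> = (\<integral>\<^sup>+x. \<integral>\<^sup>+y. diagonal_density N N' x y + residual_density N N' x y \<partial>N' \<partial>N)"
      by (subst N'.nn_integral_fst[symmetric]) auto
    also have "\<dots> = (\<integral>\<^sup>+x. 1 \<partial>N)"
      using transport_marginal[OF N N'] by (intro nn_integral_cong_AE) (auto elim!: eventually_mono)
    finally show ?thesis by (simp add: N.emeasure_space_1)
  qed
  have Rle: "?R / ?R \<le> 1"
  proof (cases "?R = 0")
    case False
    have "?R \<noteq> \<top>" using total_excess_le_1[OF N, of N'] by (auto simp: top_unique)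
    then have "?R / ?R = 1" using False by (intro ennreal_divide_self) (auto simp: less_top)
    then show ?thesis by simp
  qed simp
  have weighted: "(\<integral>\<^sup>+x. ennreal (w (f x)) * ennreal (excess K K' (f x)) \<partial>K) = ?left K K'"
    if K: "prob_space K" "sets K = sets borel" for K K'
  proof -
    interpret K: prob_space K by fact
    have "(\<integral>\<^sup>+x. ennreal (w (f x)) * ennreal (excess K K' (f x)) \<partial>K) = (\<integral>\<^sup>+k. (ennreal (w k) * ennreal (excess K K' k)) * ennreal (measure K {x. f x = k}) \<partial>count_space UNIV)"
      by (rule nn_integral_countable_partition_mass[OF f K.finite_measure_axioms K(2)])
    then show ?thesis by (simp add: cell_mass_def[symmetric] mult.assoc cell_mass_times_excess)
  qed
  have "(\<integral>\<^sup>+p. c (fst p) (snd p) \<partial>density (N \<Otimes>\<^sub>M N') (\<lambda>p. ?D1 p + ?D2 p)) = (\<integral>\<^sup>+p. (?D1 p + ?D2 p) * c (fst p) (snd p) \<partial>(N \<Otimes>\<^sub>M N'))"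
    by (intro nn_integral_density) measurable
  also have "\<dots> \<le> (\<integral>\<^sup>+p. ennreal d * ?D1 p + (ennreal (w (f (fst p))) + ennreal (w (f (snd p)))) * ?D2 p \<partial>(N \<Otimes>\<^sub>M N'))"
  proof (rule nn_integral_mono)
    fix p
    have "?D1 p * c (fst p) (snd p) \<le> ?D1 p * ennreal d"
      by (cases "f (fst p) = f (snd p)") (auto simp: diagonal_density_def intro!: mult_left_mono diag)
    moreover have "?D2 p * c (fst p) (snd p) \<le> ?D2 p * (ennreal (w (f (fst p))) + ennreal (w (f (snd p))))"
      by (intro mult_left_mono off) simp
    ultimately show "(?D1 p + ?D2 p) * c (fst p) (snd p) \<le> ennreal d * ?D1 p + (ennreal (w (f (fst p))) + ennreal (w (f (snd p)))) * ?D2 p"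
      by (simp add: distrib_right add_mono mult.commute[of "?D1 p"] mult.commute[of "?D2 p"])
  qed
  also have "\<dots> = ennreal d * (\<integral>\<^sup>+p. ?D1 p \<partial>(N \<Otimes>\<^sub>M N')) + ((\<integral>\<^sup>+p. ennreal (w (f (fst p))) * ?D2 p \<partial>(N \<Otimes>\<^sub>M N')) + (\<integral>\<^sup>+p. ennreal (w (f (snd p))) * ?D2 p \<partial>(N \<Otimes>\<^sub>M N')))"
    by (simp add: distrib_right nn_integral_add nn_integral_cmult)
  also have "\<dots> \<le> ennreal d * 1 + (?left N N'
       + ?left N' N)"
  proof (intro add_mono mult_left_mono mass1)
    have "(\<integral>\<^sup>+p. ennreal (w (f (fst p))) * ?D2 p \<partial>(N \<Otimes>\<^sub>M N')) = (\<integral>\<^sup>+x. \<integral>\<^sup>+y. (ennreal (w (f x)) * ennreal (excess N N' (f x)) / ?R) * ennreal (excess N' N (f y)) \<partial>N' \<partial>N)"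
      by (subst N'.nn_integral_fst[symmetric]) (auto simp: residual_density_def divide_ennreal_def mult_ac)
    also have "\<dots> = (\<integral>\<^sup>+x. (ennreal (w (f x)) * ennreal (excess N N' (f x)) / ?R) * total_excess N' N \<partial>N)"
      unfolding total_excess_def[of N' N] by (intro nn_integral_cong nn_integral_cmult) measurable
    also have "\<dots> = (\<integral>\<^sup>+x. (ennreal (w (f x)) * ennreal (excess N N' (f x))) * (?R / ?R) \<partial>N)"
      unfolding total_excess_sym[OF N' N] by (simp add: divide_ennreal_def mult_ac)
    also have "\<dots> \<le> (\<integral>\<^sup>+x. (ennreal (w (f x)) * ennreal (excess N N' (f x))) * 1 \<partial>N)"
      by (intro nn_integral_mono mult_left_mono Rle) simp
    also have "\<dots> = ?left N N'"
      using weighted[OF N] by simp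
    finally show "(\<integral>\<^sup>+p. ennreal (w (f (fst p))) * ?D2 p \<partial>(N \<Otimes>\<^sub>M N')) \<le> \<dots>" .
    have "(\<integral>\<^sup>+p. ennreal (w (f (snd p))) * ?D2 p \<partial>(N \<Otimes>\<^sub>M N')) = (\<integral>\<^sup>+y. \<integral>\<^sup>+x. (ennreal (w (f y)) * ennreal (excess N' N (f y)) / ?R) * ennreal (excess N N' (f x)) \<partial>N \<partial>N')"
      by (subst P.nn_integral_snd[symmetric]) (auto simp: residual_density_def divide_ennreal_def mult_ac)
    also have "\<dots> = (\<integral>\<^sup>+y. (ennreal (w (f y)) * ennreal (excess N' N (f y)) / ?R) * ?R \<partial>N')"
      unfolding total_excess_def[of N N'] by (intro nn_integral_cong nn_integral_cmult) measurable
    also have "\<dots> = (\<integral>\<^sup>+y. (ennreal (w (f y)) * ennreal (excess N' N (f y))) * (?R / ?R) \<partial>N')"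
      by (simp add: divide_ennreal_def mult_ac)
    also have "\<dots> \<le> (\<integral>\<^sup>+y. (ennreal (w (f y)) * ennreal (excess N' N (f y))) * 1 \<partial>N')"
      by (intro nn_integral_mono mult_left_mono Rle) simp
    also have "\<dots> = ?left N' N"
      using weighted[OF N'] by simp
    finally show "(\<integral>\<^sup>+p. ennreal (w (f (snd p))) * ?D2 p \<partial>(N \<Otimes>\<^sub>M N')) \<le> \<dots>" .
  qed simp
  also have "\<dots> = ennreal d + (\<integral>\<^sup>+k. ennreal (w k) * ennreal (leftover N N' k) + ennreal (w k) * ennreal (leftover N' N k) \<partial>count_space UNIV)"
    by (subst nn_integral_add) auto
  also have "\<dots> = ennreal d + (\<integral>\<^sup>+k. ennreal (w k * \<bar>cell_mass N k - cell_mass N' k\<bar>) \<partial>count_space UNIV)"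
  proof (intro arg_cong2[where f="(+)"] refl nn_integral_cong)
    fix k
    have "ennreal (w k) * ennreal (leftover N N' k) + ennreal (w k) * ennreal (leftover N' N k)
      = ennreal (w k * (leftover N N' k) + w k * (leftover N' N k))"
      using w[of k] by (subst ennreal_plus) (auto simp: ennreal_mult')
    also have "w k * (leftover N N' k) + w k * (leftover N' N k) = w k * \<bar>cell_mass N k - cell_mass N' k\<bar>"
      by (auto simp: min_def abs_if algebra_simps)
    finally show "ennreal (w k) * ennreal (leftover N N' k) + ennreal (w k) * ennreal (leftover N' N k) = ennreal (w k * \<bar>cell_mass N k - cell_mass N' k\<bar>)" .
  qed
  finally show ?thesis .
qed

end

lemma ennpowr_mono: "a \<le> b \<Longrightarrow> 0 < e \<Longrightarrow> ennpowr a e \<le> ennpowr b e"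
  by (cases a; cases b) (auto simp: ennpowr_def top_unique intro!: ennreal_leI powr_mono2)

lemma abs_diff_powr_le: "\<bar>x - y\<bar> powr p \<le> 2 powr p * \<bar>x\<bar> powr p + 2 powr p * \<bar>y\<bar> powr p" if p: "0 < p" for x y p :: real
proof -
  have "\<bar>x - y\<bar> powr p \<le> (2 * max \<bar>x\<bar> \<bar>y\<bar>) powr p" using p by (intro powr_mono2) auto
  also have "\<dots> = 2 powr p * (max \<bar>x\<bar> \<bar>y\<bar>) powr p" by (simp add: powr_mult)
  also have "\<dots> \<le> 2 powr p * (\<bar>x\<bar> powr p + \<bar>y\<bar> powr p)" by (intro mult_left_mono) (auto simp: max_def)
  finally show ?thesis by (simp add: distrib_left)
qed

lemma wasserstein_le_cells:
  fixes d p :: real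
  assumes N: "prob_space N" "sets N = sets borel" and N': "prob_space N'" "sets N' = sets borel"
    and d: "0 < d" and p: "0 < p"
  defines "cell \<equiv> \<lambda>k::int. {x::real. \<lfloor>x / d\<rfloor> = k}"
  shows "ennpowr (wasserstein p N N') p \<le> ennreal (d powr p)
    + (\<integral>\<^sup>+k. ennreal (2 powr p * (\<bar>real_of_int k * d\<bar> + d) powr p * \<bar>measure N (cell k) - measure N' (cell k)\<bar>) \<partial>count_space UNIV)"
proof -
  define f where "f x = \<lfloor>x / d\<rfloor>" for x :: real
  have f: "f \<in> measurable borel (count_space UNIV)" unfolding f_def by measurable
  define w where "w k = 2 powr p * (\<bar>real_of_int k * d\<bar> + d) powr p" for k :: int
  have bounds: "real_of_int (f x) * d \<le> x" "x < real_of_int (f x) * d + d" for x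
  proof -
    have "real_of_int (f x) \<le> x / d" "x / d < real_of_int (f x) + 1" unfolding f_def by linarith+
    then show "real_of_int (f x) * d \<le> x" "x < real_of_int (f x) * d + d" using d by (simp_all add: field_simps)
  qed
  have ab: "\<bar>x\<bar> \<le> \<bar>real_of_int (f x) * d\<bar> + d" for x using bounds[of x] d by linarith
  let ?pi = "transport_plan f N N'"
  have "?pi \<in> couplings N N'" by (rule transport_coupling[OF f N N'])
  then have W: "wasserstein p N N' \<le> ennpowr (\<integral>\<^sup>+(x, y). ennreal (\<bar>x - y\<bar> powr p) \<partial>?pi) (1 / p)"
    unfolding wasserstein_def by (rule INF_lower)
  have cost: "(\<integral>\<^sup>+(x, y). ennreal (\<bar>x - y\<bar> powr p) \<partial>?pi) \<le> ennreal (d powr p) + (\<integral>\<^sup>+k. ennreal (w k * \<bar>cell_mass f N k - cell_mass f N' k\<bar>) \<partial>count_space UNIV)"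
    unfolding case_prod_beta
  proof (rule transport_cost[OF f N N'])
    show "ennreal (\<bar>x - y\<bar> powr p) \<le> ennreal (d powr p)" if "f x = f y" for x y
      using bounds[of x] bounds[of y] that p by (intro ennreal_leI powr_mono2) auto
    show "ennreal (\<bar>x - y\<bar> powr p) \<le> ennreal (w (f x)) + ennreal (w (f y))" for x y
    proof -
      have "\<bar>x - y\<bar> powr p \<le> 2 powr p * \<bar>x\<bar> powr p + 2 powr p * \<bar>y\<bar> powr p" by (rule abs_diff_powr_le[OF p])
      also have "\<dots> \<le> w (f x) + w (f y)"
        unfolding w_def using p ab by (intro add_mono mult_left_mono powr_mono2) auto
      finally show ?thesis by (simp add: ennreal_plus[symmetric] w_def ennreal_leI del: ennreal_plus)
    qed
  qed (auto simp: w_def)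
  have inv: "ennpowr (ennpowr a (1 / p)) p = a" for a
    using p by (cases a) (auto simp: ennpowr_def powr_powr)
  have "ennpowr (wasserstein p N N') p \<le> (\<integral>\<^sup>+(x, y). ennreal (\<bar>x - y\<bar> powr p) \<partial>?pi)"
    using ennpowr_mono[OF W p] unfolding inv .
  note order_trans[OF this cost]
  then show ?thesis by (simp add: cell_mass_def[OF f] f_def cell_def w_def)
qed

section \<open>Convergence rates of the occupation measure\<close>

lemma gaussian_power_integral_finite:
  fixes w q b :: real
  assumes w: "0 < w" and q: "0 < q" and b: "0 \<le> b"
  shows "(\<integral>\<^sup>+x. ennreal ((\<bar>x\<bar> + b) powr q) * ennreal (exp (- x\<^sup>2 / w)) \<partial>lborel) < \<infinity>"
proof -
  have bound: "(\<bar>x\<bar> + b) powr q * exp (- x\<^sup>2 / w) \<le> exp (q * b + q\<^sup>2 * w / 2) * exp (- x\<^sup>2 / (2 * w))" for x :: real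
  proof -
    \<comment> \<open>as \<open>ln z \<le> z\<close>; the linear exponent is then absorbed by completing a square\<close>
    have "(\<bar>x\<bar> + b) powr q \<le> exp (q * (\<bar>x\<bar> + b))"
    proof (cases "\<bar>x\<bar> + b = 0")
      case False
      then have "0 < \<bar>x\<bar> + b" using b by linarith
      then have "ln (\<bar>x\<bar> + b) \<le> \<bar>x\<bar> + b" using ln_le_minus_one[of "\<bar>x\<bar> + b"] by linarith
      then show ?thesis using False q by (simp add: powr_def)
    qed simp
    then have "(\<bar>x\<bar> + b) powr q * exp (- x\<^sup>2 / w) \<le> exp (q * (\<bar>x\<bar> + b)) * exp (- x\<^sup>2 / w)" by (intro mult_right_mono) auto
    also have "\<dots> = exp (q * (\<bar>x\<bar> + b) + - x\<^sup>2 / w)" by (rule exp_add[symmetric])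
    also have "\<dots> \<le> exp ((q * b + q\<^sup>2 * w / 2) + - x\<^sup>2 / (2 * w))"
    proof (subst exp_le_cancel_iff)
      have "0 \<le> (\<bar>x\<bar> - q * w)\<^sup>2 / (2 * w)" using w by simp
      also have "(\<bar>x\<bar> - q * w)\<^sup>2 / (2 * w) = x\<^sup>2 / (2 * w) - q * \<bar>x\<bar> + q\<^sup>2 * w / 2"
        using w by (simp add: power2_diff field_simps power2_eq_square)
      finally have "q * \<bar>x\<bar> \<le> x\<^sup>2 / (2 * w) + q\<^sup>2 * w / 2" by simp
      moreover have "x\<^sup>2 / w = 2 * (x\<^sup>2 / (2 * w))" by simp
      ultimately show "q * (\<bar>x\<bar> + b) + - x\<^sup>2 / w \<le> (q * b + q\<^sup>2 * w / 2) + - x\<^sup>2 / (2 * w)"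
        by (simp add: distrib_left)
    qed
    also have "\<dots> = exp (q * b + q\<^sup>2 * w / 2) * exp (- x\<^sup>2 / (2 * w))" by (rule exp_add)
    finally show ?thesis .
  qed
  have "(\<integral>\<^sup>+x. ennreal ((\<bar>x\<bar> + b) powr q) * ennreal (exp (- x\<^sup>2 / w)) \<partial>lborel)
    \<le> (\<integral>\<^sup>+x. ennreal (exp (q * b + q\<^sup>2 * w / 2)) * (ennreal (exp (- x\<^sup>2 / (2 * w))) * indicator UNIV x) \<partial>lborel)"
    using bound by (intro nn_integral_mono) (simp add: ennreal_mult'[symmetric] ennreal_leI)
  also have "\<dots> = ennreal (exp (q * b + q\<^sup>2 * w / 2)) * gauss_mass (2 * w) UNIV"
    unfolding gauss_mass_def by (rule nn_integral_cmult) measurable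
  also have "\<dots> < \<infinity>" using gauss_mass_finite[of "2 * w" UNIV] w by (simp add: ennreal_mult_less_top)
  finally show ?thesis .
qed

text \<open>Within a cell of length \<open>d\<close> the weight varies by a shift of at most \<open>2 d\<close> in \<open>\<bar>x\<bar>\<close>, so the sum is bounded by one
  integral, uniformly in \<open>d \<le> d0\<close>.\<close>

lemma sum_weighted_gauss_mass:
  assumes d: "0 < d" "d \<le> d0" and p: "0 < p"
  shows "(\<integral>\<^sup>+k. ennreal ((\<bar>real_of_int k * d\<bar> + d) powr p) * gauss_mass w {x. \<lfloor>x / d\<rfloor> = k} \<partial>count_space UNIV)
    \<le> (\<integral>\<^sup>+x. ennreal ((\<bar>x\<bar> + 2 * d0) powr p) * ennreal (exp (- x\<^sup>2 / w)) \<partial>lborel)"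
proof -
  have "(\<integral>\<^sup>+k. ennreal ((\<bar>real_of_int k * d\<bar> + d) powr p) * gauss_mass w {x. \<lfloor>x / d\<rfloor> = k} \<partial>count_space UNIV)
    = (\<integral>\<^sup>+x. ennreal ((\<bar>real_of_int \<lfloor>x / d\<rfloor> * d\<bar> + d) powr p) * ennreal (exp (- x\<^sup>2 / w)) \<partial>lborel)"
    using nn_integral_countable_partition[of "\<lambda>x::real. \<lfloor>x / d\<rfloor>" lborel "\<lambda>x. ennreal (exp (- x\<^sup>2 / w))" "\<lambda>k. ennreal ((\<bar>real_of_int k * d\<bar> + d) powr p)"]
    by (simp add: gauss_mass_def mult.commute[of "indicator _ _"])
  also have "\<dots> \<le> (\<integral>\<^sup>+x. ennreal ((\<bar>x\<bar> + 2 * d0) powr p) * ennreal (exp (- x\<^sup>2 / w)) \<partial>lborel)"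
  proof (intro nn_integral_mono mult_right_mono ennreal_leI powr_mono2)
    fix x :: real
    have fl: "real_of_int \<lfloor>x / d\<rfloor> \<le> x / d" "x / d < real_of_int \<lfloor>x / d\<rfloor> + 1" by linarith+
    from fl(1) have "real_of_int \<lfloor>x / d\<rfloor> * d \<le> x" by (simp only: pos_le_divide_eq[OF d(1)])
    moreover from fl(2) have "x < real_of_int \<lfloor>x / d\<rfloor> * d + d"
      by (simp only: pos_divide_less_eq[OF d(1)] distrib_right mult_1_left)
    ultimately show "\<bar>real_of_int \<lfloor>x / d\<rfloor> * d\<bar> + d \<le> \<bar>x\<bar> + 2 * d0" using d by linarith
  qed (use p d in auto)
  finally show ?thesis .
qed

context stationary_fOU
begin

lemma
  assumes w: "\<omega> \<in> space M" and t: "0 < t"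
  shows prob_space_occupation_measure: "prob_space (occupation_measure X t \<omega>)"
    and measure_occupation_measure: "A \<in> sets borel \<Longrightarrow> measure (occupation_measure X t \<omega>) A = occupation_fraction t \<omega> A"
proof -
  interpret T: finite_measure "time_interval t" by (rule finite_measure_time_interval)
  have m: "(\<lambda>s. X s \<omega>) \<in> borel_measurable borel" by (rule borel_measurable_continuous_onI[OF X_cont[OF w]])
  note [measurable] = measurable_time_intervalI[OF m, of t]
  have "emeasure (occupation_measure X t \<omega>) UNIV = ennreal (1 / t) * emeasure (time_interval t) (space (time_interval t))"
    unfolding occupation_measure_def by (simp add: emeasure_distr)
  also have "\<dots> = 1" using t emeasure_time_interval[of t] by (simp add: ennreal_mult'[symmetric])
  finally show "prob_space (occupation_measure X t \<omega>)"
    by (intro prob_spaceI) (simp add: occupation_measure_def space_scale_measure)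
  assume A[measurable]: "A \<in> sets borel"
  have "measure (distr (time_interval t) borel (\<lambda>s. X s \<omega>)) A = (LINT x|distr (time_interval t) borel (\<lambda>s. X s \<omega>). indicator A x)"
    by simp
  also have "\<dots> = (LINT s|time_interval t. indicator A (X s \<omega>))" by (subst integral_distr) auto
  finally have e: "measure (distr (time_interval t) borel (\<lambda>s. X s \<omega>)) A = (LINT s|time_interval t. indicator A (X s \<omega>))" .
  have "measure (occupation_measure X t \<omega>) A = enn2real (ennreal (1 / t)) * measure (distr (time_interval t) borel (\<lambda>s. X s \<omega>)) A"
    unfolding occupation_measure_def measure_def by (simp add: enn2real_mult)
  then show "measure (occupation_measure X t \<omega>) A = occupation_fraction t \<omega> A" using t by (simp add: e occupation_fraction_def)
qed

lemma occupation_fraction_measurable: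
  assumes [measurable]: "A \<in> sets borel"
  shows "(\<lambda>\<omega>. occupation_fraction t \<omega> A) \<in> borel_measurable M"
proof -
  have "(\<lambda>\<omega>. LINT s|time_interval t. indicator A (X s \<omega>) :: real) \<in> borel_measurable M"
  proof (rule path_integral_measurable)
    have "(\<lambda>p. indicator A (X (fst p) (snd p)) :: real) \<in> borel_measurable (borel \<Otimes>\<^sub>M M)"
      using measurable_compose[OF X_joint_measurable borel_measurable_indicator[OF assms]] by (simp add: case_prod_beta)
    then show "(\<lambda>(s, \<omega>). indicator A (X s \<omega>) :: real) \<in> borel_measurable (borel \<Otimes>\<^sub>M M)"
      by (simp add: case_prod_beta)
  qed
  then show ?thesis unfolding occupation_fraction_def by (rule borel_measurable_times[OF borel_measurable_const])
qed

lemma occupation_deviation_bound: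
  assumes t0: "0 < t0"
  shows "\<exists>C0>0. \<forall>t\<ge>t0. \<forall>A\<in>sets borel.
    (\<integral>\<^sup>+\<omega>. ennreal \<bar>occupation_fraction t \<omega> A - nu A\<bar> \<partial>M) \<le> ennreal (C0 * min (nu A) (sqrt (nu A) / t powr rate_exponent))"
proof -
  obtain G where G: "G \<in> borel_measurable borel"
      "\<And>A s u. A \<in> sets borel \<Longrightarrow> 0 \<le> s \<Longrightarrow> 0 \<le> u \<Longrightarrow> s \<noteq> u \<Longrightarrow> ennreal \<bar>cov A s u\<bar> \<le> G \<bar>s - u\<bar> * ennreal (nu A)"
      "\<And>A s u. A \<in> sets borel \<Longrightarrow> 0 \<le> s \<Longrightarrow> 0 \<le> u \<Longrightarrow> s \<noteq> u \<Longrightarrow> ennreal \<bar>cov A s u\<bar> \<le> G \<bar>s - u\<bar> * (gauss_mass (4 * var) A)\<^sup>2"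
      "\<And>t0. 0 < t0 \<Longrightarrow> \<exists>L>0. \<forall>t\<ge>t0. (\<integral>\<^sup>+x. G x * indicator {0..t} x \<partial>lborel) \<le> ennreal (L * t powr (1 - 2 * rate_exponent))"
    by (rule covariance_majorant, rule that)
  from G(4)[OF t0] obtain L where L: "0 < L"
    "\<And>t. t \<ge> t0 \<Longrightarrow> (\<integral>\<^sup>+x. G x * indicator {0..t} x \<partial>lborel) \<le> ennreal (L * t powr (1 - 2 * rate_exponent))" by blast
  define C0 where "C0 = max 2 (sqrt (2 * L))"
  have "(\<integral>\<^sup>+\<omega>. ennreal \<bar>occupation_fraction t \<omega> A - nu A\<bar> \<partial>M) \<le> ennreal (C0 * min (nu A) (sqrt (nu A) / t powr rate_exponent))"
    if t: "t \<ge> t0" and A: "A \<in> sets borel" for t A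
  proof -
    have tp: "0 < t" using t t0 by simp
    have "(\<integral>\<^sup>+\<omega>. ennreal \<bar>occupation_fraction t \<omega> A - nu A\<bar> \<partial>M) \<le> ennreal (2 * nu A)" by (rule expectation_occ_le[OF tp A])
    also have "\<dots> \<le> ennreal (C0 * nu A)" by (intro ennreal_leI mult_right_mono nu_nonneg) (simp add: C0_def)
    finally have 1: "(\<integral>\<^sup>+\<omega>. ennreal \<bar>occupation_fraction t \<omega> A - nu A\<bar> \<partial>M) \<le> ennreal (C0 * nu A)" .
    have "(\<integral>\<^sup>+\<omega>. ennreal \<bar>occupation_fraction t \<omega> A - nu A\<bar> \<partial>M) \<le> ennreal (sqrt (2 * L) * t powr (- rate_exponent) * sqrt (nu A))"
      by (rule occupation_fraction_deviation[OF G(1) tp A G(2)[OF A] nu_nonneg less_imp_le[OF L(1)] L(2)[OF t]])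
    also have "\<dots> \<le> ennreal (C0 * (sqrt (nu A) / t powr rate_exponent))"
    proof (rule ennreal_leI)
      have "sqrt (2 * L) * (sqrt (nu A) / t powr rate_exponent) \<le> C0 * (sqrt (nu A) / t powr rate_exponent)"
        by (intro mult_right_mono) (auto simp: C0_def nu_nonneg)
      then show "sqrt (2 * L) * t powr (- rate_exponent) * sqrt (nu A) \<le> C0 * (sqrt (nu A) / t powr rate_exponent)"
        by (simp add: powr_minus divide_inverse mult_ac)
    qed
    finally have 2: "(\<integral>\<^sup>+\<omega>. ennreal \<bar>occupation_fraction t \<omega> A - nu A\<bar> \<partial>M) \<le> ennreal (C0 * (sqrt (nu A) / t powr rate_exponent))" .
    show ?thesis using 1 2 by (simp add: min_def)
  qed
  moreover have "0 < C0" by (simp add: C0_def)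
  ultimately show ?thesis by blast
qed

lemma stationary_moment_finite:
  assumes q: "0 < q"
  shows "(\<integral>\<^sup>+\<xi>. ennreal (\<bar>\<xi>\<bar> powr q) \<partial>distr M borel (X 0)) < \<infinity>"
proof -
  have "(\<integral>\<^sup>+\<xi>. ennreal (\<bar>\<xi>\<bar> powr q) \<partial>distr M borel (X 0)) = (\<integral>\<^sup>+x. ennreal (normal_density 0 (sqrt var) x) * ennreal (\<bar>x\<bar> powr q) \<partial>lborel)"
    unfolding X_law[OF order_refl] using var_pos by (simp add: gaussian_law_def nn_integral_density)
  also have "\<dots> = (\<integral>\<^sup>+x. ennreal (1 / sqrt (2 * pi * var)) * (ennreal ((\<bar>x\<bar> + 0) powr q) * ennreal (exp (- x\<^sup>2 / (2 * var)))) \<partial>lborel)"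
    using var_pos by (intro nn_integral_cong) (simp add: normal_density_def ennreal_mult'[symmetric] mult_ac)
  also have "\<dots> = ennreal (1 / sqrt (2 * pi * var)) * (\<integral>\<^sup>+x. ennreal ((\<bar>x\<bar> + 0) powr q) * ennreal (exp (- x\<^sup>2 / (2 * var))) \<partial>lborel)"
    by (rule nn_integral_cmult) measurable
  also have "\<dots> < \<infinity>"
    using gaussian_power_integral_finite[of "2 * var" q 0] q var_pos by (simp add: ennreal_mult_less_top)
  finally show ?thesis .
qed

text \<open>The cell length \<open>d = t powr (- rate_exponent / p)\<close> makes the cost of moving mass inside cells equal to
  \<open>t powr (- rate_exponent)\<close>, the
  order of the cost of the leftover mass.\<close>

lemma wasserstein_rate:
  assumes p: "0 < p" and t0: "0 < t0"
  shows "\<exists>C>0. \<forall>t\<ge>t0. Lp_norm M p (\<lambda>\<omega>. wasserstein p (occupation_measure X t \<omega>) (distr M borel (X 0)))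
    \<le> ennreal (C * t powr (- (1 / p) * rate_exponent))"
proof -
  obtain G where G: "G \<in> borel_measurable borel"
      "\<And>A s u. A \<in> sets borel \<Longrightarrow> 0 \<le> s \<Longrightarrow> 0 \<le> u \<Longrightarrow> s \<noteq> u \<Longrightarrow> ennreal \<bar>cov A s u\<bar> \<le> G \<bar>s - u\<bar> * ennreal (nu A)"
      "\<And>A s u. A \<in> sets borel \<Longrightarrow> 0 \<le> s \<Longrightarrow> 0 \<le> u \<Longrightarrow> s \<noteq> u \<Longrightarrow> ennreal \<bar>cov A s u\<bar> \<le> G \<bar>s - u\<bar> * (gauss_mass (4 * var) A)\<^sup>2"
      "\<And>t0. 0 < t0 \<Longrightarrow> \<exists>L>0. \<forall>t\<ge>t0. (\<integral>\<^sup>+x. G x * indicator {0..t} x \<partial>lborel) \<le> ennreal (L * t powr (1 - 2 * rate_exponent))"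
    by (rule covariance_majorant, rule that)
  from G(4)[OF t0] obtain L where L: "0 < L"
    "\<And>t. t \<ge> t0 \<Longrightarrow> (\<integral>\<^sup>+x. G x * indicator {0..t} x \<partial>lborel) \<le> ennreal (L * t powr (1 - 2 * rate_exponent))" by blast
  define d0 where "d0 = t0 powr (- rate_exponent / p)"
  have d0: "0 < d0" using t0 by (simp add: d0_def)
  define I where "I = (\<integral>\<^sup>+x. ennreal ((\<bar>x\<bar> + 2 * d0) powr p) * ennreal (exp (- x\<^sup>2 / (4 * var))) \<partial>lborel)"
  have "I < \<infinity>" unfolding I_def using var_pos d0 p by (intro gaussian_power_integral_finite) auto
  then obtain J where J: "0 \<le> J" "I = ennreal J" by (cases I) auto
  define K where "K = 1 + 2 powr p * sqrt (2 * L) * J"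
  have K: "0 < K" using J L by (simp add: K_def add_pos_nonneg)
  have main: "Lp_norm M p (\<lambda>\<omega>. wasserstein p (occupation_measure X t \<omega>) (distr M borel (X 0))) \<le> ennreal (K powr (1 / p) * t powr (- (1 / p) * rate_exponent))"
    if t: "t \<ge> t0" for t
  proof -
    have tp: "0 < t" using t t0 by simp
    define d where "d = t powr (- rate_exponent / p)"
    have d: "0 < d" "d \<le> d0" using tp t t0 rate_exponent_pos p unfolding d_def d0_def by (auto intro!: powr_mono2')
    have dp: "d powr p = t powr (- rate_exponent)" using p by (simp add: d_def powr_powr)
    define cell where "cell k = {x::real. \<lfloor>x / d\<rfloor> = k}" for k :: int
    have cell[measurable]: "cell k \<in> sets borel" for k unfolding cell_def by measurable
    define W where "W k = (\<bar>real_of_int k * d\<bar> + d) powr p" for k :: int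
    let ?W = "\<lambda>\<omega>. wasserstein p (occupation_measure X t \<omega>) (distr M borel (X 0))" and ?D = "\<lambda>k \<omega>. ennreal \<bar>occupation_fraction t \<omega> (cell k) - nu (cell k)\<bar>"
    let ?S = "\<lambda>\<omega>. \<integral>\<^sup>+k. ennreal (2 powr p * W k) * ?D k \<omega> \<partial>count_space UNIV"
    have dev: "(\<integral>\<^sup>+\<omega>. ?D k \<omega> \<partial>M) \<le> ennreal (sqrt (2 * L) * t powr (- rate_exponent)) * gauss_mass (4 * var) (cell k)" for k
    proof -
      obtain g where g: "0 \<le> g" "gauss_mass (4 * var) (cell k) = ennreal g"
        using gauss_mass_finite[of "4 * var" "cell k"] var_pos by (cases "gauss_mass (4 * var) (cell k)") auto
      have c: "ennreal \<bar>cov (cell k) s u\<bar> \<le> G \<bar>s - u\<bar> * ennreal (g\<^sup>2)" if "0 \<le> s" "0 \<le> u" "s \<noteq> u" for s u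
        using G(3)[OF cell that, of k] g by (simp add: ennreal_power)
      have "(\<integral>\<^sup>+\<omega>. ?D k \<omega> \<partial>M) \<le> ennreal (sqrt (2 * L) * t powr (- rate_exponent) * sqrt (g\<^sup>2))"
        by (rule occupation_fraction_deviation[OF G(1) tp cell c zero_le_power2 less_imp_le[OF L(1)] L(2)[OF t]])
      then show ?thesis using g by (simp add: ennreal_mult'')
    qed
    have "(\<integral>\<^sup>+\<omega>. ennpowr (?W \<omega>) p \<partial>M)
      \<le> (\<integral>\<^sup>+\<omega>. ennreal (d powr p) + ?S \<omega> \<partial>M)"
    proof (rule nn_integral_mono)
      fix \<omega> assume w: "\<omega> \<in> space M"
      have "prob_space (distr M borel (X 0))" by (rule prob_space_distr) simp
      from wasserstein_le_cells[OF prob_space_occupation_measure[OF w tp] _ this _ d(1) p]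
      show "ennpowr (?W \<omega>) p
        \<le> ennreal (d powr p) + ?S \<omega>"
        by (simp add: occupation_measure_def[of X t \<omega>] cell_def[symmetric] W_def[symmetric] nu_def[symmetric] ennreal_mult'')
          (simp add: occupation_measure_def[of X t \<omega>, symmetric] measure_occupation_measure[OF w tp cell])
    qed
    also have "\<dots> = ennreal (d powr p) + (\<integral>\<^sup>+\<omega>. ?S \<omega> \<partial>M)"
    proof (subst nn_integral_add)
      note [measurable] = occupation_fraction_measurable[OF cell]
      show "(\<lambda>\<omega>. \<integral>\<^sup>+k. ennreal (2 powr p * W k) * ?D k \<omega> \<partial>count_space UNIV) \<in> borel_measurable M"
      proof -
        interpret C: sigma_finite_measure "count_space (UNIV :: int set)" by (rule sigma_finite_measure_count_space)
        have "(\<lambda>q. ennreal (2 powr p * W (snd q)) * ?D (snd q) (fst q))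
          \<in> borel_measurable (M \<Otimes>\<^sub>M count_space UNIV)"
        proof (rule measurable_compose_countable[where g=snd and f="\<lambda>k q. ennreal (2 powr p * W k) * ?D k (fst q)"])
          show "(\<lambda>q. ennreal (2 powr p * W k) * ?D k (fst q)) \<in> borel_measurable (M \<Otimes>\<^sub>M count_space UNIV)" for k :: int
            by measurable
        qed (rule measurable_snd)
        then show ?thesis by (intro C.borel_measurable_nn_integral) (simp add: case_prod_beta)
      qed
    qed (simp_all add: emeasure_space_1)
    also have "(\<integral>\<^sup>+\<omega>. ?S \<omega> \<partial>M)
      = (\<integral>\<^sup>+k. (\<integral>\<^sup>+\<omega>. ennreal (2 powr p * W k) * ?D k \<omega> \<partial>M) \<partial>count_space UNIV)"
    proof (rule nn_integral_count_space_nn_integral)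
      note [measurable] = occupation_fraction_measurable[OF cell]
      show "(\<lambda>\<omega>. ennreal (2 powr p * W k) * ?D k \<omega>) \<in> borel_measurable M" for k by measurable
    qed simp
    also have "\<dots> \<le> (\<integral>\<^sup>+k. ennreal (2 powr p * sqrt (2 * L) * t powr (- rate_exponent)) * (ennreal (W k) * gauss_mass (4 * var) (cell k)) \<partial>count_space UNIV)"
    proof (rule nn_integral_mono)
      fix k
      note [measurable] = occupation_fraction_measurable[OF cell]
      have "(\<integral>\<^sup>+\<omega>. ennreal (2 powr p * W k) * ?D k \<omega> \<partial>M) = ennreal (2 powr p * W k) * (\<integral>\<^sup>+\<omega>. ?D k \<omega> \<partial>M)"
        by (rule nn_integral_cmult) measurable
      also have "\<dots> \<le> ennreal (2 powr p * W k) * (ennreal (sqrt (2 * L) * t powr (- rate_exponent)) * gauss_mass (4 * var) (cell k))"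
        by (intro mult_left_mono dev) simp
      also have "\<dots> = ennreal (2 powr p * sqrt (2 * L) * t powr (- rate_exponent)) * (ennreal (W k) * gauss_mass (4 * var) (cell k))"
        using L by (simp add: ennreal_mult W_def mult_ac)
      finally show "(\<integral>\<^sup>+\<omega>. ennreal (2 powr p * W k) * ?D k \<omega> \<partial>M) \<le> \<dots>" .
    qed
    also have "\<dots> = ennreal (2 powr p * sqrt (2 * L) * t powr (- rate_exponent)) * (\<integral>\<^sup>+k. ennreal (W k) * gauss_mass (4 * var) (cell k) \<partial>count_space UNIV)"
      by (rule nn_integral_cmult) simp
    also have "\<dots> \<le> ennreal (2 powr p * sqrt (2 * L) * t powr (- rate_exponent)) * I"
      unfolding I_def W_def cell_def by (intro mult_left_mono sum_weighted_gauss_mass d p) simp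
    also have "\<dots> = ennreal (2 powr p * sqrt (2 * L) * t powr (- rate_exponent) * J)"
      using J by (simp add: ennreal_mult'')
    finally have "(\<integral>\<^sup>+\<omega>. ennpowr (?W \<omega>) p \<partial>M)
      \<le> ennreal (d powr p) + ennreal (2 powr p * sqrt (2 * L) * t powr (- rate_exponent) * J)" by simp
    also have "\<dots> = ennreal (K * t powr (- rate_exponent))"
    proof -
      have "K * t powr (- rate_exponent) = t powr (- rate_exponent) + 2 powr p * sqrt (2 * L) * t powr (- rate_exponent) * J"
        by (simp add: K_def algebra_simps)
      then show ?thesis unfolding dp using J L by (simp only:) (rule ennreal_plus[symmetric]; simp)
    qed
    finally have fin: "(\<integral>\<^sup>+\<omega>. ennpowr (?W \<omega>) p \<partial>M) \<le> ennreal (K * t powr (- rate_exponent))" .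
    have "Lp_norm M p ?W \<le> ennpowr (ennreal (K * t powr (- rate_exponent))) (1 / p)"
      unfolding Lp_norm_def using p by (intro ennpowr_mono fin) simp
    also have "\<dots> = ennreal (K powr (1 / p) * t powr (- (1 / p) * rate_exponent))"
      using K by (simp add: ennpowr_def powr_mult powr_powr)
    finally show ?thesis .
  qed
  then show ?thesis using K by (intro exI[of _ "K powr (1 / p)"]) auto
qed

end

lemma stationary_pair_law:
  assumes "stationary_process M Y" and s: "0 \<le> s" and t: "0 \<le> t" and h: "0 \<le> h"
  shows "distr M (borel \<Otimes>\<^sub>M borel) (\<lambda>\<omega>. (Y (s + h) \<omega>, Y (t + h) \<omega>)) = distr M (borel \<Otimes>\<^sub>M borel) (\<lambda>\<omega>. (Y s \<omega>, Y t \<omega>))"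
proof -
  let ?J = "{s, t}"
  have Ym[measurable]: "Y u \<in> borel_measurable M" if "0 \<le> u" for u using assms(1) that by (simp add: stationary_process_def)
  have g: "(\<lambda>x. (x s, x t)) \<in> measurable (Pi\<^sub>M ?J (\<lambda>_. borel :: real measure)) (borel \<Otimes>\<^sub>M borel)"
    by (intro measurable_Pair measurable_component_singleton) auto
  have eq: "distr M (Pi\<^sub>M ?J (\<lambda>_. borel)) (\<lambda>\<omega>. \<lambda>u\<in>?J. Y (u + h) \<omega>) = distr M (Pi\<^sub>M ?J (\<lambda>_. borel)) (\<lambda>\<omega>. \<lambda>u\<in>?J. Y u \<omega>)"
    using conjunct2[OF assms(1)[unfolded stationary_process_def], rule_format, of ?J h] s t h by simp
  have push: "distr (distr M (Pi\<^sub>M ?J (\<lambda>_. borel)) (\<lambda>\<omega>. \<lambda>u\<in>?J. Y (u + k) \<omega>)) (borel \<Otimes>\<^sub>M borel) (\<lambda>x. (x s, x t))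
     = distr M (borel \<Otimes>\<^sub>M borel) (\<lambda>\<omega>. (Y (s + k) \<omega>, Y (t + k) \<omega>))" if k: "0 \<le> k" for k
  proof -
    have "(\<lambda>\<omega>. \<lambda>u\<in>?J. Y (u + k) \<omega>) \<in> measurable M (Pi\<^sub>M ?J (\<lambda>_. borel))"
      by (intro measurable_restrict Ym) (use s t k in auto)
    from distr_distr[OF g this] show ?thesis by (simp add: comp_def)
  qed
  show ?thesis using push[OF h] push[OF order_refl] eq by simp
qed

theorem theorem2p18:
  fixes M :: "'a measure" and B Y :: "real \<Rightarrow> 'a \<Rightarrow> real"
    and H lam sig \<gamma> :: real and \<nu> :: "real measure"
  defines "\<nu> \<equiv> distr M borel (Y 0)"
    and "\<gamma> \<equiv> (if H \<le> 1 / 2 then 1 / 2 else 1 - H)"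
  assumes "prob_space M"
    and "0 < H" "H < 1" "0 < lam" "0 < sig"
    and "fractional_brownian_motion M H B"
    and "fractional_OU M lam sig B Y"
    and "stationary_process M Y"
  shows "(\<forall>q>0. \<forall>t0>0. \<exists>C0>0.
        (\<forall>t\<ge>t0. \<forall>A\<in>sets borel.
          (\<integral>\<^sup>+\<omega>. ennreal \<bar>measure (occupation_measure Y t \<omega>) A - measure \<nu> A\<bar> \<partial>M)
            \<le> ennreal (C0 * min (measure \<nu> A) (sqrt (measure \<nu> A) / t powr \<gamma>))) \<and>
        (\<integral>\<^sup>+\<xi>. ennreal (\<bar>\<xi>\<bar> powr q) \<partial>\<nu>) < \<infinity>) \<and>
      (\<forall>p>0. \<forall>t0>0. \<exists>C>0. \<forall>t\<ge>t0.
        Lp_norm M p (\<lambda>\<omega>. wasserstein p (occupation_measure Y t \<omega>) \<nu>)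
          \<le> ennreal (C * t powr (- (1 / p) * min (1 / 2) (1 - H))))"
proof -
  interpret prob_space M by fact
  have Ym: "Y t \<in> borel_measurable M" if "0 \<le> t" for t using \<open>fractional_OU M lam sig B Y\<close> that by (simp add: fractional_OU_def)
  have gp: "gaussian_process M {0..} B" using \<open>fractional_brownian_motion M H B\<close> by (simp add: fractional_brownian_motion_def)
  have Bm: "B t \<in> borel_measurable M" if "0 \<le> t" for t using gp that by (simp add: gaussian_process_def)
  have EB: "expectation (B t) = 0" if "0 \<le> t" for t
    using \<open>fractional_brownian_motion M H B\<close> that by (simp add: fractional_brownian_motion_def)
  have EBB: "expectation (\<lambda>\<omega>. B t \<omega> * B t \<omega>) = t powr (2 * H)" if "0 \<le> t" for t
  proof -
    have "expectation (\<lambda>\<omega>. B t \<omega> * B t \<omega>) = (t powr (2 * H) + t powr (2 * H) - \<bar>t - t\<bar> powr (2 * H)) / 2"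
      using \<open>fractional_brownian_motion M H B\<close> that unfolding fractional_brownian_motion_def by blast
    then show ?thesis by simp
  qed
  \<comment> \<open>off a null set both paths are continuous and the equation holds for all times at once\<close>
  define good where "good \<omega> \<longleftrightarrow> continuous_on {0..} (\<lambda>t. B t \<omega>) \<and> continuous_on {0..} (\<lambda>t. Y t \<omega>) \<and>
    (\<forall>t\<ge>0. Y t \<omega> = Y 0 \<omega> - lam * integral {0..t} (\<lambda>s. Y s \<omega>) + sig * B t \<omega>)" for \<omega>
  have goodD: "continuous_on {0..} (\<lambda>t. B t \<omega>)" "continuous_on {0..} (\<lambda>t. Y t \<omega>)"
      "0 \<le> t \<Longrightarrow> Y t \<omega> = Y 0 \<omega> - lam * integral {0..t} (\<lambda>s. Y s \<omega>) + sig * B t \<omega>" if "good \<omega>" for \<omega> t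
    using that unfolding good_def by blast+
  have "AE \<omega> in M. good \<omega>"
    using \<open>fractional_brownian_motion M H B\<close> \<open>fractional_OU M lam sig B Y\<close>
    unfolding fractional_brownian_motion_def fractional_OU_def good_def by auto
  then obtain N where N: "{\<omega> \<in> space M. \<not> good \<omega>} \<subseteq> N" "emeasure M N = 0" "N \<in> sets M" by (rule AE_E)
  have AEN: "AE \<omega> in M. \<omega> \<notin> N" using N by (intro AE_not_in) (auto simp: null_sets_def)
  define X where "X t \<omega> = (if \<omega> \<in> N then 0 else Y (max 0 t) \<omega>)" for t \<omega>
  define B' where "B' t \<omega> = (if \<omega> \<in> N then 0 else B (max 0 t) \<omega>)" for t \<omega>
  have Xm[measurable]: "X t \<in> borel_measurable M" for t
    unfolding X_def using N(3) Ym[of "max 0 t"] by (intro measurable_If_set) auto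
  have B'm[measurable]: "B' t \<in> borel_measurable M" for t
    unfolding B'_def using N(3) Bm[of "max 0 t"] by (intro measurable_If_set) auto
  have XY: "AE \<omega> in M. X t \<omega> = Y t \<omega>" if "0 \<le> t" for t
    using AEN by eventually_elim (use that in \<open>simp add: X_def\<close>)
  have BB: "AE \<omega> in M. \<forall>t\<ge>0. B' t \<omega> = B t \<omega>"
    using AEN by eventually_elim (simp add: B'_def)
  have cont_ext: "continuous_on UNIV (\<lambda>t. h (max 0 t))" if "continuous_on {0..} h" for h :: "real \<Rightarrow> real"
    by (rule continuous_on_compose2[OF that]) (auto intro!: continuous_intros)
  interpret fou: stationary_fOU M X B' H lam sig
  proof
    fix \<omega> assume w: "\<omega> \<in> space M"
    have g: "\<omega> \<notin> N \<Longrightarrow> good \<omega>" using N(1) w by auto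
    show "continuous_on UNIV (\<lambda>t. X t \<omega>)"
      using g[THEN goodD(2), THEN cont_ext] by (cases "\<omega> \<in> N") (simp_all add: X_def)
    show "continuous_on UNIV (\<lambda>t. B' t \<omega>)"
      using g[THEN goodD(1), THEN cont_ext] by (cases "\<omega> \<in> N") (simp_all add: B'_def)
    fix t :: real assume t: "0 \<le> t"
    show "X t \<omega> = X 0 \<omega> - lam * integral {0..t} (\<lambda>s. X s \<omega>) + sig * B' t \<omega>"
    proof (cases "\<omega> \<in> N")
      case True
      then show ?thesis by (simp add: X_def B'_def)
    next
      case False
      have "integral {0..t} (\<lambda>s. X s \<omega>) = integral {0..t} (\<lambda>s. Y s \<omega>)"
        by (rule Henstock_Kurzweil_Integration.integral_cong) (use False in \<open>simp add: X_def\<close>)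
      moreover have "X t \<omega> = Y t \<omega>" "X 0 \<omega> = Y 0 \<omega>" "B' t \<omega> = B t \<omega>" using False t by (simp_all add: X_def B'_def)
      ultimately show ?thesis using goodD(3)[OF g[OF False] t] by simp
    qed
  next
    fix J :: "real set" and c :: "real \<Rightarrow> real" assume J: "finite J" "J \<subseteq> {0..}"
    have AEs: "AE \<omega> in M. (\<Sum>t\<in>J. c t * B' t \<omega>) = (\<Sum>t\<in>J. c t * B t \<omega>)"
      using BB by eventually_elim (use J in \<open>auto intro!: sum.cong\<close>)
    have sm: "(\<lambda>\<omega>. \<Sum>t\<in>J. c t * B t \<omega>) \<in> borel_measurable M"
      using J by (intro borel_measurable_sum borel_measurable_times Bm) auto
    have d: "distr M borel (\<lambda>\<omega>. \<Sum>t\<in>J. c t * B' t \<omega>) = distr M borel (\<lambda>\<omega>. \<Sum>t\<in>J. c t * B t \<omega>)"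
      by (intro distr_cong_AE refl AEs sm) measurable
    obtain m v where mv: "0 \<le> v" "distr M borel (\<lambda>\<omega>. \<Sum>t\<in>J. c t * B t \<omega>) = gaussian_law m v"
      using conjunct2[OF gp[unfolded gaussian_process_def], rule_format, OF J] by blast
    have Bint: "integrable M (B t)" if t: "0 \<le> t" for t
    proof -
      obtain m' v' where "0 \<le> v'" "distr M borel (\<lambda>\<omega>. \<Sum>u\<in>{t}. 1 * B u \<omega>) = gaussian_law m' v'"
        using conjunct2[OF gp[unfolded gaussian_process_def], rule_format, of "{t}" "\<lambda>_. 1"] t by auto
      then have "integrable (distr M borel (B t)) (\<lambda>x. x)" using integrable_gaussian_law[of v' m'] by simp
      then show ?thesis using Bm[OF t] by (subst (asm) integrable_distr_eq) auto
    qed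
    have "m = integral\<^sup>L (distr M borel (\<lambda>\<omega>. \<Sum>t\<in>J. c t * B t \<omega>)) (\<lambda>x. x)"
      unfolding mv(2) using integral_gaussian_law[OF mv(1)] by simp
    also have "\<dots> = expectation (\<lambda>\<omega>. \<Sum>t\<in>J. c t * B t \<omega>)"
      by (rule integral_distr[OF sm]) simp
    also have "\<dots> = (\<Sum>t\<in>J. expectation (\<lambda>\<omega>. c t * B t \<omega>))"
      using J Bint by (intro Bochner_Integration.integral_sum) auto
    also have "\<dots> = 0" using J EB by (intro sum.neutral) auto
    finally have "m = 0" .
    then show "\<exists>v\<ge>0. distr M borel (\<lambda>\<omega>. \<Sum>t\<in>J. c t * B' t \<omega>) = gaussian_law 0 v"
      using d mv by auto
  next
    fix t :: real assume t: "0 \<le> t"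
    have "expectation (\<lambda>\<omega>. (B' t \<omega>)\<^sup>2) = expectation (\<lambda>\<omega>. B t \<omega> * B t \<omega>)"
    proof (rule integral_cong_AE)
      show "AE \<omega> in M. (B' t \<omega>)\<^sup>2 = B t \<omega> * B t \<omega>"
        using BB by eventually_elim (use t in \<open>simp add: power2_eq_square\<close>)
    qed (use Bm[OF t] in auto)
    then show "expectation (\<lambda>\<omega>. (B' t \<omega>)\<^sup>2) = t powr (2 * H)" using EBB[OF t] by simp
  next
    fix s t h :: real assume sth: "0 \<le> s" "0 \<le> t" "0 \<le> h"
    have law: "distr M (borel \<Otimes>\<^sub>M borel) (\<lambda>\<omega>. (X a \<omega>, X b \<omega>)) = distr M (borel \<Otimes>\<^sub>M borel) (\<lambda>\<omega>. (Y a \<omega>, Y b \<omega>))"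
      if ab: "0 \<le> a" "0 \<le> b" for a b
    proof (rule distr_cong_AE)
      show "AE \<omega> in M. (X a \<omega>, X b \<omega>) = (Y a \<omega>, Y b \<omega>)"
        using XY[OF ab(1)] XY[OF ab(2)] by eventually_elim simp
    qed (use Ym ab in auto)
    show "distr M (borel \<Otimes>\<^sub>M borel) (\<lambda>\<omega>. (X (s + h) \<omega>, X (t + h) \<omega>)) = distr M (borel \<Otimes>\<^sub>M borel) (\<lambda>\<omega>. (X s \<omega>, X t \<omega>))"
      using law[of "s + h" "t + h"] law[of s t] stationary_pair_law[OF \<open>stationary_process M Y\<close> sth] sth by simp
  qed (use assms in auto)
  have nu: "\<nu> = distr M borel (X 0)"
    unfolding \<nu>_def using XY[of 0] Ym[of 0] by (intro distr_cong_AE) auto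
  have nuA: "measure \<nu> A = fou.nu A" for A by (simp add: nu fou.nu_def)
  have g1: "\<gamma> = fou.rate_exponent" by (simp add: \<gamma>_def fou.rate_exponent_def)
  have g2: "min (1 / 2) (1 - H) = fou.rate_exponent" by (auto simp: fou.rate_exponent_def min_def)
  have occupation_fraction_eq: "occupation_measure Y t \<omega> = occupation_measure X t \<omega>" if "\<omega> \<notin> N" for t \<omega>
  proof -
    have "distr (restrict_space lborel {0..t}) borel (\<lambda>s. Y s \<omega>) = distr (restrict_space lborel {0..t}) borel (\<lambda>s. X s \<omega>)"
      by (rule distr_cong) (use that in \<open>auto simp: X_def space_restrict_space\<close>)
    then show ?thesis by (simp add: occupation_measure_def)
  qed
  show ?thesis
  proof (intro conjI allI impI)
    fix q t0 :: real assume q: "0 < q" and t0: "0 < t0"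
    obtain C0 where C0: "0 < C0" "\<And>t A. t \<ge> t0 \<Longrightarrow> A \<in> sets borel \<Longrightarrow>
      (\<integral>\<^sup>+\<omega>. ennreal \<bar>fou.occupation_fraction t \<omega> A - fou.nu A\<bar> \<partial>M) \<le> ennreal (C0 * min (fou.nu A) (sqrt (fou.nu A) / t powr fou.rate_exponent))"
      using fou.occupation_deviation_bound[OF t0] by blast
    have "(\<integral>\<^sup>+\<omega>. ennreal \<bar>measure (occupation_measure Y t \<omega>) A - measure \<nu> A\<bar> \<partial>M)
        \<le> ennreal (C0 * min (measure \<nu> A) (sqrt (measure \<nu> A) / t powr \<gamma>))" if t: "t \<ge> t0" and A: "A \<in> sets borel" for t A
    proof -
      have "(\<integral>\<^sup>+\<omega>. ennreal \<bar>measure (occupation_measure Y t \<omega>) A - measure \<nu> A\<bar> \<partial>M) = (\<integral>\<^sup>+\<omega>. ennreal \<bar>fou.occupation_fraction t \<omega> A - fou.nu A\<bar> \<partial>M)"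
      proof (rule nn_integral_cong_AE)
        show "AE \<omega> in M. ennreal \<bar>measure (occupation_measure Y t \<omega>) A - measure \<nu> A\<bar> = ennreal \<bar>fou.occupation_fraction t \<omega> A - fou.nu A\<bar>"
          using AEN AE_space
        proof eventually_elim
          case (elim \<omega>)
          then show ?case using t t0 fou.measure_occupation_measure[of \<omega> t A] A by (simp add: occupation_fraction_eq nuA)
        qed
      qed
      then show ?thesis using C0(2)[OF t A] by (simp add: nuA g1)
    qed
    moreover have "(\<integral>\<^sup>+\<xi>. ennreal (\<bar>\<xi>\<bar> powr q) \<partial>\<nu>) < \<infinity>"
      unfolding nu by (rule fou.stationary_moment_finite[OF q])
    ultimately show "\<exists>C0>0. (\<forall>t\<ge>t0. \<forall>A\<in>sets borel.
          (\<integral>\<^sup>+\<omega>. ennreal \<bar>measure (occupation_measure Y t \<omega>) A - measure \<nu> A\<bar> \<partial>M)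
            \<le> ennreal (C0 * min (measure \<nu> A) (sqrt (measure \<nu> A) / t powr \<gamma>))) \<and>
        (\<integral>\<^sup>+\<xi>. ennreal (\<bar>\<xi>\<bar> powr q) \<partial>\<nu>) < \<infinity>"
      using C0(1) by blast
  next
    fix p t0 :: real assume p: "0 < p" and t0: "0 < t0"
    have "Lp_norm M p (\<lambda>\<omega>. wasserstein p (occupation_measure Y t \<omega>) \<nu>) = Lp_norm M p (\<lambda>\<omega>. wasserstein p (occupation_measure X t \<omega>) (distr M borel (X 0)))" for t
    proof -
      have "(\<integral>\<^sup>+\<omega>. ennpowr (wasserstein p (occupation_measure Y t \<omega>) \<nu>) p \<partial>M) = (\<integral>\<^sup>+\<omega>. ennpowr (wasserstein p (occupation_measure X t \<omega>) (distr M borel (X 0))) p \<partial>M)"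
        using AEN by (intro nn_integral_cong_AE) (auto elim!: eventually_mono simp: occupation_fraction_eq nu)
      then show ?thesis by (simp add: Lp_norm_def)
    qed
    then show "\<exists>C>0. \<forall>t\<ge>t0. Lp_norm M p (\<lambda>\<omega>. wasserstein p (occupation_measure Y t \<omega>) \<nu>)
          \<le> ennreal (C * t powr (- (1 / p) * min (1 / 2) (1 - H)))"
      using fou.wasserstein_rate[OF p t0] unfolding g2 by simp
  qed
qed

end
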